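(* For every $N\geq1$, the numbers $|\mathrm{Av}_n(12453)|$ for $0\leq n\leq N$ can be computed using $O(N^7)$ integer arithmetic operations and $O(N^4)$ stored integers. The bit complexity is $O(N^7M(N\log N))$, and the bit storage is $O(N^5\log N)$.
   Context: Write $[n]=\{1,\ldots,n\}$. A permutation $\pi=\pi_1\cdots\pi_n$ of $[n]$ contains a permutation $\tau$ of $[k]$ if there are indices $1\leq i_1<\cdots<i_k\leq n$ such that $\pi_{i_1},\ldots,\pi_{i_k}$ has the same relative order as $\tau$; otherwise $\pi$ avoids $\tau$. $\mathrm{Av}_n(\tau)$ is the set of permutations of $[n]$ that avoid $\tau$. The operation count treats each integer addition or multiplication as one step; the bit complexity counts operations on single bits. $M(b)$ denotes the cost of multiplying two $b$-bit integers. *)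

theory Defs
  imports
    "HOL-Library.Log_Nat"
    "HOL-Library.Landau_Symbols"
    "HOL-Combinatorics.Multiset_Permutations"
begin

section \<open>Pattern avoidance\<close>

text \<open>Permutations are in one-line notation. List positions start at 0, entries at 1.\<close>

definition contains_pattern :: "nat list \<Rightarrow> nat list \<Rightarrow> bool" where
  "contains_pattern \<pi> \<tau> \<longleftrightarrow>
     (\<exists>f. strict_mono_on {..<length \<tau>} f \<and>
          (\<forall>a<length \<tau>. f a < length \<pi>) \<and>
          (\<forall>a<length \<tau>. \<forall>b<length \<tau>. \<pi> ! f a < \<pi> ! f b \<longleftrightarrow> \<tau> ! a < \<tau> ! b))"

definition Av :: "nat \<Rightarrow> nat list \<Rightarrow> nat list set" where
  "Av n \<tau> = {\<pi> \<in> permutations_of_set {1..n}. \<not> contains_pattern \<pi> \<tau>}"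


section \<open>A random access machine over the integers\<close>

text \<open>
  A program uses finitely many registers, together with a memory of integer cells that is accessed
  by indirect addressing only. Arithmetic is restricted to addition, subtraction and multiplication
  of unbounded integers. A store is a finite partial map whose domain consists of the locations
  that are in use; a location not in use reads as 0. Locations are never released.
\<close>

type_synonym reg = nat

datatype loc = Reg reg | Mem int

type_synonym store = "loc \<rightharpoonup> int"

definition val :: "store \<Rightarrow> loc \<Rightarrow> int" where
  "val s l = (case s l of None \<Rightarrow> 0 | Some v \<Rightarrow> v)"

text \<open>
  The target comes first: \<open>Add r x y\<close> sets \<open>r\<close> to \<open>x + y\<close>, \<open>Load r x\<close> sets \<open>r\<close> to the content of the
  memory cell whose address is in \<open>x\<close>, and \<open>Store x y\<close> writes \<open>y\<close> to the memory cell whose address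
  is in \<open>x\<close>. \<open>Test\<close> is the sign test performed by conditionals and loops.
\<close>

datatype instr =
    Const reg int
  | Copy reg reg
  | Add reg reg reg
  | Sub reg reg reg
  | Mul reg reg reg
  | Load reg reg
  | Store reg reg
  | Test reg

fun effect :: "instr \<Rightarrow> store \<Rightarrow> store" where
  "effect (Const r c) s = s(Reg r \<mapsto> c)"
| "effect (Copy r x) s = s(Reg r \<mapsto> val s (Reg x))"
| "effect (Add r x y) s = s(Reg r \<mapsto> val s (Reg x) + val s (Reg y))"
| "effect (Sub r x y) s = s(Reg r \<mapsto> val s (Reg x) - val s (Reg y))"
| "effect (Mul r x y) s = s(Reg r \<mapsto> val s (Reg x) * val s (Reg y))"
| "effect (Load r x) s = s(Reg r \<mapsto> val s (Mem (val s (Reg x))))"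
| "effect (Store x y) s = s(Mem (val s (Reg x)) \<mapsto> val s (Reg y))"
| "effect (Test r) s = s"

datatype com =
    Instr instr
  | Seq com com
  | If reg com com
  | While reg com

text \<open>
  \<open>run c s tr t\<close>: started in store \<open>s\<close>, program \<open>c\<close> terminates in store \<open>t\<close>, and \<open>tr\<close> lists the
  executed instructions in order, each with the store in which it is executed.
\<close>

type_synonym trace = "(instr \<times> store) list"

inductive run :: "com \<Rightarrow> store \<Rightarrow> trace \<Rightarrow> store \<Rightarrow> bool" where
  Instr: "run (Instr i) s [(i, s)] (effect i s)"
| Seq: "run c1 s tr1 s' \<Longrightarrow> run c2 s' tr2 t \<Longrightarrow> run (Seq c1 c2) s (tr1 @ tr2) t"
| IfTrue: "val s (Reg r) > 0 \<Longrightarrow> run c1 s tr t \<Longrightarrow> run (If r c1 c2) s ((Test r, s) # tr) t"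
| IfFalse: "\<not> val s (Reg r) > 0 \<Longrightarrow> run c2 s tr t \<Longrightarrow> run (If r c1 c2) s ((Test r, s) # tr) t"
| WhileFalse: "\<not> val s (Reg r) > 0 \<Longrightarrow> run (While r c) s [(Test r, s)] s"
| WhileTrue: "val s (Reg r) > 0 \<Longrightarrow> run c s tr1 s' \<Longrightarrow> run (While r c) s' tr2 t \<Longrightarrow>
    run (While r c) s ((Test r, s) # tr1 @ tr2) t"

lemma run_deterministic:
  assumes "run c s tr t" and "run c s tr' t'"
  shows "tr' = tr \<and> t' = t"
  using assms
proof (induction arbitrary: tr' t' rule: run.induct)
  case (Instr i s)
  then show ?case by cases simp
next
  case (Seq c1 s tr1 s' c2 tr2 t)
  from Seq.prems obtain ta sa tb where "run c1 s ta sa" "run c2 sa tb t'" "tr' = ta @ tb"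
    by cases simp
  with Seq.IH show ?case by metis
next
  case (IfTrue s r c1 tr t c2)
  from IfTrue.prems IfTrue.hyps obtain ta where "run c1 s ta t'" "tr' = (Test r, s) # ta"
    by cases simp_all
  with IfTrue.IH show ?case by metis
next
  case (IfFalse s r c2 tr t c1)
  from IfFalse.prems IfFalse.hyps obtain ta where "run c2 s ta t'" "tr' = (Test r, s) # ta"
    by cases simp_all
  with IfFalse.IH show ?case by metis
next
  case (WhileFalse s r c)
  from WhileFalse.prems WhileFalse.hyps show ?case by cases simp_all
next
  case (WhileTrue s r c tr1 s' tr2 t)
  from WhileTrue.prems WhileTrue.hyps obtain ta sa tb
    where "run c s ta sa" "run (While r c) sa tb t'" "tr' = (Test r, s) # ta @ tb"
    by cases simp_all
  with WhileTrue.IH show ?case by metis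
qed

definition initial_store :: "nat \<Rightarrow> store" where
  "initial_store N = [Reg 0 \<mapsto> int N]"


section \<open>Resources of a run\<close>

text \<open>
  Every executed instruction is one operation. Besides the arithmetic operations this counts
  data movement and sign tests, so that no work is free.
\<close>

definition operations :: "trace \<Rightarrow> nat" where
  "operations tr = length tr"

text \<open>One bit is for the sign.\<close>

definition bits :: "int \<Rightarrow> nat" where
  "bits x = Suc (floorlog 2 (nat \<bar>x\<bar>))"

text \<open>
  The parameter \<open>M\<close> is the cost of the integer multiplication procedure in use: \<open>M b\<close> bit operations
  for two integers of at most \<open>b\<close> bits. All other instructions are charged linearly in the number
  of bits they handle, where memory accesses also handle the address.
\<close>

fun bit_cost :: "(nat \<Rightarrow> real) \<Rightarrow> instr \<Rightarrow> store \<Rightarrow> real" where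
  "bit_cost M (Const r c) s = bits c"
| "bit_cost M (Copy r x) s = bits (val s (Reg x))"
| "bit_cost M (Add r x y) s = bits (val s (Reg x)) + bits (val s (Reg y))"
| "bit_cost M (Sub r x y) s = bits (val s (Reg x)) + bits (val s (Reg y))"
| "bit_cost M (Mul r x y) s = M (max (bits (val s (Reg x))) (bits (val s (Reg y))))"
| "bit_cost M (Load r x) s = bits (val s (Reg x)) + bits (val s (Mem (val s (Reg x))))"
| "bit_cost M (Store x y) s = bits (val s (Reg x)) + bits (val s (Reg y))"
| "bit_cost M (Test r) s = bits (val s (Reg r))"

definition bit_operations :: "(nat \<Rightarrow> real) \<Rightarrow> trace \<Rightarrow> real" where
  "bit_operations M tr = (\<Sum>(i, s)\<leftarrow>tr. bit_cost M i s)"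

text \<open>
  The usual regularity conditions on a multiplication cost. The last one makes
  \<open>M (O(b)) = O(M b)\<close>, without which a bound such as \<open>O(M (N log N))\<close> would depend on the base of
  the logarithm.
\<close>

definition multiplication_cost :: "(nat \<Rightarrow> real) \<Rightarrow> bool" where
  "multiplication_cost M \<longleftrightarrow>
     mono M \<and> (\<forall>b. real b \<le> M b) \<and> (\<exists>C. \<forall>b. M (2 * b) \<le> C * M b)"

definition visited :: "trace \<Rightarrow> store \<Rightarrow> store set" where
  "visited tr t = insert t (snd ` set tr)"

definition stored_integers :: "trace \<Rightarrow> store \<Rightarrow> nat" where
  "stored_integers tr t = Max ((\<lambda>s. card (dom s)) ` visited tr t)"

text \<open>
  A memory cell is charged for its address as well, so that nothing can be stored for free in the
  choice of the addresses in use. Register names are fixed by the program.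
\<close>

fun location_bits :: "loc \<Rightarrow> nat" where
  "location_bits (Reg r) = 0"
| "location_bits (Mem a) = bits a"

definition store_bits :: "store \<Rightarrow> nat" where
  "store_bits s = (\<Sum>l\<in>dom s. location_bits l + bits (val s l))"

definition bit_storage :: "trace \<Rightarrow> store \<Rightarrow> nat" where
  "bit_storage tr t = Max (store_bits ` visited tr t)"

end

theory Submission
  imports Defs "HOL-Library.Sublist"
begin

text \<open>
  Build permutations by inserting the values \<open>n, n - 1, \<dots>, 1\<close>, so that each new value is a minimum.
  Since 12453 is a new minimum followed by 1342, a site is forbidden iff a 1342 lies to its right.
  Let \<open>p\<close> be the rightmost start of a 1342 and \<open>q\<close> the rightmost start of a 231. The sites between
  \<open>p\<close> and \<open>q\<close> matter only through their number \<open>a\<close>, and the 231-avoiding word after \<open>q\<close> only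
  through the lengths of its decreasing runs. A minimum inserted between \<open>p\<close> and \<open>q\<close> becomes the new
  \<open>p\<close>; one inserted after an ascent of the word turns the last ascent bottom before it into \<open>q\<close>, so
  that all runs up to that one are popped and their sites join the first kind. The runs thus form a
  stack, and cutting a history at the time when its first run is popped gives a recurrence for
  four-parameter transfer numbers in which each value is a sum of cubically many products. A
  nested-loop program tabulates these numbers; they are bounded by \<open>(2 K\<^sup>3)\<^sup>K\<close> with \<open>K = N + 1\<close>,
  hence have \<open>O(N log N)\<close> bits.
\<close>

section \<open>Inserting a new minimum\<close>

text \<open>The list of run lengths is unbounded, so tabulating \<open>runs_count\<close> itself
  would need exponentially many states. What saves the count is that a run, together with the runs
  split off from it, communicates with the rest of the history through two numbers only: the
  \<open>a\<close> sites present when it comes to the top and the \<open>b\<close> sites present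
  once it is popped. Runs deeper in the stack are frozen meanwhile and need not be parameters. This
  leaves \<open>m\<close>, \<open>a\<close>, \<open>e\<close>, \<open>b\<close> and one bit, hence
  O(K^4) table entries, each obtained by summing over a split position, a division of the insertions
  and an intermediate number of sites. The factor \<open>2 * K ^ 3\<close> in the size bound is the
  number of summands in one step of the recurrence. The bit bounds do not follow individual numbers:
  they come from one uniform bound on every store of the run.\<close>

lemma subseq_conv_nth:
  "subseq xs ys \<longleftrightarrow> (\<exists>f. strict_mono_on {..<length xs} f \<and>
     (\<forall>a<length xs. f a < length ys \<and> ys ! f a = xs ! a))"
proof
  assume "subseq xs ys"
  then show "\<exists>f. strict_mono_on {..<length xs} f \<and>
     (\<forall>a<length xs. f a < length ys \<and> ys ! f a = xs ! a)"
  proof induction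
    case (list_emb_Nil ys)
    then show ?case by (auto simp: strict_mono_on_def)
  next
    case (list_emb_Cons xs ys y)
    then obtain f where "strict_mono_on {..<length xs} f"
      "\<forall>a<length xs. f a < length ys \<and> ys ! f a = xs ! a" by blast
    then show ?case
      by (intro exI[of _ "Suc \<circ> f"]) (auto simp: strict_mono_on_def)
  next
    case (list_emb_Cons2 x y xs ys)
    then obtain f where f: "strict_mono_on {..<length xs} f"
      "\<forall>a<length xs. f a < length ys \<and> ys ! f a = xs ! a" by blast
    show ?case
      using f list_emb_Cons2.hyps
      by (intro exI[of _ "case_nat 0 (Suc \<circ> f)"])
         (auto simp: strict_mono_on_def less_Suc_eq_0_disj nth_Cons split: nat.splits)
  qed
next
  assume "\<exists>f. strict_mono_on {..<length xs} f \<and>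
     (\<forall>a<length xs. f a < length ys \<and> ys ! f a = xs ! a)"
  then obtain f where f: "strict_mono_on {..<length xs} f"
     "\<And>a. a < length xs \<Longrightarrow> f a < length ys \<and> ys ! f a = xs ! a" by blast
  then show "subseq xs ys"
  proof (induction xs arbitrary: ys f)
    case Nil
    then show ?case by simp
  next
    case (Cons x xs)
    have f0: "f 0 < length ys" "ys ! f 0 = x" using Cons.prems(2)[of 0] by auto
    have less: "f 0 < f (Suc a)" if "a < length xs" for a
      using Cons.prems(1) that by (auto simp: strict_mono_on_def)
    \<comment> \<open>The first index cuts \<open>ys\<close>; the other indices are measured from
      just behind the cut.\<close>
    have "subseq xs (drop (Suc (f 0)) ys)"
    proof (rule Cons.IH[of "\<lambda>a. f (Suc a) - Suc (f 0)"])
      show "strict_mono_on {..<length xs} (\<lambda>a. f (Suc a) - Suc (f 0))"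
        unfolding strict_mono_on_def
      proof (intro allI impI)
        fix r t assume rt: "r \<in> {..<length xs} \<and> t \<in> {..<length xs} \<and> r < t"
        then have "f (Suc r) < f (Suc t)"
          using Cons.prems(1) by (auto simp: strict_mono_on_def)
        then show "f (Suc r) - Suc (f 0) < f (Suc t) - Suc (f 0)"
          using less[of r] rt by auto
      qed
    next
      fix a assume "a < length xs"
      then show "f (Suc a) - Suc (f 0) < length (drop (Suc (f 0)) ys) \<and>
        drop (Suc (f 0)) ys ! (f (Suc a) - Suc (f 0)) = xs ! a"
        using less[of a] Cons.prems(2)[of "Suc a"] by auto
    qed
    then have "subseq (x # xs) (x # drop (Suc (f 0)) ys)" by simp
    moreover have "x # drop (Suc (f 0)) ys = drop (f 0) ys"
      using f0 Cons_nth_drop_Suc[of "f 0" ys] by simp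
    ultimately have "subseq (x # xs) (drop (f 0) ys)" by metis
    then show ?case
      by (metis append_take_drop_id subseq_drop_many)
  qed
qed

text \<open>\<open>subseq\<close> replaces the index functions of \<open>contains_pattern\<close>,
  because words are cut and glued below and \<open>subseq\<close> is compatible with append. Only
  neighbouring values of the pattern are compared; the other comparisons follow by
  transitivity.\<close>

definition contains231 :: "nat list \<Rightarrow> bool" where
  "contains231 xs \<longleftrightarrow> (\<exists>x y z. subseq [x, y, z] xs \<and> z < x \<and> x < y)"

definition contains1342 :: "nat list \<Rightarrow> bool" where
  "contains1342 xs \<longleftrightarrow> (\<exists>w x y z. subseq [w, x, y, z] xs \<and> w < z \<and> z < x \<and> x < y)"

definition contains12453 :: "nat list \<Rightarrow> bool" where
  "contains12453 xs \<longleftrightarrow>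
     (\<exists>v w x y z. subseq [v, w, x, y, z] xs \<and> v < w \<and> w < z \<and> z < x \<and> x < y)"

lemma all_less_5: "(\<forall>a<5. P a) \<longleftrightarrow> P 0 \<and> P 1 \<and> P 2 \<and> P 3 \<and> P (4::nat)"
  by (auto simp: numeral_eq_Suc less_Suc_eq)

lemma contains_pattern_12453: "contains_pattern xs [1, 2, 4, 5, 3] \<longleftrightarrow> contains12453 xs"
proof
  assume "contains_pattern xs [1, 2, 4, 5, 3]"
  then obtain f where f: "strict_mono_on {..<5} f" "\<And>a. a < 5 \<Longrightarrow> f a < length xs"
    and ord: "\<And>a b. a < 5 \<Longrightarrow> b < 5 \<Longrightarrow>
      xs ! f a < xs ! f b \<longleftrightarrow> [1, 2, 4, 5, 3 :: nat] ! a < [1, 2, 4, 5, 3] ! b"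
    unfolding contains_pattern_def by (auto simp: numeral_eq_Suc)
  have "subseq (map (\<lambda>a. xs ! f a) [0..<5]) xs"
    unfolding subseq_conv_nth using f by (intro exI[of _ f]) auto
  then have "subseq [xs ! f 0, xs ! f 1, xs ! f 2, xs ! f 3, xs ! f 4] xs"
    by (simp add: upt_rec numeral_eq_Suc)
  moreover have "xs ! f 0 < xs ! f 1" "xs ! f 1 < xs ! f 4" "xs ! f 4 < xs ! f 2" "xs ! f 2 < xs ! f 3"
    using ord[of 0 1] ord[of 1 4] ord[of 4 2] ord[of 2 3] by (simp_all add: numeral_eq_Suc)
  ultimately show "contains12453 xs"
    unfolding contains12453_def by blast
next
  assume "contains12453 xs"
  then obtain v w x y z where s: "subseq [v, w, x, y, z] xs"
    and o: "v < w" "w < z" "z < x" "x < y"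
    unfolding contains12453_def by blast
  then obtain f where f: "strict_mono_on {..<5} f"
    "\<forall>a<5. f a < length xs \<and> xs ! f a = [v, w, x, y, z] ! a"
    unfolding subseq_conv_nth by (auto simp: numeral_eq_Suc)
  have "\<forall>a<5. \<forall>b<5. xs ! f a < xs ! f b \<longleftrightarrow> [1, 2, 4, 5, 3 :: nat] ! a < [1, 2, 4, 5, 3] ! b"
    using f(2) o unfolding all_less_5 by (simp add: numeral_eq_Suc)
  then show "contains_pattern xs [1, 2, 4, 5, 3]"
    unfolding contains_pattern_def using f by (intro exI[of _ f]) (simp add: eval_nat_numeral)
qed

text \<open>An occurrence that uses the inserted entry is cut by it into a left and a right part. In
  the lemmas on new minima, minimality then dictates which pattern entry \<open>u\<close>
  plays.\<close>

lemma subseq_insertE: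
  assumes "subseq ps (xs @ u # ys)"
  obtains "subseq ps (xs @ ys)"
  | p1 p2 where "ps = p1 @ u # p2" "subseq p1 xs" "subseq p2 ys"
proof -
  from assms obtain q1 q2 where q: "ps = q1 @ q2" "subseq q1 xs" "subseq q2 (u # ys)"
    by (auto simp: subseq_append_iff)
  show ?thesis
  proof (cases "subseq q2 ys")
    case True
    then show ?thesis using q that(1) by (auto intro: list_emb_append_mono)
  next
    case False
    with q(3) obtain p2 where "q2 = u # p2" "subseq p2 ys"
      by (cases q2) (auto split: if_splits elim: list_emb.cases)
    then show ?thesis using q that(2) by blast
  qed
qed

lemma subseq_insert: "subseq (xs @ ys) (xs @ u # ys)"
  by (intro list_emb_append_mono) auto

lemma contains231_mono: "contains231 xs \<Longrightarrow> subseq xs ys \<Longrightarrow> contains231 ys"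
  unfolding contains231_def by (meson subseq_order.trans)

lemma contains1342_mono: "contains1342 xs \<Longrightarrow> subseq xs ys \<Longrightarrow> contains1342 ys"
  unfolding contains1342_def by (meson subseq_order.trans)

lemma contains12453_mono: "contains12453 xs \<Longrightarrow> subseq xs ys \<Longrightarrow> contains12453 ys"
  unfolding contains12453_def by (meson subseq_order.trans)

lemma subseq_set: "subseq ps xs \<Longrightarrow> set ps \<subseteq> set xs"
  by (metis set_nths_subset subseq_conv_nths)

lemma subseq_insert_min_le:
  assumes "subseq ps (xs @ u # ys)" and "\<forall>x\<in>set (xs @ ys). u < x" and "p \<in> set ps"
  shows "u \<le> (p :: nat)"
proof -
  have "p \<in> insert u (set (xs @ ys))" using subseq_set[OF assms(1)] assms(3) by auto
  then show ?thesis using assms(2) by (auto intro: less_imp_le)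
qed

text \<open>A new minimum can only play the 1 of a 231, so the 2 and the 3 form an ascent in front
  of it.\<close>

lemma contains231_insert_min:
  assumes "contains231 (xs @ u # ys)" and min: "\<forall>x\<in>set (xs @ ys). u < x"
  shows "contains231 (xs @ ys) \<or> (\<exists>x y. subseq [x, y] xs \<and> x < y)"
proof -
  from assms obtain x y z where s: "subseq [x, y, z] (xs @ u # ys)" "z < x" "x < y"
    unfolding contains231_def by blast
  from s(1) show ?thesis
  proof (cases rule: subseq_insertE)
    case 1
    then show ?thesis using s unfolding contains231_def by blast
  next
    case (2 p1 p2)
    have "u \<le> z" using subseq_insert_min_le[OF s(1) min] by simp
    then have "p1 = [x, y]"
      using 2(1) s(2,3) by (auto simp: Cons_eq_append_conv)
    then show ?thesis using 2 s by blast
  qed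
qed

text \<open>The minimum must play the 1, which comes first in 1342; what follows it is a
  231.\<close>

lemma contains1342_insert_min:
  assumes "contains1342 (xs @ u # ys)" and min: "\<forall>x\<in>set (xs @ ys). u < x"
  shows "contains1342 (xs @ ys) \<or> contains231 ys"
proof -
  from assms obtain w x y z where s: "subseq [w, x, y, z] (xs @ u # ys)" "w < z" "z < x" "x < y"
    unfolding contains1342_def by blast
  from s(1) show ?thesis
  proof (cases rule: subseq_insertE)
    case 1
    then show ?thesis using s unfolding contains1342_def by blast
  next
    case (2 p1 p2)
    have "u \<le> w" using subseq_insert_min_le[OF s(1) min] by simp
    then have "p2 = [x, y, z]"
      using 2(1) s(2-) by (auto simp: Cons_eq_append_conv)
    then show ?thesis using 2 s unfolding contains231_def by blast
  qed
qed

text \<open>Again \<open>u\<close> must play the leading 1. Conversely it completes any 1342 to its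
  right, so the test is exact.\<close>

lemma contains12453_insert_min:
  assumes "\<not> contains12453 (xs @ ys)" and min: "\<forall>x\<in>set (xs @ ys). u < x"
  shows "contains12453 (xs @ u # ys) \<longleftrightarrow> contains1342 ys"
proof
  assume "contains12453 (xs @ u # ys)"
  then obtain v w x y z where s: "subseq [v, w, x, y, z] (xs @ u # ys)"
    "v < w" "w < z" "z < x" "x < y"
    unfolding contains12453_def by blast
  from s(1) show "contains1342 ys"
  proof (cases rule: subseq_insertE)
    case 1
    then show ?thesis using s assms(1) unfolding contains12453_def by blast
  next
    case (2 p1 p2)
    have "u \<le> v" using subseq_insert_min_le[OF s(1) min] by simp
    then have "p2 = [w, x, y, z]"
      using 2(1) s(2-) by (auto simp: Cons_eq_append_conv)
    then show ?thesis using 2 s unfolding contains1342_def by blast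
  qed
next
  assume "contains1342 ys"
  then obtain w x y z where s: "subseq [w, x, y, z] ys" "w < z" "z < x" "x < y"
    unfolding contains1342_def by blast
  moreover have "u < w" using subseq_set[OF s(1)] min by auto
  moreover have "subseq [u, w, x, y, z] (xs @ u # ys)"
    using s(1) by (intro subseq_drop_many) simp
  ultimately show "contains12453 (xs @ u # ys)"
    unfolding contains12453_def by blast
qed

section \<open>Runs of the word after the last 231\<close>

text \<open>\<open>Suc k\<close> is the next value, so \<open>k\<close> is the number of insertions
  still to come after it. Pruning at every insertion loses nothing: the word at an intermediate
  stage is a subsequence of the final permutation.\<close>

primrec extensions :: "nat \<Rightarrow> nat list \<Rightarrow> nat" where
  "extensions 0 xs = 1"
| "extensions (Suc k) xs =
     (\<Sum>s\<le>length xs. let ys = take s xs @ Suc k # drop s xs in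
        if contains12453 ys then 0 else extensions k ys)"

text \<open>
  In state \<open>a, ds\<close> the number of sites before \<open>q\<close> is \<open>a\<close> and \<open>ds\<close> lists the run lengths of the word
  after \<open>q\<close>. A minimum inserted after \<open>i\<close> entries of a run of length \<open>d\<close> leaves runs of lengths
  \<open>i + 1\<close> and \<open>d - i\<close>; the latter may be 0, and such empty runs are harmless. The site in front of a
  run is the site after the preceding run, so \<open>i = 0\<close> is counted for the first run only.
\<close>

fun passive_sum :: "(nat \<Rightarrow> nat list \<Rightarrow> nat) \<Rightarrow> nat \<Rightarrow> nat list \<Rightarrow> nat" where
  "passive_sum h a [] = 0"
| "passive_sum h a (d # ds) =
     (\<Sum>i<d. h a (Suc (Suc i) # (d - Suc i) # ds)) + passive_sum h (a + d) ds"

primrec runs_count :: "nat \<Rightarrow> nat \<Rightarrow> nat list \<Rightarrow> nat" where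
  "runs_count 0 a ds = 1"
| "runs_count (Suc n) a ds =
     (\<Sum>i<a. runs_count n (Suc i) ds) + runs_count n a (1 # ds) + passive_sum (runs_count n) a ds"

text \<open>The prefix \<open>w\<close> is carried along because runs may be empty: the ascent in
  front of a run is measured from the last entry that actually precedes it.\<close>

fun runs :: "nat list \<Rightarrow> nat list list \<Rightarrow> bool" where
  "runs w [] \<longleftrightarrow> True"
| "runs w (r # rs) \<longleftrightarrow> sorted_wrt (>) r \<and> (w \<noteq> [] \<and> r \<noteq> [] \<longrightarrow> last w < hd r) \<and> runs (w @ r) rs"

text \<open>
  A permutation is split as \<open>P @ L @ w\<close> with \<open>p\<close> the last entry of \<open>P\<close> and \<open>q\<close> the last entry of \<open>L\<close>,
  where either part is empty if \<open>p\<close> or \<open>q\<close> does not exist.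
\<close>

definition good :: "nat list \<Rightarrow> nat list \<Rightarrow> nat list \<Rightarrow> bool" where
  "good P L w \<longleftrightarrow> \<not> contains231 w \<and> \<not> contains1342 (L @ w) \<and>
     (L \<noteq> [] \<longrightarrow> (\<exists>y z. subseq [y, z] w \<and> z < last L \<and> last L < y)) \<and>
     (P \<noteq> [] \<longrightarrow> (\<exists>x y z. subseq [x, y, z] (L @ w) \<and> last P < z \<and> z < x \<and> x < y))"

text \<open>Only the last entry of the prefix is ever compared, and an entry below all runs passes
  every comparison.\<close>

lemma runs_change_prefix:
  assumes "runs w rs" and "w' = [] \<or> last w' = u \<or> w \<noteq> [] \<and> last w' = last w"
    and "\<forall>x\<in>set (concat rs). u < x"
  shows "runs w' rs"
  using assms
proof (induction rs arbitrary: w w')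
  case Nil
  then show ?case by simp
next
  case (Cons r rs)
  have "runs (w' @ r) rs"
    by (rule Cons.IH[of "w @ r"]) (cases "r = []"; use Cons.prems in auto)+
  then show ?case using Cons.prems by (cases r) auto
qed

lemma not_contains_mono:
  "\<not> contains231 ys \<Longrightarrow> subseq xs ys \<Longrightarrow> \<not> contains231 xs"
  "\<not> contains1342 ys \<Longrightarrow> subseq xs ys \<Longrightarrow> \<not> contains1342 xs"
  using contains231_mono contains1342_mono by blast+

text \<open>The last entry of \<open>L\<close> starts a 231 whose other two entries lie in
  \<open>w\<close>, and \<open>u\<close> is below all three. Inserted in front of that entry,
  \<open>u\<close> starts a 1342, which is why it ends the new first part.\<close>

lemma good_cut:
  assumes g: "good P L w" and k: "k < length L" and min: "\<forall>x\<in>set (L @ w). u < x"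
  shows "good (P @ take k L @ [u]) (drop k L) w"
proof -
  have ne: "L \<noteq> []" "drop k L \<noteq> []" using k by auto
  have lst: "last (drop k L) = last L" using k by (simp add: last_drop)
  obtain y z where yz: "subseq [y, z] w" "z < last L" "last L < y"
    using g ne unfolding good_def by blast
  have "subseq ([last L] @ [y, z]) (drop k L @ w)"
    using last_in_set[OF ne(2)] yz(1) unfolding lst
    by (intro list_emb_append_mono) (simp_all only: subseq_singleton_left)
  then have s: "subseq [last L, y, z] (drop k L @ w)" by simp
  have "u < z" using min subseq_set[OF yz(1)] by auto
  moreover have "\<not> contains1342 (drop k L @ w)"
  proof (rule not_contains_mono(2))
    show "\<not> contains1342 (L @ w)" using g unfolding good_def by blast
    show "subseq (drop k L @ w) (L @ w)"
      by (intro list_emb_append_mono suffix_imp_subseq suffix_drop) simp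
  qed
  ultimately show ?thesis
    using g yz s lst ne unfolding good_def by auto
qed

lemma sorted_not_ascent:
  assumes "sorted_wrt (>) xs" "subseq [x, y] xs"
  shows "\<not> x < (y :: nat)"
proof -
  obtain f where f: "strict_mono_on {..<length [x, y]} f"
     "\<forall>a<length [x, y]. f a < length xs \<and> xs ! f a = [x, y] ! a"
    using assms(2) unfolding subseq_conv_nth by blast
  then have "f 0 < f 1" "f 1 < length xs" "xs ! f 0 = x" "xs ! f 1 = y"
    by (auto simp: strict_mono_on_def)
  then have "y < x" using assms(1) unfolding sorted_wrt_iff_nth_less by blast
  then show ?thesis by simp
qed

text \<open>If runs \<open>pre\<close> are skipped, then \<open>last pre\<close>,
  \<open>hd x\<close>, \<open>u\<close> form a 231, so \<open>last pre\<close> is the new q and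
  \<open>pre\<close> moves into the middle part. If none is skipped, the old q keeps its witness. A
  new 231 in the last part would need an ascent inside the decreasing word \<open>x\<close>.\<close>

lemma good_insert:
  assumes g: "good P L (pre @ x @ y)" and x: "sorted_wrt (>) x"
    and pre: "pre \<noteq> [] \<Longrightarrow> x \<noteq> [] \<and> last pre < hd x"
    and min: "\<forall>v\<in>set (L @ pre @ x @ y). u < v"
  shows "good P (L @ pre) (x @ u # y)"
proof -
  have "subseq (x @ y) (pre @ x @ y)" "subseq y (pre @ x @ y)"
    using subseq_drop_many[of "x @ y" "x @ y" pre] subseq_drop_many[of y y "pre @ x"] by simp_all
  then have "\<not> contains231 (x @ y)" "\<not> contains231 y"
    using g not_contains_mono(1) unfolding good_def by blast+
  then have 1: "\<not> contains231 (x @ u # y)"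
    using contains231_insert_min[of x u y] sorted_not_ascent[OF x] min by auto
  have 2: "\<not> contains1342 ((L @ pre) @ x @ u # y)"
    using contains1342_insert_min[of "L @ pre @ x" u y] g \<open>\<not> contains231 y\<close> min
    by (auto simp: good_def)
  have ins: "subseq (x @ y) (x @ u # y)" by (rule subseq_insert)
  have 3: "\<exists>y' z. subseq [y', z] (x @ u # y) \<and> z < last (L @ pre) \<and> last (L @ pre) < y'"
    if ne: "L @ pre \<noteq> []"
  proof (cases "pre = []")
    case True
    then obtain y' z where "subseq [y', z] (x @ y)" "z < last L" "last L < y'"
      using ne g unfolding good_def by auto
    moreover have "subseq [y', z] (x @ u # y)"
      using subseq_order.trans[OF calculation(1) ins] .
    ultimately show ?thesis using True by auto
  next
    case False
    with pre have "x \<noteq> []" "last pre < hd x" by auto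
    moreover have "u < last pre" using False min by auto
    moreover have "subseq ([hd x] @ [u]) (x @ u # y)"
      by (rule list_emb_append_mono) (use \<open>x \<noteq> []\<close> in \<open>auto simp: subseq_singleton_left\<close>)
    ultimately show ?thesis using False by auto
  qed
  have 4: "\<exists>x' y' z. subseq [x', y', z] ((L @ pre) @ x @ u # y) \<and> last P < z \<and> z < x' \<and> x' < y'"
    if ne: "P \<noteq> []"
  proof -
    obtain x' y' z where *: "subseq [x', y', z] (L @ pre @ x @ y)" "last P < z" "z < x'" "x' < y'"
      using ne g unfolding good_def by auto
    have "subseq [x', y', z] ((L @ pre @ x) @ u # y)"
      using subseq_order.trans[OF _ subseq_insert[of "L @ pre @ x" y u]] *(1) by simp
    then show ?thesis using * by auto
  qed
  show ?thesis using 1 2 3 4 unfolding good_def by blast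
qed

text \<open>The minimum extends the left half by a descent and makes a nonempty right half begin
  with an ascent. Later runs see in front of them either the old last entry or
  \<open>u\<close>.\<close>

lemma runs_insert:
  assumes "runs w (r # rs)" and min: "\<forall>v\<in>set (r @ concat rs). u < v"
  shows "runs [] ((take i r @ [u]) # drop i r # rs)"
proof -
  have r: "sorted_wrt (>) r" "runs (w @ r) rs" using assms(1) by auto
  have "sorted_wrt (>) (take i r @ [u])"
    using r(1) min by (auto simp: sorted_wrt_append sorted_wrt_take dest: in_set_takeD)
  moreover have "sorted_wrt (>) (drop i r)" using r(1) by (rule sorted_wrt_drop)
  moreover have "drop i r \<noteq> [] \<Longrightarrow> u < hd (drop i r)"
    using min hd_in_set[of "drop i r"] in_set_dropD[of "hd (drop i r)" i r] by simp
  moreover have "runs ((take i r @ [u]) @ drop i r) rs"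
    by (rule runs_change_prefix[OF r(2), where u = u]) (cases "i < length r"; use min in \<open>auto simp: last_drop last_append\<close>)+
  ultimately show ?thesis by simp
qed

definition extendable :: "nat \<Rightarrow> nat list \<Rightarrow> nat list \<Rightarrow> nat list list \<Rightarrow> bool" where
  "extendable k P L rs \<longleftrightarrow> good P L (concat rs) \<and> runs [] rs \<and>
     (\<forall>x\<in>set (P @ L @ concat rs). k < x) \<and> \<not> contains12453 (P @ L @ concat rs)"

text \<open>Everything to the right of the site lies in a word without 1342, so the insertion is
  allowed. When \<open>pre\<close> is nonempty, \<open>i > 0\<close> provides an entry of
  \<open>r\<close> before the minimum, which is the 3 of the new 231.\<close>

lemma extendable_insert:
  assumes "good P L (pre @ concat (r # rs))" and "runs pre (r # rs)"
    and min: "\<forall>x\<in>set (P @ L @ pre @ concat (r # rs)). Suc k < x"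
    and av: "\<not> contains12453 (P @ L @ pre @ concat (r # rs))"
    and i: "i \<le> length r" "i > 0 \<or> pre = []"
  shows "extendable k P (L @ pre) ((take i r @ [Suc k]) # drop i r # rs)"
proof -
  have split: "concat (r # rs) = take i r @ drop i r @ concat rs" by simp
  have x: "sorted_wrt (>) (take i r)" using assms(2) by (simp add: sorted_wrt_take)
  have "good P (L @ pre) (take i r @ Suc k # (drop i r @ concat rs))"
  proof (rule good_insert)
    show "good P L (pre @ take i r @ drop i r @ concat rs)" using assms(1) unfolding split .
    show "pre \<noteq> [] \<Longrightarrow> take i r \<noteq> [] \<and> last pre < hd (take i r)"
      using assms(2) i by (cases r) (auto simp: hd_take)
    show "\<forall>v\<in>set (L @ pre @ take i r @ drop i r @ concat rs). Suc k < v"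
      using min unfolding split by auto
  qed (rule x)
  moreover have "runs [] ((take i r @ [Suc k]) # drop i r # rs)"
    by (rule runs_insert[OF assms(2)]) (use min in auto)
  moreover have "\<not> contains12453 ((P @ L @ pre @ take i r) @ Suc k # (drop i r @ concat rs))"
  proof (subst contains12453_insert_min)
    show "\<not> contains12453 ((P @ L @ pre @ take i r) @ drop i r @ concat rs)"
      using av unfolding split by simp
    show "\<forall>x\<in>set ((P @ L @ pre @ take i r) @ drop i r @ concat rs). Suc k < x"
      using min unfolding split by auto
    show "\<not> contains1342 (drop i r @ concat rs)"
    proof (rule not_contains_mono(2))
      show "\<not> contains1342 (L @ pre @ concat (r # rs))" using assms(1) by (simp add: good_def)
      have "subseq (drop i r @ concat rs) ((L @ pre @ take i r) @ drop i r @ concat rs)"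
        by (rule subseq_drop_many) simp
      then show "subseq (drop i r @ concat rs) (L @ pre @ concat (r # rs))" unfolding split by simp
    qed
  qed
  moreover have "\<forall>x\<in>set (P @ L @ pre @ concat (r # rs)). k < x"
    using min Suc_lessD by blast
  ultimately show ?thesis
    unfolding extendable_def by (auto dest: in_set_takeD in_set_dropD)
qed

section \<open>Summing over the sites of a permutation\<close>

definition child :: "nat \<Rightarrow> nat list \<Rightarrow> nat \<Rightarrow> nat" where
  "child k xs s = (let ys = take s xs @ Suc k # drop s xs in
     if contains12453 ys then 0 else extensions k ys)"

lemma extensions_Suc: "extensions (Suc k) xs = (\<Sum>s\<le>length xs. child k xs s)"
  by (simp add: child_def)

lemma sum_lessThan_add:
  "(\<Sum>t<m + n. f t) = (\<Sum>t<m. f t) + (\<Sum>t<n. f (m + t))" for f :: "nat \<Rightarrow> nat"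
  by (induction n) (simp_all add: add.assoc)

text \<open>The runs are scanned from left to right; \<open>pre\<close> holds those already passed,
  which an insertion further right would pop, so that their sites count like those of
  \<open>L\<close>. The induction hypothesis for \<open>k\<close> enters as the assumption
  \<open>IH\<close>, because the induction here is on the list of runs.\<close>

lemma passive_sum_eq:
  assumes IH: "\<And>P L r rs. extendable k P L (r # rs) \<Longrightarrow>
      extensions k (P @ L @ concat (r # rs)) = h (length L) (map length (r # rs))"
    and "good P L (pre @ concat rs)" and "runs pre rs"
    and "\<forall>x\<in>set (P @ L @ pre @ concat rs). Suc k < x"
    and "\<not> contains12453 (P @ L @ pre @ concat rs)"
  shows "(\<Sum>t<length (concat rs). child k (P @ L @ pre @ concat rs)
            (length (P @ L @ pre) + Suc t))
    = passive_sum h (length L + length pre) (map length rs)"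
  using assms(2-)
proof (induction rs arbitrary: pre)
  case Nil
  then show ?case by simp
next
  case (Cons r rs)
  let ?xs = "P @ L @ pre @ concat (r # rs)"
  have len: "length (concat (r # rs)) = length r + length (concat rs)" by simp
  have "(\<Sum>t<length r. child k ?xs (length (P @ L @ pre) + Suc t)) =
    (\<Sum>t<length r. h (length L + length pre)
        (Suc (Suc t) # (length r - Suc t) # map length rs))"
  proof (rule sum.cong[OF refl])
    fix t assume "t \<in> {..<length r}"
    then have t: "t < length r" by simp
    have e: "extendable k P (L @ pre) ((take (Suc t) r @ [Suc k]) # drop (Suc t) r # rs)"
      by (rule extendable_insert) (use Cons.prems t in auto)
    have ys: "take (length (P @ L @ pre) + Suc t) ?xs @ Suc k # drop (length (P @ L @ pre) + Suc t) ?xs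
      = P @ (L @ pre) @ concat ((take (Suc t) r @ [Suc k]) # drop (Suc t) r # rs)"
      using t by (simp add: add.assoc flip: add_Suc_right)
    have "\<not> contains12453 (P @ (L @ pre) @ concat ((take (Suc t) r @ [Suc k]) # drop (Suc t) r # rs))"
      using e unfolding extendable_def by blast
    then show "child k ?xs (length (P @ L @ pre) + Suc t) =
        h (length L + length pre) (Suc (Suc t) # (length r - Suc t) # map length rs)"
      unfolding child_def Let_def ys using IH[OF e] t by simp
  qed
  moreover have "(\<Sum>t<length (concat rs). child k ?xs (length (P @ L @ pre) + Suc (length r + t))) =
    passive_sum h (length L + length pre + length r) (map length rs)"
    using Cons.IH[of "pre @ r"] Cons.prems by (simp add: add.assoc add.left_commute)
  moreover have "(\<Sum>t<length (concat (r # rs)). f t) =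
      (\<Sum>t<length r. f t) + (\<Sum>t<length (concat rs). f (length r + t))" for f :: "nat \<Rightarrow> nat"
    unfolding len by (rule sum_lessThan_add)
  ultimately show ?case by simp
qed

lemma extensions_eq:
  assumes "extendable k P L (r # rs)"
  shows "extensions k (P @ L @ concat (r # rs)) = runs_count k (length L) (map length (r # rs))"
  using assms
proof (induction k arbitrary: P L r rs)
  case 0
  then show ?case by simp
next
  case (Suc k)
  define w where "w = concat (r # rs)"
  let ?xs = "P @ L @ w"
  let ?ds = "map length (r # rs)"
  have g: "good P L w" and r: "runs [] (r # rs)" and min: "\<forall>x\<in>set ?xs. Suc k < x"
    and av: "\<not> contains12453 ?xs"
    using Suc.prems unfolding extendable_def w_def by blast+
  have min': "\<forall>x\<in>set ?xs. k < x" using min Suc_lessD by blast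
  \<comment> \<open>The entry \<open>last P\<close> lies to the right of each of these sites and
    starts a 1342, so they are all forbidden.\<close>
  have P: "child k ?xs s = 0" if "s < length P" for s
  proof -
    have "P \<noteq> []" using that by auto
    then obtain x y z where *: "subseq [x, y, z] (L @ w)" "last P < z" "z < x" "x < y"
      using g unfolding good_def by blast
    have "drop s P \<noteq> []" "last (drop s P) = last P" using that by (auto simp: last_drop)
    then have "subseq ([last P] @ [x, y, z]) (drop s P @ L @ w)"
      using *(1) last_in_set[OF \<open>drop s P \<noteq> []\<close>] unfolding \<open>last (drop s P) = last P\<close>
      by (intro list_emb_append_mono) (simp_all only: subseq_singleton_left)
    then have "contains1342 (drop s P @ L @ w)"
      using * unfolding contains1342_def by auto
    then have "contains12453 (take s P @ Suc k # drop s P @ L @ w)"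
      using min av by (subst contains12453_insert_min) (auto simp flip: append_assoc)
    then show ?thesis using that by (simp add: child_def)
  qed
  have L: "child k ?xs (length P + s) = runs_count k (length L - s) ?ds" if "s < length L" for s
  proof -
    have g': "good (P @ take s L @ [Suc k]) (drop s L) w"
      by (rule good_cut[OF g that]) (use min in auto)
    have "\<not> contains12453 ((P @ take s L) @ Suc k # (drop s L @ w))"
    proof (subst contains12453_insert_min)
      have eq: "(P @ take s L) @ drop s L @ w = ?xs" by simp
      show "\<not> contains12453 ((P @ take s L) @ drop s L @ w)" unfolding eq by (rule av)
      show "\<forall>x\<in>set ((P @ take s L) @ drop s L @ w). Suc k < x" unfolding eq by (rule min)
      show "\<not> contains1342 (drop s L @ w)"
        using g not_contains_mono(2)[of "L @ w" "drop s L @ w"]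
        by (auto simp: good_def intro!: list_emb_append_mono suffix_imp_subseq suffix_drop)
    qed
    moreover have "extendable k (P @ take s L @ [Suc k]) (drop s L) (r # rs)"
      unfolding extendable_def w_def[symmetric] using g' r min' calculation
      by (auto dest: in_set_takeD in_set_dropD)
    ultimately show ?thesis
      using Suc.IH[of "P @ take s L @ [Suc k]" "drop s L" r rs] that
      by (simp add: child_def w_def)
  qed
  have W0: "child k ?xs (length (P @ L)) = runs_count k (length L) (1 # ?ds)"
  proof -
    have e: "extendable k P (L @ []) ((take 0 r @ [Suc k]) # drop 0 r # rs)"
      by (rule extendable_insert) (use g r min av in \<open>auto simp: w_def\<close>)
    then have "\<not> contains12453 (P @ L @ Suc k # w)"
      unfolding extendable_def by (simp add: w_def)
    then show ?thesis using Suc.IH[OF e] by (simp add: child_def w_def)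
  qed
  have W: "(\<Sum>t<length w. child k ?xs (length (P @ L) + Suc t)) =
      passive_sum (runs_count k) (length L) ?ds"
    using passive_sum_eq[of k "runs_count k" P L "[]" "r # rs"] Suc.IH g r min av
    by (simp add: w_def)
  have "extensions (Suc k) ?xs = (\<Sum>s<length P + (length L + Suc (length w)). child k ?xs s)"
    unfolding extensions_Suc by (intro sum.cong) auto
  also have "\<dots> = (\<Sum>s<length P. child k ?xs s) + ((\<Sum>s<length L. child k ?xs (length P + s)) +
      (\<Sum>t<Suc (length w). child k ?xs (length (P @ L) + t)))"
    unfolding sum_lessThan_add by (simp add: add.assoc)
  also have "(\<Sum>s<length P. child k ?xs s) = 0" using P by simp
  \<comment> \<open>Insertion at position \<open>s\<close> leaves \<open>length L - s\<close> sites,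
    so these numbers descend from \<open>length L\<close> to 1; reading the sum backwards gives the
    form used in \<open>runs_count\<close>.\<close>
  also have "(\<Sum>s<length L. child k ?xs (length P + s)) =
      (\<Sum>s<length L. runs_count k (Suc (length L - Suc s)) ?ds)"
    using L by (intro sum.cong) (auto simp: Suc_diff_Suc)
  also have "\<dots> = (\<Sum>s<length L. runs_count k (Suc s) ?ds)"
    by (rule sum.nat_diff_reindex)
  also have "(\<Sum>t<Suc (length w). child k ?xs (length (P @ L) + t)) =
      runs_count k (length L) (1 # ?ds) + passive_sum (runs_count k) (length L) ?ds"
    unfolding sum.lessThan_Suc_shift W using W0 by simp
  finally show ?case
    unfolding runs_count.simps(2) w_def[symmetric] by (simp only: add_0 add.assoc)
qed

section \<open>From insertion histories to avoiding permutations\<close>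

definition avoiders :: "nat \<Rightarrow> nat \<Rightarrow> nat list set" where
  "avoiders k n = {xs \<in> permutations_of_set {k<..n}. \<not> contains12453 xs}"

lemma finite_avoiders: "finite (avoiders k n)"
  unfolding avoiders_def by simp

text \<open>Deleting the minimum \<open>Suc k\<close> is inverse to inserting it at an admissible
  site, so unfolding \<open>extensions\<close> once is a reindexing along a bijection.\<close>

lemma sum_extensions_step:
  assumes "k < n"
  shows "(\<Sum>xs\<in>avoiders (Suc k) n. extensions (Suc k) xs) = (\<Sum>ys\<in>avoiders k n. extensions k ys)"
proof -
  define A where "A = avoiders (Suc k) n"
  define ins where "ins = (\<lambda>(xs, s). take s xs @ Suc k # drop s xs)"
  define D where "D = {(xs, s). xs \<in> A \<and> s \<le> length xs \<and> \<not> contains12453 (ins (xs, s))}"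
  have set_eq: "{k<..n} = insert (Suc k) {Suc k<..n}" using assms by auto
  have "(\<Sum>xs\<in>A. extensions (Suc k) xs) =
      (\<Sum>xs\<in>A. \<Sum>s\<le>length xs. if contains12453 (ins (xs, s)) then 0 else extensions k (ins (xs, s)))"
    by (simp only: extensions.simps ins_def Let_def split)
  also have "\<dots> = (\<Sum>p\<in>(SIGMA xs:A. {..length xs}).
      if contains12453 (ins p) then 0 else extensions k (ins p))"
    by (subst sum.Sigma) (auto simp: A_def finite_avoiders intro!: sum.cong)
  also have "\<dots> = (\<Sum>p\<in>D. extensions k (ins p))"
    by (rule sum.mono_neutral_cong_right) (auto simp: D_def A_def finite_avoiders)
  also have "\<dots> = (\<Sum>ys\<in>avoiders k n. extensions k ys)"
  proof (rule sum.reindex_bij_betw[of ins D "avoiders k n" "extensions k"])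
    \<comment> \<open>A child determines its parent and the site: deleting \<open>Suc k\<close>
      gives back \<open>xs\<close>, and the part in front of it has length \<open>s\<close>.\<close>
    have 1: "takeWhile ((\<noteq>) (Suc k)) (ins (xs, s)) = take s xs"
      "filter ((\<noteq>) (Suc k)) (ins (xs, s)) = xs" if "(xs, s) \<in> D" for xs s
    proof -
      have "set xs = {Suc k<..n}"
        using that by (auto simp: D_def A_def avoiders_def dest: permutations_of_setD)
      then have n: "Suc k \<notin> set xs" by auto
      then have *: "\<forall>x\<in>set (take s xs). Suc k \<noteq> x" "\<forall>x\<in>set (drop s xs). Suc k \<noteq> x"
        by (auto dest: in_set_takeD in_set_dropD)
      show "takeWhile ((\<noteq>) (Suc k)) (ins (xs, s)) = take s xs"
        using * by (simp add: ins_def takeWhile_append2)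
      have "filter ((\<noteq>) (Suc k)) (ins (xs, s)) = take s xs @ drop s xs"
        using * by (simp add: ins_def filter_id_conv del: append_take_drop_id)
      then show "filter ((\<noteq>) (Suc k)) (ins (xs, s)) = xs" by simp
    qed
    have inj: "inj_on ins D"
    proof (rule inj_onI, clarify)
      fix xs s ys t assume d: "(xs, s) \<in> D" "(ys, t) \<in> D" "ins (xs, s) = ins (ys, t)"
      then have "xs = ys" "take s xs = take t ys" using 1 by metis+
      moreover have "s \<le> length xs" "t \<le> length ys" using d by (auto simp: D_def)
      ultimately show "xs = ys \<and> s = t" by (metis length_take min.absorb2)
    qed
    have "ins p \<in> avoiders k n" if p: "p \<in> D" for p
    proof -
      obtain xs s where "p = (xs, s)" by fastforce
      with p have xs: "xs \<in> permutations_of_set {Suc k<..n}" and av: "\<not> contains12453 (ins p)"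
        by (auto simp: D_def A_def avoiders_def)
      have "set xs = {Suc k<..n}" "distinct xs" using xs by (auto dest: permutations_of_setD)
      moreover have "mset (ins p) = add_mset (Suc k) (mset xs)"
        unfolding \<open>p = (xs, s)\<close> ins_def
        by simp (metis append_take_drop_id mset_append union_code)
      then have "set (ins p) = insert (Suc k) (set xs)" "distinct (ins p) \<longleftrightarrow> distinct (Suc k # xs)"
        by (metis set_mset_add_mset_insert set_mset_mset) (metis \<open>mset (ins p) = _\<close> mset.simps(2) mset_eq_imp_distinct_iff)
      ultimately show ?thesis
        using av set_eq by (auto simp: avoiders_def intro!: permutations_of_setI)
    qed
    moreover have "ys \<in> ins ` D" if ys: "ys \<in> avoiders k n" for ys
    proof -
      have p: "set ys = {k<..n}" "distinct ys" "\<not> contains12453 ys"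
        using ys by (auto simp: avoiders_def dest: permutations_of_setD)
      then have "Suc k \<in> set ys" using assms by auto
      then obtain as bs where ab: "ys = as @ Suc k # bs" by (meson split_list)
      have "set (as @ bs) = set ys - {Suc k}" using p(2) unfolding ab by auto
      also have "\<dots> = {Suc k<..n}" unfolding p(1) by auto
      finally have "as @ bs \<in> avoiders (Suc k) n"
        using p(2,3) contains12453_mono[OF _ subseq_insert] unfolding ab
        by (auto simp: avoiders_def intro!: permutations_of_setI)
      then have "(as @ bs, length as) \<in> D"
        using p ab by (simp add: D_def A_def ins_def)
      moreover have "ys = ins (as @ bs, length as)" by (simp add: ins_def ab)
      ultimately show ?thesis by blast
    qed
    ultimately show "bij_betw ins D (avoiders k n)"
      using inj by (auto simp: bij_betw_def)
  qed
  finally show ?thesis unfolding A_def .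
qed

text \<open>The previous lemma telescopes from the empty word, the only member of
  \<open>avoiders n n\<close>, down to the avoiders with all values, each counted once because
  \<open>extensions 0\<close> is 1.\<close>

lemma card_Av_eq_runs_count: "card (Av n [1, 2, 4, 5, 3]) = runs_count n 0 [0]"
proof -
  have nil: "\<not> contains12453 []" by (simp add: contains12453_def)
  have "(\<Sum>xs\<in>avoiders (n - j) n. extensions (n - j) xs) = extensions n []" if "j \<le> n" for j
    using that
  proof (induction j)
    case 0
    have "avoiders n n = {[]}" using nil by (auto simp: avoiders_def)
    then show ?case by simp
  next
    case (Suc j)
    then show ?case
      using sum_extensions_step[of "n - Suc j" n] by (simp add: Suc_diff_Suc)
  qed
  from this[of n] have "card (avoiders 0 n) = extensions n []" by simp
  moreover have "{0<..n} = {1..n}" by auto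
  then have "avoiders 0 n = Av n [1, 2, 4, 5, 3]"
    unfolding avoiders_def Av_def contains_pattern_12453 by simp
  \<comment> \<open>The empty permutation is presented as one empty run, because
    \<open>extensions_eq\<close> asks for a first run; hence the list \<open>[0]\<close>.\<close>
  moreover have "extendable n [] [] [[]]"
    using nil by (simp add: extendable_def good_def contains231_def contains1342_def)
  then have "extensions n [] = runs_count n 0 [0]"
    using extensions_eq[of n "[]" "[]" "[]" "[]"] by simp
  ultimately show ?thesis by simp
qed

section \<open>Transfer numbers\<close>

text \<open>
  Counts the continuations in which the first run cannot be split at its front because the
  preceding run, which owns that site, has just been popped.
\<close>

primrec passive_count :: "nat \<Rightarrow> nat \<Rightarrow> nat list \<Rightarrow> nat" where
  "passive_count 0 a ds = 1"
| "passive_count (Suc n) a ds = passive_sum (runs_count n) a ds"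

text \<open>
  \<open>transfer K m f a e b\<close> counts the histories of \<open>m\<close> insertions that start with \<open>a\<close> sites before \<open>q\<close>
  and a first run of length \<open>e\<close>, end with \<open>b\<close> sites once this run and its descendants are popped, and
  do not touch the runs behind it. The flag \<open>f\<close> is 1 if the run is on top of the stack and 0 if the
  run before it has just been popped. The parameter \<open>K\<close> only truncates the sum over \<open>c\<close>, so that it
  matches a loop of the program.
\<close>

function transfer :: "nat \<Rightarrow> nat \<Rightarrow> nat \<Rightarrow> nat \<Rightarrow> nat \<Rightarrow> nat \<Rightarrow> nat" where
  "transfer K 0 f a e b = (if b = a + e then 1 else 0)"
| "transfer K (Suc m) f a e b =
     (\<Sum>i<a * f. transfer K m 1 (Suc i) e b) +
     (\<Sum>j<e + f. \<Sum>p\<le>m. \<Sum>c<K.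
        transfer K p 1 a (j + 2 - f) c * transfer K (m - p) 0 c (e + f - 1 - j) b)"
  by pat_completeness auto
termination by (relation "measure (\<lambda>(K, m, _). m)") auto

text \<open>An insertion raises the number of available sites by at most one. This makes the cutoff
  \<open>c < K\<close> harmless and excuses table lookups outside the computed region.\<close>

lemma transfer_support: "f \<le> 1 \<Longrightarrow> a + e + m < b \<Longrightarrow> transfer K m f a e b = 0"
proof (induction K m f a e b rule: transfer.induct)
  case (1 K f a e b)
  then show ?case by simp
next
  case (2 K m f a e b)
  have "transfer K m 1 (Suc i) e b = 0" if "i < a * f" for i
  proof -
    have "i < a" using that 2(4) by (cases f) auto
    then show ?thesis using 2(1)[of i] that 2(5) by simp
  qed
  moreover have "transfer K p 1 a (j + 2 - f) c * transfer K (m - p) 0 c (e + f - 1 - j) b = 0"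
    if "j < e + f" "p \<le> m" "c < K" for j p c
  proof (cases "c \<le> a + (j + 2 - f) + p")
    case True
    have "c + (e + f - 1 - j) + (m - p) < b" using True that 2(4,5) by linarith
    then show ?thesis using 2(3)[of j p c] that by simp
  next
    case False
    then show ?thesis using 2(2)[of j p c] that by simp
  qed
  ultimately show ?case by simp
qed

lemma sum_singleton:
  assumes "k < (K :: nat)"
  shows "(\<Sum>b<K. (if b = k then 1 else 0) * g b) = (g k :: nat)"
proof -
  have "(\<Sum>b<K. (if b = k then 1 else 0) * g b) = (\<Sum>b<K. if b = k then g b else 0)"
    by (intro sum.cong) auto
  then show ?thesis using assms by simp
qed

lemma sum_triangle:
  fixes g :: "nat \<Rightarrow> nat \<Rightarrow> nat"
  shows "(\<Sum>p\<le>n. \<Sum>q\<le>n - p. g p q) = (\<Sum>m\<le>n. \<Sum>p\<le>m. g p (m - p))"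
proof -
  have "(\<Sum>p\<le>n. \<Sum>q\<le>n - p. g p q) = (\<Sum>(p, q)\<in>(SIGMA p:{..n}. {..n - p}). g p q)"
    by (rule sum.Sigma) auto
  also have "(SIGMA p:{..n}. {..n - p}) = {(p, q). p + q \<le> n}" by auto
  finally show ?thesis by (simp add: sum.triangle_reindex_eq)
qed

text \<open>What follows once a run has been split into \<open>d\<close> and \<open>e\<close>: the
  left half, now on top, absorbs \<open>p\<close> insertions and leaves \<open>c\<close> sites; the
  right half then starts with flag 0, since its front site belonged to the left half.\<close>

definition split_transfer :: "nat \<Rightarrow> nat \<Rightarrow> nat \<Rightarrow> nat \<Rightarrow> nat \<Rightarrow> nat \<Rightarrow> nat" where
  "split_transfer K m a d e b =
     (\<Sum>p\<le>m. \<Sum>c<K. transfer K p 1 a d c * transfer K (m - p) 0 c e b)"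

text \<open>Origin of the offsets in \<open>transfer\<close>: an insertion after \<open>i\<close>
  entries splits a run of length \<open>e\<close> into \<open>i + 1\<close> and
  \<open>e - i\<close>. With \<open>f = 0\<close> the site \<open>i = 0\<close> is barred and
  \<open>i = j + 1\<close>; with \<open>f = 1\<close> it is allowed and
  \<open>i = j\<close>.\<close>

lemma transfer_Suc_passive:
  "transfer K (Suc m) 0 a d b = (\<Sum>j<d. split_transfer K m a (Suc (Suc j)) (d - Suc j) b)"
  by (simp add: split_transfer_def)

lemma transfer_Suc_active:
  "transfer K (Suc m) 1 a d b = (\<Sum>i<a. transfer K m 1 (Suc i) d b) +
     split_transfer K m a 1 d b + transfer K (Suc m) 0 a d b"
  unfolding transfer_Suc_passive by (simp add: split_transfer_def sum.lessThan_Suc_shift del: sum.lessThan_Suc)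

text \<open>The formula for the top run is followed by the one for the run behind it, and the two
  convolutions merge into one. The assumptions are the two halves of the induction hypothesis of
  \<open>runs_count_transfer\<close>.\<close>

lemma runs_count_split:
  assumes active: "\<And>a d ds. a + sum_list (d # ds) + k < K \<Longrightarrow> runs_count k a (d # ds) =
      (\<Sum>m\<le>k. \<Sum>b<K. transfer K m 1 a d b * passive_count (k - m) b ds)"
    and passv: "\<And>j a d ds. j \<le> k \<Longrightarrow> a + sum_list (d # ds) + j < K \<Longrightarrow> passive_count j a (d # ds) =
      (\<Sum>m\<le>j. \<Sum>b<K. transfer K m 0 a d b * passive_count (j - m) b ds)"
    and K: "a + sum_list (d # e # ds) + k < K"
  shows "runs_count k a (d # e # ds) =
    (\<Sum>m\<le>k. \<Sum>b<K. split_transfer K m a d e b * passive_count (k - m) b ds)"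
proof -
  let ?t = "\<lambda>p q c b. transfer K p 1 a d c * transfer K q 0 c e b"
  have "runs_count k a (d # e # ds) =
      (\<Sum>p\<le>k. \<Sum>c<K. transfer K p 1 a d c * passive_count (k - p) c (e # ds))"
    using K by (rule active)
  also have "\<dots> = (\<Sum>p\<le>k. \<Sum>c<K. transfer K p 1 a d c *
      (\<Sum>q\<le>k - p. \<Sum>b<K. transfer K q 0 c e b * passive_count (k - p - q) b ds))"
  proof (intro sum.cong refl)
    fix p c assume pc: "p \<in> {..k}" "c \<in> {..<K}"
    show "transfer K p 1 a d c * passive_count (k - p) c (e # ds) = transfer K p 1 a d c *
      (\<Sum>q\<le>k - p. \<Sum>b<K. transfer K q 0 c e b * passive_count (k - p - q) b ds)"
    \<comment> \<open>Beyond this bound the hypothesis on \<open>passive_count\<close> may fail to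
      apply, but there the first factor vanishes.\<close>
    proof (cases "c \<le> a + d + p")
      case True
      then have "c + sum_list (e # ds) + (k - p) < K" using K pc by simp
      then show ?thesis using passv[of "k - p" c e ds] by simp
    next
      case False
      then show ?thesis using transfer_support[of 1 a d p c K] by simp
    qed
  qed
  also have "\<dots> = (\<Sum>p\<le>k. \<Sum>q\<le>k - p. \<Sum>b<K. (\<Sum>c<K. ?t p q c b) * passive_count (k - p - q) b ds)"
  proof (rule sum.cong[OF refl])
    fix p
    have "(\<Sum>c<K. transfer K p 1 a d c *
        (\<Sum>q\<le>k - p. \<Sum>b<K. transfer K q 0 c e b * passive_count (k - p - q) b ds)) =
      (\<Sum>c<K. \<Sum>q\<le>k - p. \<Sum>b<K. ?t p q c b * passive_count (k - p - q) b ds)"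
      by (simp add: sum_distrib_left mult.assoc)
    also have "\<dots> = (\<Sum>q\<le>k - p. \<Sum>c<K. \<Sum>b<K. ?t p q c b * passive_count (k - p - q) b ds)"
      by (rule sum.swap)
    also have "\<dots> = (\<Sum>q\<le>k - p. \<Sum>b<K. \<Sum>c<K. ?t p q c b * passive_count (k - p - q) b ds)"
      by (intro sum.cong refl sum.swap)
    finally show "(\<Sum>c<K. transfer K p 1 a d c *
        (\<Sum>q\<le>k - p. \<Sum>b<K. transfer K q 0 c e b * passive_count (k - p - q) b ds)) =
      (\<Sum>q\<le>k - p. \<Sum>b<K. (\<Sum>c<K. ?t p q c b) * passive_count (k - p - q) b ds)"
      by (simp add: sum_distrib_right)
  qed
  \<comment> \<open>The new index \<open>m = p + q\<close> counts the insertions absorbed by both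
    runs together.\<close>
  also have "\<dots> = (\<Sum>m\<le>k. \<Sum>p\<le>m. \<Sum>b<K. (\<Sum>c<K. ?t p (m - p) c b) * passive_count (k - p - (m - p)) b ds)"
    by (rule sum_triangle)
  also have "\<dots> = (\<Sum>m\<le>k. \<Sum>p\<le>m. \<Sum>b<K. (\<Sum>c<K. ?t p (m - p) c b) * passive_count (k - m) b ds)"
    by (intro sum.cong refl) simp
  also have "\<dots> = (\<Sum>m\<le>k. \<Sum>b<K. \<Sum>p\<le>m. (\<Sum>c<K. ?t p (m - p) c b) * passive_count (k - m) b ds)"
    by (intro sum.cong refl sum.swap)
  finally show ?thesis by (simp add: split_transfer_def sum_distrib_right)
qed

text \<open>\<open>m\<close> counts the insertions before the first one behind the top run. That one
  cannot use the front site of the next run, hence \<open>passive_count\<close>; if there is none,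
  then \<open>m = n\<close> and \<open>passive_count 0\<close> is 1. Both flags are treated at once,
  since a split leaves a right half that later becomes passive.\<close>

lemma runs_count_transfer:
  shows "a + sum_list (d # ds) + n < K \<Longrightarrow> runs_count n a (d # ds) =
      (\<Sum>m\<le>n. \<Sum>b<K. transfer K m 1 a d b * passive_count (n - m) b ds)" (is "_ \<Longrightarrow> ?A n a d ds")
    and "a + sum_list (d # ds) + n < K \<Longrightarrow> passive_count n a (d # ds) =
      (\<Sum>m\<le>n. \<Sum>b<K. transfer K m 0 a d b * passive_count (n - m) b ds)" (is "_ \<Longrightarrow> ?P n a d ds")
proof (induction n arbitrary: a d ds rule: less_induct)
  case (less n)
  have "?A n a d ds \<and> ?P n a d ds" if K: "a + sum_list (d # ds) + n < K" for a d ds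
  proof (cases n)
    case 0
    then show ?thesis using K sum_singleton[of "a + d" K "\<lambda>_. 1"] by simp
  next
    case (Suc k)
    note IHA = less.IH(1)[of k] and IHP = less.IH(2)
    have split: "runs_count k a (d' # e # ds) =
      (\<Sum>m\<le>k. \<Sum>b<K. split_transfer K m a d' e b * passive_count (k - m) b ds)"
      if "a + sum_list (d' # e # ds) + k < K" for d' e
      using that by (intro runs_count_split IHA IHP) (auto simp: Suc)
    \<comment> \<open>The term \<open>m = 0\<close>: the first insertion already lies behind this
      run, whose \<open>d\<close> sites join the first kind.\<close>
    have m0: "(\<Sum>b<K. transfer K 0 f a d b * passive_count (Suc k) b ds) = passive_count (Suc k) (a + d) ds"
      for f
      using K by (simp add: sum_singleton)
    have "passive_count n a (d # ds) =
        (\<Sum>j<d. runs_count k a (Suc (Suc j) # (d - Suc j) # ds)) + passive_count (Suc k) (a + d) ds"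
      by (simp add: Suc)
    also have "(\<Sum>j<d. runs_count k a (Suc (Suc j) # (d - Suc j) # ds)) =
        (\<Sum>j<d. \<Sum>m\<le>k. \<Sum>b<K. split_transfer K m a (Suc (Suc j)) (d - Suc j) b * passive_count (k - m) b ds)"
      by (intro sum.cong refl split) (use K Suc in auto)
    also have "\<dots> = (\<Sum>m\<le>k. \<Sum>j<d. \<Sum>b<K. split_transfer K m a (Suc (Suc j)) (d - Suc j) b * passive_count (k - m) b ds)"
      by (rule sum.swap)
    also have "\<dots> = (\<Sum>m\<le>k. \<Sum>b<K. \<Sum>j<d. split_transfer K m a (Suc (Suc j)) (d - Suc j) b * passive_count (k - m) b ds)"
      by (intro sum.cong refl sum.swap)
    also have "\<dots> = (\<Sum>m\<le>k. \<Sum>b<K. transfer K (Suc m) 0 a d b * passive_count (k - m) b ds)"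
      unfolding transfer_Suc_passive by (simp add: sum_distrib_right)
    finally have P: "passive_count n a (d # ds) =
        (\<Sum>m\<le>k. \<Sum>b<K. transfer K (Suc m) 0 a d b * passive_count (k - m) b ds) +
        passive_count (Suc k) (a + d) ds" .
    have "(\<Sum>i<a. runs_count k (Suc i) (d # ds)) =
        (\<Sum>i<a. \<Sum>m\<le>k. \<Sum>b<K. transfer K m 1 (Suc i) d b * passive_count (k - m) b ds)"
      by (intro sum.cong refl IHA) (use K Suc in auto)
    also have "\<dots> = (\<Sum>m\<le>k. \<Sum>i<a. \<Sum>b<K. transfer K m 1 (Suc i) d b * passive_count (k - m) b ds)"
      by (rule sum.swap)
    also have "\<dots> = (\<Sum>m\<le>k. \<Sum>b<K. \<Sum>i<a. transfer K m 1 (Suc i) d b * passive_count (k - m) b ds)"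
      by (intro sum.cong refl sum.swap)
    finally have A: "(\<Sum>i<a. runs_count k (Suc i) (d # ds)) =
        (\<Sum>m\<le>k. \<Sum>b<K. (\<Sum>i<a. transfer K m 1 (Suc i) d b) * passive_count (k - m) b ds)"
      by (simp add: sum_distrib_right)
    have B: "runs_count k a (1 # d # ds) =
        (\<Sum>m\<le>k. \<Sum>b<K. split_transfer K m a 1 d b * passive_count (k - m) b ds)"
      by (rule split) (use K Suc in auto)
    have "runs_count n a (d # ds) = (\<Sum>i<a. runs_count k (Suc i) (d # ds)) +
        runs_count k a (1 # d # ds) + passive_count n a (d # ds)"
      by (simp add: Suc)
    also have "\<dots> = (\<Sum>m\<le>k. \<Sum>b<K. transfer K (Suc m) 1 a d b * passive_count (k - m) b ds) +
        passive_count (Suc k) (a + d) ds"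
      unfolding A B P transfer_Suc_active by (simp only: sum.distrib add_mult_distrib add.assoc)
    finally show ?thesis
      using P unfolding Suc sum.atMost_Suc_shift m0 by (simp only: diff_zero m0 diff_Suc_Suc add.commute)
  qed
  then show "a + sum_list (d # ds) + n < K \<Longrightarrow> ?A n a d ds"
    "a + sum_list (d # ds) + n < K \<Longrightarrow> ?P n a d ds" for a d ds
    by blast+
qed

text \<open>With no run behind, every insertion stays within this one, so only \<open>m = n\<close>
  contributes and \<open>b\<close> is summed out. The case \<open>a = d = 0\<close> is what the
  program outputs.\<close>

lemma runs_count_singleton:
  assumes "a + d + n < K"
  shows "runs_count n a [d] = (\<Sum>b<K. transfer K n 1 a d b)"
proof -
  have nil: "passive_count j b [] = (if j = 0 then 1 else 0)" for j b by (cases j) auto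
  have "runs_count n a [d] =
      (\<Sum>m\<le>n. \<Sum>b<K. transfer K m 1 a d b * passive_count (n - m) b [])"
    using assms by (intro runs_count_transfer(1)) simp
  also have "\<dots> = (\<Sum>m\<le>n. if m = n then \<Sum>b<K. transfer K m 1 a d b else 0)"
    by (intro sum.cong refl) (simp add: nil)
  finally show ?thesis by simp
qed

text \<open>One step of the recurrence has at most K terms in its first sum and \<open>K ^ 3\<close>
  in its second, and the exponents \<open>p\<close> and \<open>m - p\<close> add up to
  \<open>m\<close>. The parameter \<open>a\<close> is bounded separately from \<open>e + m\<close>,
  because \<open>c\<close> takes its place in the second factor and ranges over everything below
  K.\<close>

lemma transfer_le:
  assumes "a \<le> K" "e + m < K" "f \<le> 1"
  shows "transfer K m f a e b \<le> (2 * K ^ 3) ^ m"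
  using assms
proof (induction K m f a e b rule: transfer.induct)
  case (1 K f a e b)
  then show ?case by simp
next
  case (2 K m f a e b)
  let ?D = "2 * K ^ 3"
  have af: "a * f \<le> K" using 2(4,6) by (cases f) auto
  have "(\<Sum>i<a * f. transfer K m 1 (Suc i) e b) \<le> (\<Sum>i<a * f. ?D ^ m)"
  proof (rule sum_mono)
    fix i assume "i \<in> {..<a * f}"
    then show "transfer K m 1 (Suc i) e b \<le> ?D ^ m"
      using af 2(5) by (intro 2(1)) auto
  qed
  also have "\<dots> \<le> K ^ 3 * ?D ^ m"
    using af 2(5) by (simp add: power3_eq_cube) (metis le_square mult.assoc mult_le_mono1 order.trans)
  finally have A: "(\<Sum>i<a * f. transfer K m 1 (Suc i) e b) \<le> K ^ 3 * ?D ^ m" .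
  have "(\<Sum>j<e + f. \<Sum>p\<le>m. \<Sum>c<K.
        transfer K p 1 a (j + 2 - f) c * transfer K (m - p) 0 c (e + f - 1 - j) b)
      \<le> (\<Sum>j<e + f. \<Sum>p\<le>m. \<Sum>c<K. ?D ^ m)"
  proof (intro sum_mono)
    fix j p c assume jpc: "j \<in> {..<e + f}" "p \<in> {..m}" "c \<in> {..<K}"
    have "transfer K p 1 a (j + 2 - f) c \<le> ?D ^ p"
      using jpc 2(4-6) by (intro 2(2)[of j p c]) auto
    moreover have "transfer K (m - p) 0 c (e + f - 1 - j) b \<le> ?D ^ (m - p)"
      using jpc 2(4-6) by (intro 2(3)[of j p c]) auto
    ultimately have "transfer K p 1 a (j + 2 - f) c * transfer K (m - p) 0 c (e + f - 1 - j) b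
        \<le> ?D ^ p * ?D ^ (m - p)"
      by (rule mult_le_mono)
    also have "\<dots> = ?D ^ m" using jpc unfolding power_add[symmetric] by simp
    finally show "transfer K p 1 a (j + 2 - f) c * transfer K (m - p) 0 c (e + f - 1 - j) b \<le> ?D ^ m" .
  qed
  also have "\<dots> = (e + f) * Suc m * K * ?D ^ m" by (simp add: algebra_simps)
  also have "\<dots> \<le> K * K * K * ?D ^ m"
    by (intro mult_le_mono order.refl) (use 2(5,6) in auto)
  finally show ?case using A by (simp add: power3_eq_cube)
qed

section \<open>Weakest preconditions with resource bounds\<close>

text \<open>Programs are analysed through the total valuation \<open>val s\<close>; the domain of a
  store enters only through \<open>ok\<close>. \<open>Test r\<close> is treated as rewriting
  \<open>r\<close> with its own value, so that \<open>val_effect\<close> covers every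
  instruction.\<close>

fun target :: "instr \<Rightarrow> (loc \<Rightarrow> int) \<Rightarrow> loc" where
  "target (Const r c) \<sigma> = Reg r"
| "target (Copy r x) \<sigma> = Reg r"
| "target (Add r x y) \<sigma> = Reg r"
| "target (Sub r x y) \<sigma> = Reg r"
| "target (Mul r x y) \<sigma> = Reg r"
| "target (Load r x) \<sigma> = Reg r"
| "target (Store x y) \<sigma> = Mem (\<sigma> (Reg x))"
| "target (Test r) \<sigma> = Reg r"

fun result :: "instr \<Rightarrow> (loc \<Rightarrow> int) \<Rightarrow> int" where
  "result (Const r c) \<sigma> = c"
| "result (Copy r x) \<sigma> = \<sigma> (Reg x)"
| "result (Add r x y) \<sigma> = \<sigma> (Reg x) + \<sigma> (Reg y)"
| "result (Sub r x y) \<sigma> = \<sigma> (Reg x) - \<sigma> (Reg y)"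
| "result (Mul r x y) \<sigma> = \<sigma> (Reg x) * \<sigma> (Reg y)"
| "result (Load r x) \<sigma> = \<sigma> (Mem (\<sigma> (Reg x)))"
| "result (Store x y) \<sigma> = \<sigma> (Reg y)"
| "result (Test r) \<sigma> = \<sigma> (Reg r)"

text \<open>Copying, loading, storing and testing only move values that are bounded already, so a
  check remains for constants and arithmetic.\<close>

fun result_bounded :: "int \<Rightarrow> instr \<Rightarrow> (loc \<Rightarrow> int) \<Rightarrow> bool" where
  "result_bounded B (Const r c) \<sigma> \<longleftrightarrow> \<bar>c\<bar> \<le> B"
| "result_bounded B (Add r x y) \<sigma> \<longleftrightarrow> \<bar>\<sigma> (Reg x) + \<sigma> (Reg y)\<bar> \<le> B"
| "result_bounded B (Sub r x y) \<sigma> \<longleftrightarrow> \<bar>\<sigma> (Reg x) - \<sigma> (Reg y)\<bar> \<le> B"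
| "result_bounded B (Mul r x y) \<sigma> \<longleftrightarrow> \<bar>\<sigma> (Reg x) * \<sigma> (Reg y)\<bar> \<le> B"
| "result_bounded B _ \<sigma> \<longleftrightarrow> True"

lemma val_upd: "val (s(l \<mapsto> v)) = (val s)(l := v)"
  by (auto simp: val_def)

lemma val_effect: "val (effect i s) = (val s)(target i (val s) := result i (val s))"
  by (cases i) (simp_all add: val_upd)

locale machine =
  fixes S :: "loc set" and B :: int
begin

definition ok :: "store \<Rightarrow> bool" where
  "ok s \<longleftrightarrow> dom s \<subseteq> S \<and> (\<forall>l. \<bar>val s l\<bar> \<le> B)"

text \<open>
  Every store met during the run has to be \<open>ok\<close>; the bounds on storage and on the bit complexity
  follow from this alone.
\<close>

definition wp :: "com \<Rightarrow> nat \<Rightarrow> ((loc \<Rightarrow> int) \<Rightarrow> bool) \<Rightarrow> (loc \<Rightarrow> int) \<Rightarrow> bool" where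
  "wp c k Q \<sigma> \<longleftrightarrow> (\<forall>s. ok s \<and> val s = \<sigma> \<longrightarrow> (\<exists>tr t. run c s tr t \<and> ok t \<and> Q (val t) \<and>
     length tr \<le> k \<and> (\<forall>(i, s')\<in>set tr. ok s' \<and> ok (effect i s'))))"

lemma wp_conseq:
  assumes "wp c k Q \<sigma>" "\<And>\<tau>. Q \<tau> \<Longrightarrow> Q' \<tau>" "k \<le> k'"
  shows "wp c k' Q' \<sigma>"
  unfolding wp_def
proof (intro allI impI)
  fix s assume "ok s \<and> val s = \<sigma>"
  then obtain tr t where "run c s tr t" "ok t" "Q (val t)" "length tr \<le> k"
    "\<forall>(i, s')\<in>set tr. ok s' \<and> ok (effect i s')"
    using assms(1) unfolding wp_def by blast
  then show "\<exists>tr t. run c s tr t \<and> ok t \<and> Q' (val t) \<and>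
     length tr \<le> k' \<and> (\<forall>(i, s')\<in>set tr. ok s' \<and> ok (effect i s'))"
    using assms(2,3) by (intro exI[of _ tr] exI[of _ t]) auto
qed

lemma wp_weaken: "wp c k Q \<sigma> \<Longrightarrow> k \<le> k' \<Longrightarrow> wp c k' Q \<sigma>"
  by (rule wp_conseq)

lemma wp_seq:
  assumes "wp c1 k1 (wp c2 k2 Q) \<sigma>" "k1 + k2 \<le> k"
  shows "wp (Seq c1 c2) k Q \<sigma>"
  unfolding wp_def
proof (intro allI impI)
  fix s assume s: "ok s \<and> val s = \<sigma>"
  then obtain tr1 s1 where 1: "run c1 s tr1 s1" "ok s1" "wp c2 k2 Q (val s1)"
    "length tr1 \<le> k1" "\<forall>(i, s')\<in>set tr1. ok s' \<and> ok (effect i s')"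
    using assms(1) unfolding wp_def[of c1] by blast
  then obtain tr2 t where 2: "run c2 s1 tr2 t" "ok t" "Q (val t)"
    "length tr2 \<le> k2" "\<forall>(i, s')\<in>set tr2. ok s' \<and> ok (effect i s')"
    unfolding wp_def[of c2] by blast
  show "\<exists>tr t. run (Seq c1 c2) s tr t \<and> ok t \<and> Q (val t) \<and>
     length tr \<le> k \<and> (\<forall>(i, s')\<in>set tr. ok s' \<and> ok (effect i s'))"
    using run.Seq[OF 1(1) 2(1)] 1 2 assms(2) by (intro exI[of _ "tr1 @ tr2"] exI[of _ t]) auto
qed

lemma ok_effect:
  assumes "ok s" "target i (val s) \<in> S" "result_bounded B i (val s)"
  shows "ok (effect i s)"
proof -
  have *: "\<bar>val s l\<bar> \<le> B" "dom s \<subseteq> S" for l using assms(1) unfolding ok_def by auto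
  then have "\<bar>result i (val s)\<bar> \<le> B" using assms(3) by (cases i) auto
  then have "\<forall>l. \<bar>val (effect i s) l\<bar> \<le> B" using * unfolding val_effect by simp
  moreover have "dom (effect i s) \<subseteq> S" using *(2) assms(2) by (cases i) auto
  ultimately show ?thesis unfolding ok_def by blast
qed

lemma wp_instr:
  assumes "target i \<sigma> \<in> S" "result_bounded B i \<sigma>" "Q (\<sigma>(target i \<sigma> := result i \<sigma>))"
  shows "wp (Instr i) 1 Q \<sigma>"
  unfolding wp_def
proof (intro allI impI)
  fix s assume s: "ok s \<and> val s = \<sigma>"
  then have "ok (effect i s)" using ok_effect assms by blast
  then show "\<exists>tr t. run (Instr i) s tr t \<and> ok t \<and> Q (val t) \<and>
     length tr \<le> 1 \<and> (\<forall>(i, s')\<in>set tr. ok s' \<and> ok (effect i s'))"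
    using s assms(3) val_effect[of i s] run.Instr[of i s]
    by (intro exI[of _ "[(i, s)]"] exI[of _ "effect i s"]) auto
qed

lemma wp_if:
  assumes "\<sigma> (Reg r) > 0 \<Longrightarrow> wp c1 k Q \<sigma>" "\<not> \<sigma> (Reg r) > 0 \<Longrightarrow> wp c2 k Q \<sigma>"
  shows "wp (If r c1 c2) (Suc k) Q \<sigma>"
  unfolding wp_def
proof (intro allI impI)
  fix s assume s: "ok s \<and> val s = \<sigma>"
  have "\<exists>tr t. run (if \<sigma> (Reg r) > 0 then c1 else c2) s tr t \<and> ok t \<and> Q (val t) \<and>
     length tr \<le> k \<and> (\<forall>(i, s')\<in>set tr. ok s' \<and> ok (effect i s'))"
    using s assms unfolding wp_def by (cases "\<sigma> (Reg r) > 0") auto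
  then obtain tr t where t: "run (if \<sigma> (Reg r) > 0 then c1 else c2) s tr t" "ok t" "Q (val t)"
     "length tr \<le> k" "\<forall>(i, s')\<in>set tr. ok s' \<and> ok (effect i s')" by blast
  have "run (If r c1 c2) s ((Test r, s) # tr) t"
    using t(1) s by (cases "\<sigma> (Reg r) > 0") (auto intro: run.IfTrue run.IfFalse)
  then show "\<exists>tr t. run (If r c1 c2) s tr t \<and> ok t \<and> Q (val t) \<and>
     length tr \<le> Suc k \<and> (\<forall>(i, s')\<in>set tr. ok s' \<and> ok (effect i s'))"
    using t s by (intro exI[of _ "(Test r, s) # tr"] exI[of _ t]) auto
qed

text \<open>The invariant is indexed by the number of rounds left, which the control register holds;
  this yields termination and cost together. The additional unit is the final test.\<close>

lemma wp_while:
  assumes r: "\<And>n \<sigma>. I n \<sigma> \<Longrightarrow> \<sigma> (Reg r) = int n"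
    and body: "\<And>n \<sigma>. I (Suc n) \<sigma> \<Longrightarrow> wp c k (I n) \<sigma>"
    and "I n \<sigma>"
  shows "wp (While r c) (Suc (n * Suc k)) (I 0) \<sigma>"
  using \<open>I n \<sigma>\<close>
proof (induction n arbitrary: \<sigma>)
  case 0
  show ?case unfolding wp_def
  proof (intro allI impI)
    fix s assume s: "ok s \<and> val s = \<sigma>"
    then have "run (While r c) s [(Test r, s)] s"
      using r[OF 0] by (intro run.WhileFalse) simp
    then show "\<exists>tr t. run (While r c) s tr t \<and> ok t \<and> I 0 (val t) \<and>
       length tr \<le> Suc (0 * Suc k) \<and> (\<forall>(i, s')\<in>set tr. ok s' \<and> ok (effect i s'))"
      using s 0 by (intro exI[of _ "[(Test r, s)]"] exI[of _ s]) auto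
  qed
next
  case (Suc n)
  show ?case unfolding wp_def
  proof (intro allI impI)
    fix s assume s: "ok s \<and> val s = \<sigma>"
    then obtain tr1 s1 where 1: "run c s tr1 s1" "ok s1" "I n (val s1)"
      "length tr1 \<le> k" "\<forall>(i, s')\<in>set tr1. ok s' \<and> ok (effect i s')"
      using body[OF Suc.prems] unfolding wp_def by blast
    obtain tr2 t where 2: "run (While r c) s1 tr2 t" "ok t" "I 0 (val t)"
      "length tr2 \<le> Suc (n * Suc k)" "\<forall>(i, s')\<in>set tr2. ok s' \<and> ok (effect i s')"
      using Suc.IH[OF 1(3)] 1(2) unfolding wp_def by blast
    have "run (While r c) s ((Test r, s) # tr1 @ tr2) t"
      using r[OF Suc.prems] s 1 2 by (intro run.WhileTrue) auto
    then show "\<exists>tr t. run (While r c) s tr t \<and> ok t \<and> I 0 (val t) \<and>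
       length tr \<le> Suc (Suc n * Suc k) \<and> (\<forall>(i, s')\<in>set tr. ok s' \<and> ok (effect i s'))"
      using s 1 2 by (intro exI[of _ "(Test r, s) # tr1 @ tr2"] exI[of _ t]) auto
  qed
qed

end

text \<open>The language has no skip, so a block ends in a test, which changes nothing but costs one
  operation.\<close>

primrec block :: "instr list \<Rightarrow> com" where
  "block [] = Instr (Test 0)"
| "block (i # is) = Seq (Instr i) (block is)"

text \<open>The loop variable takes the values from the bound minus 1 down to 0; register 1 holds 1.\<close>

definition For :: "reg \<Rightarrow> reg \<Rightarrow> com \<Rightarrow> com" where
  "For r b c = Seq (Instr (Copy r b)) (While r (Seq (Instr (Sub r r 1)) c))"

definition same_except :: "nat set \<Rightarrow> (loc \<Rightarrow> int) \<Rightarrow> (loc \<Rightarrow> int) \<Rightarrow> bool" where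
  "same_except X \<sigma> \<tau> \<longleftrightarrow> (\<forall>r. r \<notin> X \<longrightarrow> \<tau> (Reg r) = \<sigma> (Reg r)) \<and> (\<forall>x. \<tau> (Mem x) = \<sigma> (Mem x))"

lemma same_except_mono: "same_except X \<sigma> \<tau> \<Longrightarrow> X \<subseteq> Y \<Longrightarrow> same_except Y \<sigma> \<tau>"
  unfolding same_except_def by blast

lemma same_except_trans:
  "same_except X \<sigma> \<tau> \<Longrightarrow> same_except X \<tau> \<rho> \<Longrightarrow> same_except X \<sigma> \<rho>"
  unfolding same_except_def by simp

lemma same_exceptD:
  "same_except X \<sigma> \<tau> \<Longrightarrow> r \<notin> X \<Longrightarrow> \<tau> (Reg r) = \<sigma> (Reg r)"
  "same_except X \<sigma> \<tau> \<Longrightarrow> \<tau> (Mem x) = \<sigma> (Mem x)"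
  unfolding same_except_def by auto

section \<open>The program\<close>

definition addr :: "reg \<Rightarrow> reg \<Rightarrow> reg \<Rightarrow> reg \<Rightarrow> reg \<Rightarrow> reg \<Rightarrow> instr list" where
  "addr t g m a e b = [Copy t g, Mul t t 2, Add t t m, Mul t t 2, Add t t a,
     Mul t t 2, Add t t e, Mul t t 2, Add t t b]"

definition enc :: "nat \<Rightarrow> nat \<Rightarrow> nat \<Rightarrow> nat \<Rightarrow> nat \<Rightarrow> nat \<Rightarrow> nat" where
  "enc K g m a e b = (((g * K + m) * K + a) * K + e) * K + b"

lemma digit_unique:
  fixes x y :: nat
  assumes "x * K + d = y * K + d'" "d < K" "d' < K"
  shows "x = y \<and> d = d'"
proof -
  have "(x * K + d) div K = x" using assms(2) by simp
  moreover have "(y * K + d') div K = y" using assms(3) by simp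
  ultimately have "x = y" using assms(1) by simp
  then show ?thesis using assms(1) by simp
qed

lemma enc_inj:
  assumes "enc K g m a e b = enc K g' m' a' e' b'"
    and "m < K" "a < K" "e < K" "b < K" "m' < K" "a' < K" "e' < K" "b' < K"
  shows "g = g' \<and> m = m' \<and> a = a' \<and> e = e' \<and> b = b'"
  using assms unfolding enc_def by (blast dest: digit_unique)

text \<open>The shape \<open>c * K ^ n - 1\<close> is reproduced when a digit is appended, so that
  \<open>enc_less\<close> can chain this lemma four times from
  \<open>g \<le> 3 * K ^ 0 - 1\<close>.\<close>

lemma digit_le:
  assumes "x \<le> c * K ^ n - 1" "d < (K :: nat)" "c > 0"
  shows "x * K + d \<le> c * K ^ Suc n - 1"
proof -
  have "c * K ^ n > 0" using assms by auto
  then have "x + 1 \<le> c * K ^ n" using assms(1) by linarith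
  then have "(x + 1) * K \<le> c * K ^ n * K" by (rule mult_le_mono1)
  then show ?thesis using assms(2) by (simp add: algebra_simps)
qed

lemma enc_less:
  assumes "g \<le> 2" "m < K" "a < K" "e < K" "b < K"
  shows "enc K g m a e b < 3 * K ^ 4"
proof -
  have four: "Suc (Suc (Suc (Suc 0))) = 4" by simp
  have "enc K g m a e b \<le> 3 * K ^ Suc (Suc (Suc (Suc 0))) - 1"
    unfolding enc_def by (intro digit_le) (use assms in auto)
  moreover have "3 * K ^ 4 > 0" using assms by simp
  ultimately show ?thesis unfolding four by linarith
qed

lemma enc_ge: "g \<ge> 1 \<Longrightarrow> K \<ge> 1 \<Longrightarrow> K \<le> enc K g m a e b"
proof -
  assume "g \<ge> 1" "K \<ge> 1"
  then have "1 \<le> (((g * K + m) * K + a) * K + e)" by (simp add: Suc_le_eq)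
  then show ?thesis unfolding enc_def by (cases "(((g * K + m) * K + a) * K + e)") auto
qed

context machine
begin

primrec safe_exec :: "instr list \<Rightarrow> (loc \<Rightarrow> int) \<Rightarrow> ((loc \<Rightarrow> int) \<Rightarrow> bool) \<Rightarrow> bool" where
  "safe_exec [] \<sigma> Q \<longleftrightarrow> Q \<sigma>"
| "safe_exec (i # is) \<sigma> Q \<longleftrightarrow> target i \<sigma> \<in> S \<and> result_bounded B i \<sigma> \<and>
     safe_exec is (\<sigma>(target i \<sigma> := result i \<sigma>)) Q"

lemma wp_block:
  assumes "Reg 0 \<in> S" "safe_exec is \<sigma> Q" "Suc (length is) \<le> k"
  shows "wp (block is) k Q \<sigma>"
proof -
  have "wp (block is) (Suc (length is)) Q \<sigma>"
    using assms(2)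
  proof (induction "is" arbitrary: \<sigma>)
    case Nil
    then show ?case using assms(1) wp_instr[of "Test 0" \<sigma> Q] by simp
  next
    case (Cons i "is")
    then have "wp (Instr i) 1 (wp (block is) (Suc (length is)) Q) \<sigma>"
      by (intro wp_instr) auto
    then show ?case by (auto intro: wp_seq)
  qed
  then show ?thesis using assms(3) wp_conseq by blast
qed

text \<open>The loop counts down, so \<open>J x\<close> describes the state in which the indices
  from \<open>x\<close> on are done. The cost uses an upper bound \<open>M\<close> on the number of
  rounds, so that loops of varying length are all charged in terms of K.\<close>

lemma wp_For:
  assumes b: "\<sigma> (Reg b) = int n" "n \<le> M"
    and r: "Reg r \<in> S" "r \<noteq> 1"
    and one: "\<sigma> (Reg 1) = 1" "B \<ge> 0"
    and init: "J n (\<sigma>(Reg r := int n))"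
    and step: "\<And>x \<tau>. x < n \<Longrightarrow> J (Suc x) \<tau> \<Longrightarrow> \<tau> (Reg r) = int (Suc x) \<Longrightarrow> \<tau> (Reg 1) = 1 \<Longrightarrow>
      wp c k (\<lambda>\<tau>'. J x \<tau>' \<and> \<tau>' (Reg r) = int x \<and> \<tau>' (Reg 1) = 1) (\<tau>(Reg r := int x))"
    and fin: "\<And>\<tau>. J 0 \<tau> \<Longrightarrow> \<tau> (Reg r) = 0 \<Longrightarrow> Q \<tau>"
  shows "wp (For r b c) (2 + M * (k + 2)) Q \<sigma>"
proof -
  define I where "I x \<tau> \<longleftrightarrow> J x \<tau> \<and> \<tau> (Reg r) = int x \<and> \<tau> (Reg 1) = 1 \<and> x \<le> n \<and> int n \<le> B"
    for x \<tau>
  have body: "wp (Seq (Instr (Sub r r 1)) c) (Suc k) (I x) \<tau>" if "I (Suc x) \<tau>" for x \<tau>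
  proof (rule wp_seq)
    show "wp (Instr (Sub r r 1)) 1 (wp c k (I x)) \<tau>"
    proof (rule wp_instr)
      show "wp c k (I x) (\<tau>(target (Sub r r 1) \<tau> := result (Sub r r 1) \<tau>))"
        using that by (auto simp: I_def intro: wp_conseq[OF step])
    qed (use that r in \<open>auto simp: I_def\<close>)
  qed simp
  have w: "wp (While r (Seq (Instr (Sub r r 1)) c)) (Suc (n * Suc (Suc k))) Q (\<sigma>(Reg r := int n))"
    if "int n \<le> B"
  proof (rule wp_conseq[OF wp_while[where I = I, OF _ body]])
    show "I n (\<sigma>(Reg r := int n))" using init r one that by (simp add: I_def)
    show "I 0 \<tau> \<Longrightarrow> Q \<tau>" for \<tau> using fin by (simp add: I_def)
  qed (auto simp: I_def)
  have "wp (For r b c) (1 + Suc (n * Suc (Suc k))) Q \<sigma>"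
    unfolding wp_def
  proof (intro allI impI)
    fix s assume s: "ok s \<and> val s = \<sigma>"
    \<comment> \<open>\<open>ok\<close> covers register \<open>b\<close>, which holds
      \<open>n\<close>.\<close>
    then have "int n \<le> B" using b unfolding ok_def by (metis abs_of_nat)
    then have "wp (For r b c) (1 + Suc (n * Suc (Suc k))) Q \<sigma>"
      unfolding For_def using w b r by (intro wp_seq[OF wp_instr order.refl]) auto
    then show "\<exists>tr t. run (For r b c) s tr t \<and> ok t \<and> Q (val t) \<and>
     length tr \<le> 1 + Suc (n * Suc (Suc k)) \<and> (\<forall>(i, s')\<in>set tr. ok s' \<and> ok (effect i s'))"
      using s unfolding wp_def by blast
  qed
  then show ?thesis
    by (rule wp_conseq) (use mult_le_mono1[OF b(2), of "k + 2"] in auto)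
qed

text \<open>All summands are nonnegative, so each partial sum lies between the initial and the final
  value of the accumulator. The two inequalities hand this to the loop body, where a bound on the
  final value alone then excludes overflow.\<close>

lemma wp_For_sum:
  assumes b: "\<sigma> (Reg b) = int n" "n \<le> M"
    and r: "Reg r \<in> S" "r \<in> X" "acc \<in> X" "1 \<notin> X" "r \<noteq> acc"
    and one: "\<sigma> (Reg 1) = 1" "B \<ge> 0"
    and step: "\<And>x \<tau>. x < n \<Longrightarrow> same_except X \<sigma> \<tau> \<Longrightarrow> \<tau> (Reg r) = int x \<Longrightarrow>
      \<sigma> (Reg acc) \<le> \<tau> (Reg acc) \<Longrightarrow>
      \<tau> (Reg acc) + int (g x) \<le> \<sigma> (Reg acc) + int (\<Sum>x<n. g x) \<Longrightarrow>
      wp c k (\<lambda>\<tau>'. same_except (X - {r}) \<tau> \<tau>' \<and> \<tau>' (Reg acc) = \<tau> (Reg acc) + int (g x)) \<tau>"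
  shows "wp (For r b c) (2 + M * (k + 2))
    (\<lambda>\<tau>. same_except X \<sigma> \<tau> \<and> \<tau> (Reg acc) = \<sigma> (Reg acc) + int (\<Sum>x<n. g x)) \<sigma>"
proof (rule wp_For[where J = "\<lambda>x \<tau>. same_except X \<sigma> \<tau> \<and>
      \<tau> (Reg acc) + int (\<Sum>y<x. g y) = \<sigma> (Reg acc) + int (\<Sum>y<n. g y)" and \<sigma> = \<sigma> and n = n, OF b])
  show "Reg r \<in> S" by (rule r)
  show "r \<noteq> 1" using r by auto
  show "\<sigma> (Reg 1) = 1" "B \<ge> 0" by (rule one)+
next
  show "same_except X \<sigma> (\<sigma>(Reg r := int n)) \<and> (\<sigma>(Reg r := int n)) (Reg acc) +
      int (\<Sum>y<n. g y) = \<sigma> (Reg acc) + int (\<Sum>y<n. g y)"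
    using r by (auto simp: same_except_def)
next
  fix x \<tau> assume x: "x < n" and J: "same_except X \<sigma> \<tau> \<and>
      \<tau> (Reg acc) + int (\<Sum>y<Suc x. g y) = \<sigma> (Reg acc) + int (\<Sum>y<n. g y)"
    and "\<tau> (Reg 1) = 1"
  let ?\<tau> = "\<tau>(Reg r := int x)"
  have s: "same_except X \<sigma> ?\<tau>" using J r by (auto simp: same_except_def)
  have "(\<Sum>y<Suc x. g y) \<le> (\<Sum>y<n. g y)" using x by (intro sum_mono2) auto
  then have "int (\<Sum>y<x. g y) + int (g x) \<le> int (\<Sum>y<n. g y)" by (simp del: of_nat_sum flip: of_nat_add)
  moreover have "?\<tau> (Reg acc) + int (\<Sum>y<x. g y) + int (g x) = \<sigma> (Reg acc) + int (\<Sum>y<n. g y)"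
    using J r by simp
  ultimately have "\<sigma> (Reg acc) \<le> ?\<tau> (Reg acc)"
    "?\<tau> (Reg acc) + int (g x) \<le> \<sigma> (Reg acc) + int (\<Sum>y<n. g y)"
    using of_nat_0_le_iff[of "\<Sum>y<x. g y"] by linarith+
  then have "wp c k (\<lambda>\<tau>'. same_except (X - {r}) ?\<tau> \<tau>' \<and> \<tau>' (Reg acc) = ?\<tau> (Reg acc) + int (g x)) ?\<tau>"
    by (intro step x s) auto
  then show "wp c k (\<lambda>\<tau>'. (same_except X \<sigma> \<tau>' \<and>
      \<tau>' (Reg acc) + int (\<Sum>y<x. g y) = \<sigma> (Reg acc) + int (\<Sum>y<n. g y)) \<and>
      \<tau>' (Reg r) = int x \<and> \<tau>' (Reg 1) = 1) ?\<tau>"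
  proof (rule wp_conseq)
    fix \<tau>' assume *: "same_except (X - {r}) ?\<tau> \<tau>' \<and> \<tau>' (Reg acc) = ?\<tau> (Reg acc) + int (g x)"
    then have "same_except X \<sigma> \<tau>'"
      using s same_except_trans same_except_mono by (metis Diff_subset)
    moreover have "\<tau>' (Reg r) = int x" "\<tau>' (Reg 1) = 1"
      using * r \<open>\<tau> (Reg 1) = 1\<close> by (auto simp: same_except_def)
    ultimately show "(same_except X \<sigma> \<tau>' \<and>
      \<tau>' (Reg acc) + int (\<Sum>y<x. g y) = \<sigma> (Reg acc) + int (\<Sum>y<n. g y)) \<and>
      \<tau>' (Reg r) = int x \<and> \<tau>' (Reg 1) = 1"
      using * J r by auto
  qed simp
next
  fix \<tau> assume "same_except X \<sigma> \<tau> \<and>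
      \<tau> (Reg acc) + int (\<Sum>y<0. g y) = \<sigma> (Reg acc) + int (\<Sum>y<n. g y)"
  then show "same_except X \<sigma> \<tau> \<and> \<tau> (Reg acc) = \<sigma> (Reg acc) + int (\<Sum>y<n. g y)" by simp
qed

end

section \<open>Storage layout and bounds on all values\<close>

definition locations :: "nat \<Rightarrow> loc set" where
  "locations K = Reg ` {..<40} \<union> Mem ` {0..3 * int K ^ 4}"

text \<open>Row \<open>m\<close> of the table is bounded by \<open>(2 * K ^ 3) ^ m\<close> with
  \<open>m < K\<close>, so the exponent K leaves one factor for the sum over \<open>b\<close> that
  forms an output.\<close>

definition value_bound :: "nat \<Rightarrow> nat" where
  "value_bound K = (2 * K ^ 3) ^ K"

lemma Reg_locations [simp]: "Reg r \<in> locations K \<longleftrightarrow> r < 40"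
  by (auto simp: locations_def)

lemma Mem_locations: "x \<le> 3 * K ^ 4 \<Longrightarrow> Mem (int x) \<in> locations K"
  by (auto simp: locations_def intro!: imageI) (metis of_nat_le_iff of_nat_mult of_nat_numeral of_nat_power)

text \<open>
  Registers: 0 holds \<open>N\<close>, 1 holds 1, 2 holds \<open>K\<close>, 10 holds 2, 26 holds 0; 3 counts the remaining rows;
  4, 5, 6 hold \<open>m\<close>, \<open>m - 1\<close>, \<open>K - m\<close>; 7, 9, 11, 12 hold \<open>a\<close>, \<open>e\<close>, \<open>f\<close>, \<open>b\<close>; 8 holds \<open>K - m - a\<close>;
  27 holds \<open>f + 1\<close>, the leading digit of an address (leading digit 0 would clash with the output
  cells); 13 is the accumulator, 14 the address; 18, 20, 23, 25 are the summation indices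
  \<open>i\<close>, \<open>j\<close>, \<open>p\<close>, \<open>c\<close> of \<open>transfer\<close>; 19, 21, 22, 24, 28 hold \<open>e + f\<close>, the two run lengths,
  \<open>m - 1 - p\<close> and \<open>a * f\<close>; the others are temporary.
\<close>

locale table = machine "locations K" "int (value_bound K)" for K +
  assumes K: "K \<ge> 2"
begin

text \<open>The largest address is below the square of \<open>2 * K ^ 3\<close>, and K is at least
  2.\<close>

lemma bound_ge: "3 * K ^ 4 \<le> value_bound K"
proof -
  have "3 * K ^ 4 \<le> 4 * K ^ 6" using K by (intro mult_le_mono power_increasing) auto
  also have "\<dots> = (2 * K ^ 3) ^ 2" by (simp add: power_mult_distrib flip: power_mult)
  also have "\<dots> \<le> value_bound K"
    unfolding value_bound_def using K by (intro power_increasing) auto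
  finally show ?thesis .
qed

lemma small_le_bound: "x \<le> 3 * K ^ 4 \<Longrightarrow> int x \<le> int (value_bound K)"
  using bound_ge by simp

text \<open>The intermediate results of the Horner scheme increase, so the bound on the finished
  address covers all of them.\<close>

lemma safe_exec_addr:
  assumes t: "t < 40" "t \<noteq> 2" "t \<noteq> m" "t \<noteq> a" "t \<noteq> e" "t \<noteq> b"
    and "\<sigma> (Reg 2) = int K" "\<sigma> (Reg g) = int g'" "\<sigma> (Reg m) = int m'" "\<sigma> (Reg a) = int a'"
      "\<sigma> (Reg e) = int e'" "\<sigma> (Reg b) = int b'"
    and "g' \<le> 2" "m' < K" "a' < K" "e' < K" "b' < K"
    and Q: "safe_exec is (\<sigma>(Reg t := int (enc K g' m' a' e' b'))) Q"
  shows "safe_exec (addr t g m a e b @ is) \<sigma> Q"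
proof -
  define h1 where "h1 = g' * K + m'"
  define h2 where "h2 = h1 * K + a'"
  define h3 where "h3 = h2 * K + e'"
  define h4 where "h4 = h3 * K + b'"
  have h4: "h4 = enc K g' m' a' e' b'" by (simp add: enc_def h4_def h3_def h2_def h1_def)
  have le: "x \<le> x * K" for x using K by simp
  have "h4 \<le> 3 * K ^ 4"
    unfolding h4 using enc_less[of g' m' K a' e' b'] assms by simp
  moreover have "g' * K \<le> h1" unfolding h1_def by simp
  moreover have "h1 * K \<le> h2" unfolding h2_def by simp
  moreover have "h2 * K \<le> h3" unfolding h3_def by simp
  moreover have "h3 * K \<le> h4" unfolding h4_def by simp
  moreover have "h1 \<le> h1 * K" "h2 \<le> h2 * K" "h3 \<le> h3 * K" by (rule le)+
  ultimately have "g' * K \<le> 3 * K ^ 4" "h1 \<le> 3 * K ^ 4" "h1 * K \<le> 3 * K ^ 4"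
    "h2 \<le> 3 * K ^ 4" "h2 * K \<le> 3 * K ^ 4" "h3 \<le> 3 * K ^ 4" "h3 * K \<le> 3 * K ^ 4" "h4 \<le> 3 * K ^ 4"
    by linarith+
  note small = this[THEN small_le_bound]
  have eqs: "int g' * int K = int (g' * K)" "int (g' * K) + int m' = int h1"
    "int h1 * int K = int (h1 * K)" "int (h1 * K) + int a' = int h2"
    "int h2 * int K = int (h2 * K)" "int (h2 * K) + int e' = int h3"
    "int h3 * int K = int (h3 * K)" "int (h3 * K) + int b' = int h4"
    by (simp_all only: h1_def h2_def h3_def h4_def of_nat_add of_nat_mult)
  show ?thesis
    using assms small
    by (simp add: addr_def eqs del: of_nat_mult of_nat_add of_nat_le_iff flip: h4)
qed

text \<open>48 is the value of \<open>3 * K ^ 4\<close> in the smallest case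
  \<open>K = 2\<close>.\<close>

lemma const_le_bound: "x \<le> 48 \<Longrightarrow> \<bar>x\<bar> \<le> int (value_bound K)" if "x \<ge> 0"
proof -
  assume "x \<le> 48"
  have "3 * 2 ^ 4 \<le> 3 * K ^ 4" using K by (intro mult_le_mono2 power_mono) auto
  then have "48 \<le> value_bound K" using bound_ge by simp
  then show ?thesis using \<open>x \<le> 48\<close> that by simp
qed

lemma index_le_bound: "\<bar>x\<bar> \<le> int K \<Longrightarrow> \<bar>x\<bar> \<le> int (value_bound K)"
proof -
  have "K ^ 1 \<le> K ^ 4" using K by (intro power_increasing) auto
  then have "K \<le> value_bound K" using bound_ge by simp
  then show "\<bar>x\<bar> \<le> int K \<Longrightarrow> \<bar>x\<bar> \<le> int (value_bound K)" by linarith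
qed

section \<open>Computing one table entry\<close>

definition tabulated :: "(loc \<Rightarrow> int) \<Rightarrow> (nat \<times> nat \<times> nat \<times> nat \<times> nat) set \<Rightarrow> bool" where
  "tabulated \<sigma> D \<longleftrightarrow> (\<forall>(m, f, a, e, b)\<in>D.
     \<sigma> (Mem (int (enc K (Suc f) m a e b))) = int (transfer K m f a e b))"

text \<open>The simplex \<open>a + e + m < K\<close> is the region in which
  \<open>runs_count_transfer\<close> holds. The recurrence stays inside it, except for those
  \<open>c\<close> where the first factor is 0.\<close>

definition earlier :: "nat \<Rightarrow> (nat \<times> nat \<times> nat \<times> nat \<times> nat) set" where
  "earlier M = {(m, f, a, e, b). m < M \<and> f \<le> 1 \<and> a + e + m < K \<and> b < K}"

lemma tabulatedD:
  "tabulated \<sigma> (earlier M) \<Longrightarrow> m < M \<Longrightarrow> f \<le> 1 \<Longrightarrow> a + e + m < K \<Longrightarrow> b < K \<Longrightarrow>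
    \<sigma> (Mem (int (enc K (Suc f) m a e b))) = int (transfer K m f a e b)"
  unfolding tabulated_def earlier_def by blast

definition cell_env :: "nat \<Rightarrow> nat \<Rightarrow> nat \<Rightarrow> nat \<Rightarrow> nat \<Rightarrow> (loc \<Rightarrow> int) \<Rightarrow> bool" where
  "cell_env m f a e b \<sigma> \<longleftrightarrow> \<sigma> (Reg 1) = 1 \<and> \<sigma> (Reg 2) = int K \<and> \<sigma> (Reg 4) = int m \<and>
     \<sigma> (Reg 5) = int m - 1 \<and> \<sigma> (Reg 7) = int a \<and> \<sigma> (Reg 9) = int e \<and> \<sigma> (Reg 10) = 2 \<and>
     \<sigma> (Reg 11) = int f \<and> \<sigma> (Reg 12) = int b \<and> \<sigma> (Reg 27) = int (Suc f) \<and>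
     f \<le> 1 \<and> a + e + m < K \<and> b < K \<and> tabulated \<sigma> (earlier m)"

definition scratch :: "nat set" where
  "scratch = {13, 14, 15, 16, 17, 18, 19, 20, 21, 22, 23, 24, 25, 28}"

lemma cell_env_same:
  assumes "cell_env m f a e b \<sigma>" "same_except X \<sigma> \<tau>" "X \<subseteq> scratch"
  shows "cell_env m f a e b \<tau>"
proof -
  have "same_except scratch \<sigma> \<tau>" using assms same_except_mono by blast
  then show ?thesis
    using assms(1) unfolding cell_env_def tabulated_def
    by (simp add: same_except_def scratch_def)
qed

definition product_step :: com where
  "product_step = block (addr 14 10 23 7 21 25 @ Load 15 14 # addr 14 1 24 25 22 12 @
     [Load 16 14, Mul 15 15 16, Add 13 13 15])"

text \<open>
  If \<open>c\<close> is so large that the second factor lies outside the tabulated region, then the first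
  factor is 0 and it does not matter what is read.
\<close>

lemma wp_product_step:
  assumes env: "cell_env (Suc m) f a e b \<sigma>"
    and reg: "\<sigma> (Reg 23) = int p" "\<sigma> (Reg 24) = int (m - p)" "\<sigma> (Reg 25) = int c"
      "\<sigma> (Reg 21) = int u" "\<sigma> (Reg 22) = int v"
    and p: "p \<le> m" and c: "c < K" and uv: "u + v = Suc e"
    and acc: "\<sigma> (Reg 13) \<ge> 0"
      "\<sigma> (Reg 13) + int (transfer K p 1 a u c * transfer K (m - p) 0 c v b) \<le> int (value_bound K)"
  shows "wp product_step 24 (\<lambda>\<tau>. same_except {13, 14, 15, 16} \<sigma> \<tau> \<and> \<tau> (Reg 13) =
    \<sigma> (Reg 13) + int (transfer K p 1 a u c * transfer K (m - p) 0 c v b)) \<sigma>"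
  unfolding product_step_def
proof (rule wp_block)
  have e: "f \<le> 1" "a + e + Suc m < K" "b < K" using env unfolding cell_env_def by auto
  have x: "\<sigma> (Mem (int (enc K 2 p a u c))) = int (transfer K p 1 a u c)"
    using env p c e uv tabulatedD[of \<sigma> "Suc m" p 1 a u c]
    unfolding cell_env_def by (simp add: numeral_2_eq_2)
  define y where "y = \<sigma> (Mem (int (enc K (Suc 0) (m - p) c v b)))"
  have xy: "int (transfer K p 1 a u c) * y =
      int (transfer K p 1 a u c * transfer K (m - p) 0 c v b)"
  proof (cases "c \<le> a + u + p")
    case True
    then show ?thesis
      using env p c e uv tabulatedD[of \<sigma> "Suc m" "m - p" 0 c v b]
      unfolding cell_env_def y_def by simp
  next
    case False
    then show ?thesis using transfer_support[of 1 a u p c K] by simp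
  qed
  have prod: "\<bar>int (transfer K p 1 a u c) * y\<bar> \<le> int (value_bound K)"
    "\<bar>\<sigma> (Reg 13) + int (transfer K p 1 a u c) * y\<bar> \<le> int (value_bound K)"
    unfolding xy using acc by linarith+
  show "safe_exec (addr 14 10 23 7 21 25 @ Load 15 14 # addr 14 1 24 25 22 12 @
     [Load 16 14, Mul 15 15 16, Add 13 13 15]) \<sigma> (\<lambda>\<tau>. same_except {13, 14, 15, 16} \<sigma> \<tau> \<and> \<tau> (Reg 13) =
    \<sigma> (Reg 13) + int (transfer K p 1 a u c * transfer K (m - p) 0 c v b))"
  proof (rule safe_exec_addr)
    show "safe_exec (Load 15 14 # addr 14 1 24 25 22 12 @ [Load 16 14, Mul 15 15 16, Add 13 13 15])
      (\<sigma>(Reg 14 := int (enc K 2 p a u c))) (\<lambda>\<tau>. same_except {13, 14, 15, 16} \<sigma> \<tau> \<and> \<tau> (Reg 13) =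
       \<sigma> (Reg 13) + int (transfer K p 1 a u c * transfer K (m - p) 0 c v b))"
      unfolding safe_exec.simps
    proof (intro conjI)
      show "safe_exec (addr 14 1 24 25 22 12 @ [Load 16 14, Mul 15 15 16, Add 13 13 15])
        ((\<sigma>(Reg 14 := int (enc K 2 p a u c)))(target (Load 15 14) (\<sigma>(Reg 14 := int (enc K 2 p a u c)))
          := result (Load 15 14) (\<sigma>(Reg 14 := int (enc K 2 p a u c)))))
        (\<lambda>\<tau>. same_except {13, 14, 15, 16} \<sigma> \<tau> \<and> \<tau> (Reg 13) =
         \<sigma> (Reg 13) + int (transfer K p 1 a u c * transfer K (m - p) 0 c v b))"
        by (rule safe_exec_addr[where g' = 1 and m' = "m - p" and a' = c and e' = v and b' = b])
          (use env reg p c uv prod[unfolded One_nat_def] e in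
            \<open>simp_all add: cell_env_def x[unfolded One_nat_def] xy[unfolded One_nat_def]
              same_except_def less_imp_diff_less y_def[symmetric]\<close>)
    qed auto
  qed (use env reg p c uv in \<open>auto simp: cell_env_def\<close>)
qed (simp_all add: addr_def)

definition convolution_loop :: com where
  "convolution_loop = Seq (block [Sub 24 5 23]) (For 25 2 product_step)"

lemma wp_convolution_loop:
  assumes env: "cell_env (Suc m) f a e b \<sigma>"
    and reg: "\<sigma> (Reg 23) = int p" "\<sigma> (Reg 21) = int u" "\<sigma> (Reg 22) = int v"
    and p: "p \<le> m" and uv: "u + v = Suc e"
    and acc: "\<sigma> (Reg 13) \<ge> 0" "\<sigma> (Reg 13) +
      int (\<Sum>c<K. transfer K p 1 a u c * transfer K (m - p) 0 c v b) \<le> int (value_bound K)"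
  shows "wp convolution_loop (30 * K) (\<lambda>\<tau>. same_except {13, 14, 15, 16, 24, 25} \<sigma> \<tau> \<and>
    \<tau> (Reg 13) = \<sigma> (Reg 13) +
      int (\<Sum>c<K. transfer K p 1 a u c * transfer K (m - p) 0 c v b)) \<sigma>"
  unfolding convolution_loop_def
proof (rule wp_seq[of _ 2 _ "2 + K * (24 + 2)"])
  let ?\<sigma> = "\<sigma>(Reg 24 := int (m - p))"
  let ?X = "{13, 14, 15, 16, 25}"
  have env': "cell_env (Suc m) f a e b ?\<sigma>"
    by (rule cell_env_same[OF env, where X = "{24}"]) (auto simp: same_except_def scratch_def)
  have bp: "int (m - p) \<le> int (value_bound K)"
    using index_le_bound[of "int (m - p)"] env unfolding cell_env_def by linarith
  have "wp (For 25 2 product_step) (2 + K * (24 + 2)) (\<lambda>\<tau>. same_except ?X ?\<sigma> \<tau> \<and>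
      \<tau> (Reg 13) = ?\<sigma> (Reg 13) +
        int (\<Sum>c<K. transfer K p 1 a u c * transfer K (m - p) 0 c v b)) ?\<sigma>"
  proof (rule wp_For_sum)
    fix c \<tau> assume c: "c < K" and s: "same_except ?X ?\<sigma> \<tau>" "\<tau> (Reg 25) = int c"
      and ac: "?\<sigma> (Reg 13) \<le> \<tau> (Reg 13)" "\<tau> (Reg 13) +
        int (transfer K p 1 a u c * transfer K (m - p) 0 c v b) \<le> ?\<sigma> (Reg 13) +
        int (\<Sum>c<K. transfer K p 1 a u c * transfer K (m - p) 0 c v b)"
    have env'': "cell_env (Suc m) f a e b \<tau>"
      by (rule cell_env_same[OF env' s(1)]) (auto simp: scratch_def)
    show "wp product_step 24 (\<lambda>\<tau>'. same_except (?X - {25}) \<tau> \<tau>' \<and> \<tau>' (Reg 13) =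
       \<tau> (Reg 13) + int (transfer K p 1 a u c * transfer K (m - p) 0 c v b)) \<tau>"
    proof (rule wp_conseq[OF wp_product_step[OF env'' _ _ s(2) _ _ p c uv]])
      show "\<tau> (Reg 23) = int p" "\<tau> (Reg 24) = int (m - p)" "\<tau> (Reg 21) = int u" "\<tau> (Reg 22) = int v"
        using same_exceptD(1)[OF s(1)] reg by simp_all
      show "0 \<le> \<tau> (Reg 13)" using ac(1) acc(1) by simp
      show "\<tau> (Reg 13) + int (transfer K p 1 a u c * transfer K (m - p) 0 c v b) \<le> int (value_bound K)"
        using ac(2) acc(2) by simp
    qed (auto elim: same_except_mono)
  qed (use env in \<open>auto simp: cell_env_def\<close>)
  then have "wp (For 25 2 product_step) (2 + K * (24 + 2)) (\<lambda>\<tau>. same_except {13, 14, 15, 16, 24, 25} \<sigma> \<tau> \<and>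
      \<tau> (Reg 13) = \<sigma> (Reg 13) +
        int (\<Sum>c<K. transfer K p 1 a u c * transfer K (m - p) 0 c v b)) ?\<sigma>"
    by (rule wp_conseq) (auto simp: same_except_def)
  then show "wp (block [Sub 24 5 23]) 2 (wp (For 25 2 product_step) (2 + K * (24 + 2))
     (\<lambda>\<tau>. same_except {13, 14, 15, 16, 24, 25} \<sigma> \<tau> \<and>
      \<tau> (Reg 13) = \<sigma> (Reg 13) +
        int (\<Sum>c<K. transfer K p 1 a u c * transfer K (m - p) 0 c v b))) \<sigma>"
    using env reg p bp by (intro wp_block) (simp_all add: cell_env_def of_nat_diff)
qed (use K in simp)

definition row_step :: com where
  "row_step = Seq (block [Add 21 20 10, Sub 21 21 11, Sub 22 19 1, Sub 22 22 20])
     (For 23 4 convolution_loop)"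

lemma wp_row_step:
  assumes env: "cell_env (Suc m) f a e b \<sigma>"
    and reg: "\<sigma> (Reg 19) = int (e + f)" "\<sigma> (Reg 20) = int j" and j: "j < e + f"
    and acc: "\<sigma> (Reg 13) \<ge> 0" "\<sigma> (Reg 13) + int (\<Sum>p\<le>m. \<Sum>c<K.
      transfer K p 1 a (j + 2 - f) c * transfer K (m - p) 0 c (e + f - 1 - j) b) \<le> int (value_bound K)"
  shows "wp row_step (40 * K ^ 2) (\<lambda>\<tau>. same_except {13, 14, 15, 16, 21, 22, 23, 24, 25} \<sigma> \<tau> \<and>
    \<tau> (Reg 13) = \<sigma> (Reg 13) + int (\<Sum>p\<le>m. \<Sum>c<K.
      transfer K p 1 a (j + 2 - f) c * transfer K (m - p) 0 c (e + f - 1 - j) b)) \<sigma>"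
  unfolding row_step_def
proof (rule wp_seq[of _ 5 _ "2 + K * (30 * K + 2)"])
  define u where "u = j + 2 - f"
  define v where "v = e + f - 1 - j"
  have e: "f \<le> 1" "a + e + Suc m < K" "b < K" using env unfolding cell_env_def by auto
  have uv: "u + v = Suc e" "u \<le> K" "v \<le> K" using e j unfolding u_def v_def by auto
  have int_uv: "int j + 2 - int f = int u" "int (e + f) - 1 - int j = int v"
    using e j unfolding u_def v_def by auto
  let ?\<sigma> = "\<sigma>(Reg 21 := int u, Reg 22 := int v)"
  let ?X = "{13, 14, 15, 16, 23, 24, 25}"
  let ?g = "\<lambda>p. \<Sum>c<K. transfer K p 1 a u c * transfer K (m - p) 0 c v b"
  have env': "cell_env (Suc m) f a e b ?\<sigma>"
    by (rule cell_env_same[OF env, where X = "{21, 22}"]) (auto simp: same_except_def scratch_def)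
  \<comment> \<open>Register 4 holds \<open>Suc m\<close>, so the loop covers exactly
    \<open>p \<le> m\<close>.\<close>
  have "wp (For 23 4 convolution_loop) (2 + K * (30 * K + 2)) (\<lambda>\<tau>. same_except ?X ?\<sigma> \<tau> \<and>
      \<tau> (Reg 13) = ?\<sigma> (Reg 13) + int (\<Sum>p<Suc m. ?g p)) ?\<sigma>"
  proof (rule wp_For_sum)
    fix p \<tau> assume p: "p < Suc m" and s: "same_except ?X ?\<sigma> \<tau>" "\<tau> (Reg 23) = int p"
      and ac: "?\<sigma> (Reg 13) \<le> \<tau> (Reg 13)"
        "\<tau> (Reg 13) + int (?g p) \<le> ?\<sigma> (Reg 13) + int (\<Sum>p<Suc m. ?g p)"
    have env'': "cell_env (Suc m) f a e b \<tau>"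
      by (rule cell_env_same[OF env' s(1)]) (auto simp: scratch_def)
    show "wp convolution_loop (30 * K) (\<lambda>\<tau>'. same_except (?X - {23}) \<tau> \<tau>' \<and>
       \<tau>' (Reg 13) = \<tau> (Reg 13) + int (?g p)) \<tau>"
    proof (rule wp_conseq[OF wp_convolution_loop[OF env'' s(2) _ _ _ uv(1)]])
      show "\<tau> (Reg 21) = int u" "\<tau> (Reg 22) = int v"
        using same_exceptD(1)[OF s(1)] by simp_all
      show "p \<le> m" using p by simp
      show "0 \<le> \<tau> (Reg 13)" using ac(1) acc(1) by simp
      show "\<tau> (Reg 13) + int (?g p) \<le> int (value_bound K)"
        using ac(2) acc(2) unfolding u_def[symmetric] v_def[symmetric] lessThan_Suc_atMost by simp
    qed (auto elim: same_except_mono)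
  qed (use env in \<open>auto simp: cell_env_def\<close>)
  then have "wp (For 23 4 convolution_loop) (2 + K * (30 * K + 2))
      (\<lambda>\<tau>. same_except {13, 14, 15, 16, 21, 22, 23, 24, 25} \<sigma> \<tau> \<and>
      \<tau> (Reg 13) = \<sigma> (Reg 13) + int (\<Sum>p\<le>m. ?g p)) ?\<sigma>"
    unfolding lessThan_Suc_atMost by (rule wp_conseq) (auto simp: same_except_def)
  moreover have "\<bar>int j + 2\<bar> \<le> int (value_bound K)"
    using const_le_bound[of 3] index_le_bound[of "int (j + 2)"] e j by (cases "j + 2 \<le> K") auto
  moreover have "\<bar>int (e + f) - 1\<bar> \<le> int (value_bound K)"
    using index_le_bound[of "int (e + f) - 1"] e j by auto
  moreover have "\<bar>int u\<bar> \<le> int (value_bound K)" "\<bar>int v\<bar> \<le> int (value_bound K)"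
    using index_le_bound[of "int u"] index_le_bound[of "int v"] uv by auto
  ultimately show "wp (block [Add 21 20 10, Sub 21 21 11, Sub 22 19 1, Sub 22 22 20]) 5
     (wp (For 23 4 convolution_loop) (2 + K * (30 * K + 2))
      (\<lambda>\<tau>. same_except {13, 14, 15, 16, 21, 22, 23, 24, 25} \<sigma> \<tau> \<and>
      \<tau> (Reg 13) = \<sigma> (Reg 13) + int (\<Sum>p\<le>m. \<Sum>c<K.
      transfer K p 1 a (j + 2 - f) c * transfer K (m - p) 0 c (e + f - 1 - j) b))) \<sigma>"
    unfolding u_def[symmetric] v_def[symmetric]
    using env reg by (intro wp_block) (simp_all add: cell_env_def int_uv[simplified])
next
  have "2 * K \<le> K * K" "4 \<le> K * K" using K mult_le_mono[of 2 K 2 K] by auto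
  moreover have "5 + (2 + K * (30 * K + 2)) = 7 + 30 * (K * K) + 2 * K" by (simp add: algebra_simps)
  ultimately show "5 + (2 + K * (30 * K + 2)) \<le> 40 * K ^ 2"
    unfolding power2_eq_square by linarith
qed

definition shift_step :: com where
  "shift_step = block (Add 21 18 1 # addr 14 10 5 21 9 12 @ [Load 15 14, Add 13 13 15])"

lemma wp_shift_step:
  assumes env: "cell_env (Suc m) f a e b \<sigma>"
    and reg: "\<sigma> (Reg 18) = int i" and i: "i < a"
    and acc: "\<sigma> (Reg 13) \<ge> 0" "\<sigma> (Reg 13) + int (transfer K m 1 (Suc i) e b) \<le> int (value_bound K)"
  shows "wp shift_step 13 (\<lambda>\<tau>. same_except {13, 14, 15, 21} \<sigma> \<tau> \<and>
    \<tau> (Reg 13) = \<sigma> (Reg 13) + int (transfer K m 1 (Suc i) e b)) \<sigma>"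
  unfolding shift_step_def
proof (rule wp_block)
  have e: "f \<le> 1" "a + e + Suc m < K" "b < K" using env unfolding cell_env_def by auto
  have x: "\<sigma> (Mem (int (enc K 2 m (Suc i) e b))) = int (transfer K m 1 (Suc i) e b)"
    using env e i tabulatedD[of \<sigma> "Suc m" m 1 "Suc i" e b]
    unfolding cell_env_def by (simp add: numeral_2_eq_2)
  have b1: "\<bar>int i + 1\<bar> \<le> int (value_bound K)" using e i by (intro index_le_bound) auto
  have b2: "\<bar>\<sigma> (Reg 13) + int (transfer K m (Suc 0) (Suc i) e b)\<bar> \<le> int (value_bound K)"
    using acc by simp
  let ?Q = "\<lambda>\<tau>. same_except {13, 14, 15, 21} \<sigma> \<tau> \<and>
    \<tau> (Reg 13) = \<sigma> (Reg 13) + int (transfer K m 1 (Suc i) e b)"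
  have "safe_exec (addr 14 10 5 21 9 12 @ [Load 15 14, Add 13 13 15]) (\<sigma>(Reg 21 := int (Suc i))) ?Q"
    by (rule safe_exec_addr[where g' = 2 and m' = m and a' = "Suc i" and e' = e and b' = b])
      (use env e i b2 in \<open>simp_all add: cell_env_def x[unfolded One_nat_def] same_except_def\<close>)
  then show "safe_exec (Add 21 18 1 # addr 14 10 5 21 9 12 @ [Load 15 14, Add 13 13 15]) \<sigma> ?Q"
    using env reg b1 by (simp add: cell_env_def add.commute)
qed (simp_all add: addr_def)

definition cell_sum :: com where
  "cell_sum = Seq (block [Mul 28 7 11]) (Seq (For 18 28 shift_step)
     (Seq (block [Add 19 9 11]) (For 20 19 row_step)))"

lemma transfer_le_bound: "a \<le> K \<Longrightarrow> e + m < K \<Longrightarrow> f \<le> 1 \<Longrightarrow> transfer K m f a e b \<le> value_bound K"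
  using transfer_le[of a K e m f b] power_increasing[of m K "2 * K ^ 3"] K
  unfolding value_bound_def by simp

lemma wp_cell_sum:
  assumes env: "cell_env (Suc m) f a e b \<sigma>" and acc: "\<sigma> (Reg 13) = 0"
  shows "wp cell_sum (70 * K ^ 3) (\<lambda>\<tau>. same_except scratch \<sigma> \<tau> \<and>
    \<tau> (Reg 13) = int (transfer K (Suc m) f a e b)) \<sigma>"
proof -
  have e: "f \<le> 1" "a + e + Suc m < K" "b < K" using env unfolding cell_env_def by auto
  define A where "A = (\<Sum>i<a * f. transfer K m 1 (Suc i) e b)"
  define g where "g j = (\<Sum>p\<le>m. \<Sum>c<K.
      transfer K p 1 a (j + 2 - f) c * transfer K (m - p) 0 c (e + f - 1 - j) b)" for j
  have total: "transfer K (Suc m) f a e b = A + (\<Sum>j<e + f. g j)"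
    by (simp add: A_def g_def)
  \<comment> \<open>The two loops build up this entry from nonnegative terms, so its bound controls
    every partial sum in both of them.\<close>
  have "transfer K (Suc m) f a e b \<le> value_bound K"
    using e by (intro transfer_le_bound) auto
  then have bound: "int A + int (\<Sum>j<e + f. g j) \<le> int (value_bound K)"
    unfolding total by (simp only: of_nat_add[symmetric] of_nat_le_iff)
  have af: "a * f \<le> a" "a * f \<le> K" using e by (cases f; simp)+
  let ?X1 = "{13, 14, 15, 18, 21}"
  let ?X2 = "{13, 14, 15, 16, 20, 21, 22, 23, 24, 25}"
  have sum2: "wp (For 20 19 row_step) (2 + K * (40 * K ^ 2 + 2)) (\<lambda>\<tau>'. same_except scratch \<sigma> \<tau>' \<and>
      \<tau>' (Reg 13) = int (transfer K (Suc m) f a e b)) \<tau>"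
    if s: "same_except scratch \<sigma> \<tau>" "\<tau> (Reg 13) = int A" "\<tau> (Reg 19) = int (e + f)" for \<tau>
  proof -
    have env': "cell_env (Suc m) f a e b \<tau>" by (rule cell_env_same[OF env s(1)]) simp
    have "wp (For 20 19 row_step) (2 + K * (40 * K ^ 2 + 2)) (\<lambda>\<tau>'. same_except ?X2 \<tau> \<tau>' \<and>
      \<tau>' (Reg 13) = \<tau> (Reg 13) + int (\<Sum>j<e + f. g j)) \<tau>"
    proof (rule wp_For_sum)
      fix j \<rho> assume j: "j < e + f" and r: "same_except ?X2 \<tau> \<rho>" "\<rho> (Reg 20) = int j"
        and ac: "\<tau> (Reg 13) \<le> \<rho> (Reg 13)"
          "\<rho> (Reg 13) + int (g j) \<le> \<tau> (Reg 13) + int (\<Sum>j<e + f. g j)"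
      have env'': "cell_env (Suc m) f a e b \<rho>"
        by (rule cell_env_same[OF env' r(1)]) (auto simp: scratch_def)
      show "wp row_step (40 * K ^ 2) (\<lambda>\<tau>'. same_except (?X2 - {20}) \<rho> \<tau>' \<and>
          \<tau>' (Reg 13) = \<rho> (Reg 13) + int (g j)) \<rho>"
        unfolding g_def
      proof (rule wp_conseq[OF wp_row_step[OF env'' _ r(2) j]])
        show "\<rho> (Reg 19) = int (e + f)" using same_exceptD(1)[OF r(1)] s(3) by simp
        show "0 \<le> \<rho> (Reg 13)" using ac(1) s(2) by simp
        show "\<rho> (Reg 13) + int (\<Sum>p\<le>m. \<Sum>c<K.
          transfer K p 1 a (j + 2 - f) c * transfer K (m - p) 0 c (e + f - 1 - j) b)
          \<le> int (value_bound K)"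
          using ac(2) bound s(2) unfolding g_def[symmetric] by linarith
      qed (auto elim: same_except_mono)
    qed (use env' s e in \<open>auto simp: cell_env_def\<close>)
    then show ?thesis
      by (rule wp_conseq) (use s total in \<open>auto simp: same_except_def scratch_def\<close>)
  qed
  have mid: "wp (Seq (block [Add 19 9 11]) (For 20 19 row_step)) (4 + K * (40 * K ^ 2 + 2))
      (\<lambda>\<tau>'. same_except scratch \<sigma> \<tau>' \<and> \<tau>' (Reg 13) = int (transfer K (Suc m) f a e b)) \<tau>"
    if s: "same_except scratch \<sigma> \<tau>" "\<tau> (Reg 13) = int A" for \<tau>
  proof (rule wp_seq[of _ 2 _ "2 + K * (40 * K ^ 2 + 2)"])
    have env': "cell_env (Suc m) f a e b \<tau>" by (rule cell_env_same[OF env s(1)]) simp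
    have b: "\<bar>int e + int f\<bar> \<le> int (value_bound K)" using e by (intro index_le_bound) auto
    have "wp (For 20 19 row_step) (2 + K * (40 * K ^ 2 + 2)) (\<lambda>\<tau>'. same_except scratch \<sigma> \<tau>' \<and>
      \<tau>' (Reg 13) = int (transfer K (Suc m) f a e b)) (\<tau>(Reg 19 := int (e + f)))"
      by (rule sum2) (use s in \<open>auto simp: same_except_def scratch_def\<close>)
    then show "wp (block [Add 19 9 11]) 2 (wp (For 20 19 row_step) (2 + K * (40 * K ^ 2 + 2))
      (\<lambda>\<tau>'. same_except scratch \<sigma> \<tau>' \<and> \<tau>' (Reg 13) = int (transfer K (Suc m) f a e b))) \<tau>"
      using env' b by (intro wp_block) (simp_all add: cell_env_def)
  qed simp
  let ?\<sigma> = "\<sigma>(Reg 28 := int (a * f))"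
  have env': "cell_env (Suc m) f a e b ?\<sigma>"
    by (rule cell_env_same[OF env, where X = "{28}"]) (auto simp: same_except_def scratch_def)
  have "wp (For 18 28 shift_step) (2 + K * (13 + 2)) (\<lambda>\<tau>. same_except ?X1 ?\<sigma> \<tau> \<and>
      \<tau> (Reg 13) = ?\<sigma> (Reg 13) + int (\<Sum>i<a * f. transfer K m 1 (Suc i) e b)) ?\<sigma>"
  proof (rule wp_For_sum)
    fix i \<tau> assume i: "i < a * f" and s: "same_except ?X1 ?\<sigma> \<tau>" "\<tau> (Reg 18) = int i"
      and ac: "?\<sigma> (Reg 13) \<le> \<tau> (Reg 13)" "\<tau> (Reg 13) + int (transfer K m 1 (Suc i) e b)
        \<le> ?\<sigma> (Reg 13) + int (\<Sum>i<a * f. transfer K m 1 (Suc i) e b)"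
    have env'': "cell_env (Suc m) f a e b \<tau>"
      by (rule cell_env_same[OF env' s(1)]) (auto simp: scratch_def)
    show "wp shift_step 13 (\<lambda>\<tau>'. same_except (?X1 - {18}) \<tau> \<tau>' \<and>
        \<tau>' (Reg 13) = \<tau> (Reg 13) + int (transfer K m 1 (Suc i) e b)) \<tau>"
    proof (rule wp_conseq[OF wp_shift_step[OF env'' s(2)]])
      show "i < a" using i af(1) by linarith
      show "0 \<le> \<tau> (Reg 13)" using ac(1) acc by simp
      show "\<tau> (Reg 13) + int (transfer K m 1 (Suc i) e b) \<le> int (value_bound K)"
      proof -
        have "0 \<le> int (\<Sum>j<e + f. g j)" by (rule of_nat_0_le_iff)
        moreover have "?\<sigma> (Reg 13) = 0" using acc by simp
        ultimately show ?thesis using ac(2) bound unfolding A_def[symmetric] by linarith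
      qed
    qed (auto elim: same_except_mono)
  qed (use env af in \<open>auto simp: cell_env_def\<close>)
  then have "wp (For 18 28 shift_step) (2 + K * (13 + 2))
     (wp (Seq (block [Add 19 9 11]) (For 20 19 row_step)) (4 + K * (40 * K ^ 2 + 2))
      (\<lambda>\<tau>'. same_except scratch \<sigma> \<tau>' \<and> \<tau>' (Reg 13) = int (transfer K (Suc m) f a e b))) ?\<sigma>"
  proof (rule wp_conseq)
    fix \<tau> assume t: "same_except ?X1 ?\<sigma> \<tau> \<and>
      \<tau> (Reg 13) = ?\<sigma> (Reg 13) + int (\<Sum>i<a * f. transfer K m 1 (Suc i) e b)"
    show "wp (Seq (block [Add 19 9 11]) (For 20 19 row_step)) (4 + K * (40 * K ^ 2 + 2))
      (\<lambda>\<tau>'. same_except scratch \<sigma> \<tau>' \<and> \<tau>' (Reg 13) = int (transfer K (Suc m) f a e b)) \<tau>"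
    proof (rule mid)
      show "same_except scratch \<sigma> \<tau>" using t by (auto simp: same_except_def scratch_def)
      show "\<tau> (Reg 13) = int A" using t acc by (simp add: A_def)
    qed
  qed simp
  then have "wp (Seq (For 18 28 shift_step) (Seq (block [Add 19 9 11]) (For 20 19 row_step)))
     (2 + K * (13 + 2) + (4 + K * (40 * K ^ 2 + 2)))
      (\<lambda>\<tau>'. same_except scratch \<sigma> \<tau>' \<and> \<tau>' (Reg 13) = int (transfer K (Suc m) f a e b)) ?\<sigma>"
    by (rule wp_seq) simp
  moreover have "\<bar>int a * int f\<bar> \<le> int (value_bound K)"
  proof -
    have "\<bar>int (a * f)\<bar> \<le> int K" using af(2) by (simp only: abs_of_nat of_nat_le_iff)
    then show ?thesis using index_le_bound[of "int (a * f)"] by simp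
  qed
  ultimately have "wp (block [Mul 28 7 11])
     2 (wp (Seq (For 18 28 shift_step) (Seq (block [Add 19 9 11]) (For 20 19 row_step)))
     (2 + K * (13 + 2) + (4 + K * (40 * K ^ 2 + 2)))
      (\<lambda>\<tau>'. same_except scratch \<sigma> \<tau>' \<and> \<tau>' (Reg 13) = int (transfer K (Suc m) f a e b))) \<sigma>"
    using env by (intro wp_block) (simp_all add: cell_env_def)
  then show ?thesis
    unfolding cell_sum_def
  proof (rule wp_seq)
    define X where "X = K ^ 3"
    have "8 \<le> X" unfolding X_def using K power_mono[of 2 K 3] by simp
    moreover have "K * 2 ^ 2 \<le> K * K ^ 2" using K by (intro mult_le_mono2 power_mono) auto
    then have "4 * K \<le> X" by (simp add: X_def power2_eq_square power3_eq_cube)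
    moreover have "2 + (2 + K * (13 + 2) + (4 + K * (40 * K ^ 2 + 2))) = 8 + 17 * K + 40 * X"
      by (simp add: X_def algebra_simps power2_eq_square power3_eq_cube)
    ultimately show "2 + (2 + K * (13 + 2) + (4 + K * (40 * K ^ 2 + 2))) \<le> 70 * K ^ 3"
      unfolding X_def[symmetric] by linarith
  qed
qed

text \<open>Only a sign test is available: \<open>1 - d * d\<close> with
  \<open>d = b - (a + e)\<close> is positive iff \<open>d = 0\<close>, and then it is 1, already the
  value wanted.\<close>

definition cell_base :: com where
  "cell_base = Seq (block [Add 17 7 9, Sub 17 12 17, Mul 17 17 17, Sub 13 1 17])
     (If 13 (block []) (Instr (Const 13 0)))"

lemma wp_cell_base:
  assumes env: "cell_env 0 f a e b \<sigma>"
  shows "wp cell_base (70 * K ^ 3) (\<lambda>\<tau>. same_except scratch \<sigma> \<tau> \<and>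
    \<tau> (Reg 13) = int (transfer K 0 f a e b)) \<sigma>"
  unfolding cell_base_def
proof (rule wp_seq[of _ 5 _ 2])
  define d where "d = int b - (int a + int e)"
  let ?Q = "\<lambda>\<tau>. same_except scratch \<sigma> \<tau> \<and> \<tau> (Reg 13) = int (transfer K 0 f a e b)"
  have e: "a + e < K" "b < K" using env unfolding cell_env_def by auto
  have d: "\<bar>d\<bar> \<le> int K" using e unfolding d_def by auto
  then have "\<bar>d\<bar> * \<bar>d\<bar> \<le> int K * int K" by (intro mult_mono) auto
  then have d2: "d * d \<le> int (K ^ 2)" "0 \<le> d * d" by (auto simp: abs_mult_self_eq power2_eq_square)
  have "K ^ 2 \<le> K ^ 4" using K by (intro power_increasing) auto
  then have "K ^ 2 \<le> value_bound K" using bound_ge by simp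
  then have "int (K ^ 2) \<le> int (value_bound K)" by (simp only: of_nat_le_iff)
  moreover have "1 \<le> int (value_bound K)" using const_le_bound[of 1] by simp
  ultimately have b: "\<bar>int a + int e\<bar> \<le> int (value_bound K)" "\<bar>d\<bar> \<le> int (value_bound K)"
    "\<bar>d * d\<bar> \<le> int (value_bound K)" "\<bar>1 - d * d\<bar> \<le> int (value_bound K)"
    using d2 index_le_bound[OF d] index_le_bound[of "int a + int e"] e by linarith+
  have pos: "1 - d * d > 0 \<longleftrightarrow> d = 0"
  proof
    assume "1 - d * d > 0"
    then have "d * d = 0" using d2(2) by linarith
    then show "d = 0" by simp
  qed simp
  have "wp (If 13 (block []) (Instr (Const 13 0))) 2 ?Q (\<sigma>(Reg 17 := d * d, Reg 13 := 1 - d * d))"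
    unfolding numeral_2_eq_2
  proof (rule wp_if)
    assume "(\<sigma>(Reg 17 := d * d, Reg 13 := 1 - d * d)) (Reg 13) > 0"
    then have "d = 0" using pos by simp
    then show "wp (block []) (Suc 0) ?Q (\<sigma>(Reg 17 := d * d, Reg 13 := 1 - d * d))"
      by (intro wp_block) (auto simp: d_def same_except_def scratch_def)
  next
    assume "\<not> (\<sigma>(Reg 17 := d * d, Reg 13 := 1 - d * d)) (Reg 13) > 0"
    then have "d \<noteq> 0" using pos by simp
    then have "b \<noteq> a + e" by (auto simp: d_def)
    then show "wp (Instr (Const 13 0)) (Suc 0) ?Q (\<sigma>(Reg 17 := d * d, Reg 13 := 1 - d * d))"
      using wp_instr[of "Const 13 0" _ ?Q] by (simp add: same_except_def scratch_def)
  qed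
  then show "wp (block [Add 17 7 9, Sub 17 12 17, Mul 17 17 17, Sub 13 1 17]) 5
    (wp (If 13 (block []) (Instr (Const 13 0))) 2 ?Q) \<sigma>"
    using env b by (intro wp_block) (simp_all add: cell_env_def d_def[symmetric])
next
  show "5 + 2 \<le> 70 * K ^ 3" using K power_mono[of 2 K 3] by simp
qed

definition cell :: com where
  "cell = Seq (Instr (Const 13 0)) (If 4 cell_sum cell_base)"

lemma wp_cell:
  assumes env: "cell_env m f a e b \<sigma>"
  shows "wp cell (72 * K ^ 3) (\<lambda>\<tau>. same_except scratch \<sigma> \<tau> \<and>
    \<tau> (Reg 13) = int (transfer K m f a e b)) \<sigma>"
  unfolding cell_def
proof (rule wp_seq)
  let ?Q = "\<lambda>\<tau>. same_except scratch \<sigma> \<tau> \<and> \<tau> (Reg 13) = int (transfer K m f a e b)"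
  let ?\<sigma> = "\<sigma>(Reg 13 := 0)"
  have env': "cell_env m f a e b ?\<sigma>"
    by (rule cell_env_same[OF env, where X = "{13}"]) (auto simp: same_except_def scratch_def)
  have Q: "same_except scratch ?\<sigma> \<tau> \<and> \<tau> (Reg 13) = int (transfer K m f a e b) \<Longrightarrow> ?Q \<tau>" for \<tau>
    by (auto simp: same_except_def scratch_def)
  have "wp (If 4 cell_sum cell_base) (Suc (70 * K ^ 3)) ?Q ?\<sigma>"
  proof (rule wp_if)
    assume "?\<sigma> (Reg 4) > 0"
    then obtain m' where "m = Suc m'" using env by (cases m) (auto simp: cell_env_def)
    then show "wp cell_sum (70 * K ^ 3) ?Q ?\<sigma>"
      using env' Q by (intro wp_conseq[OF wp_cell_sum[of m' f a e b ?\<sigma>]]) auto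
  next
    assume "\<not> ?\<sigma> (Reg 4) > 0"
    then have "m = 0" using env by (simp add: cell_env_def)
    then show "wp cell_base (70 * K ^ 3) ?Q ?\<sigma>"
      using env' Q by (intro wp_conseq[OF wp_cell_base[of f a e b ?\<sigma>]]) auto
  qed
  then show "wp (Instr (Const 13 0)) 1 (wp (If 4 cell_sum cell_base) (Suc (70 * K ^ 3)) ?Q) \<sigma>"
    by (intro wp_instr) auto
  show "1 + Suc (70 * K ^ 3) \<le> 72 * K ^ 3" using K power_mono[of 2 K 3] by simp
qed

section \<open>Filling the table row by row\<close>

definition valid :: "(nat \<times> nat \<times> nat \<times> nat \<times> nat) set" where
  "valid = {(m, f, a, e, b). m < K \<and> f \<le> 1 \<and> a < K \<and> e < K \<and> b < K}"

text \<open>The cells below K hold outputs and must survive; of the remaining memory only the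
  entries in \<open>D\<close> are described.\<close>

definition extends ::
    "nat set \<Rightarrow> (loc \<Rightarrow> int) \<Rightarrow> (nat \<times> nat \<times> nat \<times> nat \<times> nat) set \<Rightarrow> (loc \<Rightarrow> int) \<Rightarrow> bool" where
  "extends X \<sigma> D \<tau> \<longleftrightarrow> (\<forall>r. r \<notin> X \<longrightarrow> \<tau> (Reg r) = \<sigma> (Reg r)) \<and>
     (\<forall>x<K. \<tau> (Mem (int x)) = \<sigma> (Mem (int x))) \<and> tabulated \<tau> D"

lemma extendsD: "extends X \<sigma> D \<tau> \<Longrightarrow> r \<notin> X \<Longrightarrow> \<tau> (Reg r) = \<sigma> (Reg r)"
  "extends X \<sigma> D \<tau> \<Longrightarrow> tabulated \<tau> D"
  unfolding extends_def by blast+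

lemma tabulated_mono: "tabulated \<sigma> D \<Longrightarrow> E \<subseteq> D \<Longrightarrow> tabulated \<sigma> E"
  unfolding tabulated_def by blast

text \<open>Distinct tuples in \<open>valid\<close> have distinct addresses, so writing one entry
  leaves the others intact.\<close>

lemma tabulated_insert:
  assumes "tabulated \<sigma> D" "D \<subseteq> valid" "(m, f, a, e, b) \<in> valid"
    and "\<And>x. \<tau> (Mem x) = (if x = int (enc K (Suc f) m a e b)
      then int (transfer K m f a e b) else \<sigma> (Mem x))"
  shows "tabulated \<tau> (insert (m, f, a, e, b) D)"
proof -
  have "\<tau> (Mem (int (enc K (Suc f') m' a' e' b'))) = int (transfer K m' f' a' e' b')"
    if d: "(m', f', a', e', b') \<in> D" for m' f' a' e' b'
  proof (cases "enc K (Suc f') m' a' e' b' = enc K (Suc f) m a e b")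
    case True
    have "(m', f', a', e', b') \<in> valid" using d assms(2) by blast
    with True assms(3) have "m' = m" "f' = f" "a' = a" "e' = e" "b' = b"
      unfolding valid_def by (auto dest!: enc_inj)
    then show ?thesis using assms(4) by simp
  next
    case False
    then show ?thesis using assms(1,4) d unfolding tabulated_def by auto
  qed
  moreover have "\<tau> (Mem (int (enc K (Suc f) m a e b))) = int (transfer K m f a e b)"
    using assms(4) by simp
  ultimately show ?thesis unfolding tabulated_def by blast
qed

definition cell_store :: com where
  "cell_store = Seq cell (block (addr 14 27 4 7 9 12 @ [Store 14 13]))"

lemma wp_cell_store:
  assumes env: "cell_env m f a e b \<sigma>" and D: "tabulated \<sigma> D" "D \<subseteq> valid"
  shows "wp cell_store (74 * K ^ 3) (extends scratch \<sigma> (insert (m, f, a, e, b) D)) \<sigma>"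
  unfolding cell_store_def
proof (rule wp_seq[OF wp_conseq[OF wp_cell[OF env] _ order.refl]])
  fix \<tau> assume t: "same_except scratch \<sigma> \<tau> \<and> \<tau> (Reg 13) = int (transfer K m f a e b)"
  have env': "cell_env m f a e b \<tau>" by (rule cell_env_same[OF env]) (use t in auto)
  have e: "f \<le> 1" "a + e + m < K" "b < K" using env unfolding cell_env_def by auto
  have v: "(m, f, a, e, b) \<in> valid" using e unfolding valid_def by auto
  let ?x = "enc K (Suc f) m a e b"
  have "?x < 3 * K ^ 4" using e by (intro enc_less) auto
  then have x: "Mem (int ?x) \<in> locations K" by (intro Mem_locations) simp
  have ge: "K \<le> ?x" using K by (intro enc_ge) auto
  let ?\<rho> = "\<tau>(Reg 14 := int ?x, Mem (int ?x) := int (transfer K m f a e b))"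
  have "tabulated ?\<rho> (insert (m, f, a, e, b) D)"
    by (rule tabulated_insert[OF D v]) (use t in \<open>auto simp: same_except_def\<close>)
  then have "extends scratch \<sigma> (insert (m, f, a, e, b) D) ?\<rho>"
    using t ge unfolding extends_def by (auto simp: same_except_def scratch_def)
  then have "safe_exec (addr 14 27 4 7 9 12 @ [Store 14 13]) \<tau>
      (extends scratch \<sigma> (insert (m, f, a, e, b) D))"
    by (intro safe_exec_addr[where g' = "Suc f" and m' = m and a' = a and e' = e and b' = b])
      (use env' t e x in \<open>simp_all add: cell_env_def\<close>)
  then show "wp (block (addr 14 27 4 7 9 12 @ [Store 14 13])) 11
      (extends scratch \<sigma> (insert (m, f, a, e, b) D)) \<tau>"
    by (intro wp_block) (simp_all add: addr_def)
next
  show "72 * K ^ 3 + 11 \<le> 74 * K ^ 3" using K power_mono[of 2 K 3] by simp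
qed

text \<open>The body meets an intermediate table \<open>D'\<close> of which only two inclusions are
  revealed: the lower one provides the entries that are read, the upper one keeps \<open>D'\<close>
  within \<open>valid\<close>.\<close>

lemma wp_For_fill:
  assumes b: "\<sigma> (Reg b) = int n" "n \<le> M"
    and r: "r < 40" "r \<in> X" "1 \<notin> X" and one: "\<sigma> (Reg 1) = 1"
    and D: "tabulated \<sigma> D"
    and step: "\<And>x \<tau> D'. x < n \<Longrightarrow> extends X \<sigma> D' \<tau> \<Longrightarrow> D \<subseteq> D' \<Longrightarrow>
      D' \<subseteq> D \<union> (\<Union>x<n. E x) \<Longrightarrow> \<tau> (Reg r) = int x \<Longrightarrow>
      wp c k (extends (X - {r}) \<tau> (D' \<union> E x)) \<tau>"
  shows "wp (For r b c) (2 + M * (k + 2)) (extends X \<sigma> (D \<union> (\<Union>x<n. E x))) \<sigma>"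
proof (rule wp_For[where J = "\<lambda>x. extends X \<sigma> (D \<union> (\<Union>y\<in>{x..<n}. E y))" and \<sigma> = \<sigma> and n = n, OF b])
  show "Reg r \<in> locations K" "r \<noteq> 1" "\<sigma> (Reg 1) = 1" "int (value_bound K) \<ge> 0"
    using r one by auto
  show "extends X \<sigma> (D \<union> (\<Union>y\<in>{n..<n}. E y)) (\<sigma>(Reg r := int n))"
    using r D by (auto simp: extends_def tabulated_def)
next
  fix x \<tau> assume x: "x < n" and J: "extends X \<sigma> (D \<union> (\<Union>y\<in>{Suc x..<n}. E y)) \<tau>"
    and t: "\<tau> (Reg 1) = 1"
  let ?D' = "D \<union> (\<Union>y\<in>{Suc x..<n}. E y)"
  have J': "extends X \<sigma> ?D' (\<tau>(Reg r := int x))"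
    using J r by (auto simp: extends_def tabulated_def)
  have "wp c k (extends (X - {r}) (\<tau>(Reg r := int x)) (?D' \<union> E x)) (\<tau>(Reg r := int x))"
    by (rule step[OF x J']) auto
  moreover have "{x..<n} = insert x {Suc x..<n}" using x by auto
  then have "?D' \<union> E x = D \<union> (\<Union>y\<in>{x..<n}. E y)" by auto
  ultimately show "wp c k (\<lambda>\<tau>'. extends X \<sigma> (D \<union> (\<Union>y\<in>{x..<n}. E y)) \<tau>' \<and>
      \<tau>' (Reg r) = int x \<and> \<tau>' (Reg 1) = 1) (\<tau>(Reg r := int x))"
    using J' r t one by (elim wp_conseq) (auto simp: extends_def)
next
  fix \<tau> assume "extends X \<sigma> (D \<union> (\<Union>y\<in>{0..<n}. E y)) \<tau>"
  then show "extends X \<sigma> (D \<union> (\<Union>x<n. E x)) \<tau>" by (simp add: lessThan_atLeast0)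
qed

definition row_env :: "nat \<Rightarrow> (loc \<Rightarrow> int) \<Rightarrow> bool" where
  "row_env m \<sigma> \<longleftrightarrow> \<sigma> (Reg 1) = 1 \<and> \<sigma> (Reg 2) = int K \<and> \<sigma> (Reg 4) = int m \<and>
     \<sigma> (Reg 5) = int m - 1 \<and> \<sigma> (Reg 10) = 2"

lemma row_env_extends:
  "row_env m \<sigma> \<Longrightarrow> extends X \<sigma> D \<tau> \<Longrightarrow> X \<inter> {1, 2, 4, 5, 10} = {} \<Longrightarrow> row_env m \<tau>"
  unfolding row_env_def by (auto dest: extendsD(1))

text \<open>A loop of K rounds raises the exponent by one. Its overhead \<open>2 + K * d\<close> is
  absorbed by \<open>Suc d\<close> further copies of \<open>K ^ Suc n\<close>, which sets the growth
  of the constants from loop to loop.\<close>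

lemma loop_cost:
  assumes "c + Suc d \<le> c'"
  shows "2 + K * (c * K ^ n + d) \<le> c' * K ^ Suc n"
proof -
  define X where "X = K ^ Suc n"
  have "K \<le> X" unfolding X_def using K self_le_power[of K "Suc n"] by simp
  then have "d * K \<le> d * X" "2 \<le> X" using K by (simp_all add: mult_le_mono2)
  moreover have "2 + K * (c * K ^ n + d) = 2 + c * X + d * K" by (simp add: X_def algebra_simps)
  moreover have "(c + Suc d) * X = c * X + X + d * X" by (simp add: algebra_simps)
  ultimately have "2 + K * (c * K ^ n + d) \<le> (c + Suc d) * K ^ Suc n"
    unfolding X_def[symmetric] by linarith
  also have "\<dots> \<le> c' * K ^ Suc n" using assms by (rule mult_le_mono1)
  finally show ?thesis .
qed

definition b_loop :: com where
  "b_loop = For 12 2 cell_store"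

lemma wp_b_loop:
  assumes env: "row_env m \<sigma>" "\<sigma> (Reg 7) = int a" "\<sigma> (Reg 9) = int e" "\<sigma> (Reg 11) = int f"
      "\<sigma> (Reg 27) = int (Suc f)" "f \<le> 1" "a + e + m < K"
    and D: "tabulated \<sigma> D" "D \<subseteq> valid" "earlier m \<subseteq> D"
  shows "wp b_loop (80 * K ^ 4) (extends (insert 12 scratch) \<sigma> (D \<union> (\<Union>b<K. {(m, f, a, e, b)}))) \<sigma>"
proof -
  have "wp b_loop (2 + K * (74 * K ^ 3 + 2))
      (extends (insert 12 scratch) \<sigma> (D \<union> (\<Union>b<K. {(m, f, a, e, b)}))) \<sigma>"
    unfolding b_loop_def
  proof (rule wp_For_fill)
    fix b \<tau> D' assume b: "b < K" "\<tau> (Reg 12) = int b"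
      and t: "extends (insert 12 scratch) \<sigma> D' \<tau>" and D': "D \<subseteq> D'"
        "D' \<subseteq> D \<union> (\<Union>b<K. {(m, f, a, e, b)})"
    have "row_env m \<tau>" using env(1) t by (rule row_env_extends) (auto simp: scratch_def)
    moreover have "\<tau> (Reg r) = \<sigma> (Reg r)" if "r \<in> {7, 9, 11, 27}" for r
      using that by (intro extendsD(1)[OF t]) (auto simp: scratch_def)
    ultimately have env': "cell_env m f a e b \<tau>"
      using env b D(3) D'(1) tabulated_mono[OF extendsD(2)[OF t], of "earlier m"]
      unfolding cell_env_def row_env_def by auto
    have "D' \<subseteq> valid" using D'(2) D(2) env unfolding valid_def by auto
    then have "wp cell_store (74 * K ^ 3) (extends scratch \<tau> (insert (m, f, a, e, b) D')) \<tau>"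
      by (intro wp_cell_store[OF env'] extendsD(2)[OF t])
    moreover have "insert 12 scratch - {12} = scratch" by (auto simp: scratch_def)
    ultimately show "wp cell_store (74 * K ^ 3)
        (extends (insert 12 scratch - {12}) \<tau> (D' \<union> {(m, f, a, e, b)})) \<tau>" by simp
  qed (use env D in \<open>auto simp: row_env_def scratch_def\<close>)
  moreover have "2 + K * (74 * K ^ 3 + 2) \<le> 80 * K ^ 4"
    using loop_cost[of 74 2 80 3] by simp
  ultimately show ?thesis by (rule wp_weaken)
qed

text \<open>Register 10 holds 2, so this loop doubles the cost but leaves the exponent
  alone.\<close>

definition f_loop :: com where
  "f_loop = For 11 10 (Seq (block [Add 27 11 1]) b_loop)"

lemma wp_f_loop:
  assumes env: "row_env m \<sigma>" "\<sigma> (Reg 7) = int a" "\<sigma> (Reg 9) = int e" "a + e + m < K"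
    and D: "tabulated \<sigma> D" "D \<subseteq> valid" "earlier m \<subseteq> D"
  shows "wp f_loop (170 * K ^ 4) (extends (scratch \<union> {11, 12, 27}) \<sigma>
    (D \<union> (\<Union>f<2. \<Union>b<K. {(m, f, a, e, b)}))) \<sigma>"
proof -
  let ?X = "scratch \<union> {11, 12, 27}"
  have "wp f_loop (2 + 2 * ((2 + 80 * K ^ 4) + 2))
      (extends ?X \<sigma> (D \<union> (\<Union>f<2. \<Union>b<K. {(m, f, a, e, b)}))) \<sigma>"
    unfolding f_loop_def
  proof (rule wp_For_fill)
    fix f \<tau> D' assume f: "f < (2 :: nat)" "\<tau> (Reg 11) = int f"
      and t: "extends ?X \<sigma> D' \<tau>" and D': "D \<subseteq> D'"
        "D' \<subseteq> D \<union> (\<Union>f<2. \<Union>b<K. {(m, f, a, e, b)})"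
    let ?\<tau> = "\<tau>(Reg 27 := int (Suc f))"
    have t': "extends ?X \<sigma> D' ?\<tau>" using t by (auto simp: extends_def tabulated_def)
    have row: "row_env m ?\<tau>" using env(1) t' by (rule row_env_extends) (auto simp: scratch_def)
    have same: "\<tau> (Reg 7) = \<sigma> (Reg 7)" "\<tau> (Reg 9) = \<sigma> (Reg 9)"
      using extendsD(1)[OF t, of 7] extendsD(1)[OF t, of 9] by (simp_all add: scratch_def)
    have "D' \<subseteq> valid" using D'(2) D(2) env unfolding valid_def by auto
    then have "wp b_loop (80 * K ^ 4) (extends (insert 12 scratch) ?\<tau> (D' \<union> (\<Union>b<K. {(m, f, a, e, b)}))) ?\<tau>"
      using row same env f extendsD(2)[OF t'] D(3) D'(1) by (intro wp_b_loop) auto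
    then have "wp b_loop (80 * K ^ 4) (extends (?X - {11}) \<tau> (D' \<union> (\<Union>b<K. {(m, f, a, e, b)}))) ?\<tau>"
      by (rule wp_conseq) (auto simp: extends_def scratch_def)
    moreover have "\<bar>int f + 1\<bar> \<le> int (value_bound K)" using f K by (intro index_le_bound) auto
    ultimately show "wp (Seq (block [Add 27 11 1]) b_loop) (2 + 80 * K ^ 4)
        (extends (?X - {11}) \<tau> (D' \<union> (\<Union>b<K. {(m, f, a, e, b)}))) \<tau>"
      using row f by (intro wp_seq[OF wp_block order.refl]) (auto simp: row_env_def add.commute)
  qed (use env D in \<open>auto simp: row_env_def scratch_def\<close>)
  moreover have "10 \<le> 10 * K ^ 4" using K by simp
  then have "2 + 2 * ((2 + 80 * K ^ 4) + 2) \<le> 170 * K ^ 4" by simp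
  ultimately show ?thesis by (rule wp_weaken)
qed

definition e_loop :: com where
  "e_loop = For 9 8 f_loop"

lemma wp_e_loop:
  assumes env: "row_env m \<sigma>" "\<sigma> (Reg 7) = int a" "\<sigma> (Reg 8) = int (K - m - a)" "a + m < K"
    and D: "tabulated \<sigma> D" "D \<subseteq> valid" "earlier m \<subseteq> D"
  shows "wp e_loop (175 * K ^ 5) (extends (scratch \<union> {9, 11, 12, 27}) \<sigma>
    (D \<union> (\<Union>e<K - m - a. \<Union>f<2. \<Union>b<K. {(m, f, a, e, b)}))) \<sigma>"
proof -
  let ?X = "scratch \<union> {9, 11, 12, 27}"
  have "wp e_loop (2 + K * (170 * K ^ 4 + 2)) (extends ?X \<sigma>
      (D \<union> (\<Union>e<K - m - a. \<Union>f<2. \<Union>b<K. {(m, f, a, e, b)}))) \<sigma>"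
    unfolding e_loop_def
  proof (rule wp_For_fill)
    fix e \<tau> D' assume e: "e < K - m - a" "\<tau> (Reg 9) = int e"
      and t: "extends ?X \<sigma> D' \<tau>" and D': "D \<subseteq> D'"
        "D' \<subseteq> D \<union> (\<Union>e<K - m - a. \<Union>f<2. \<Union>b<K. {(m, f, a, e, b)})"
    have row: "row_env m \<tau>" using env(1) t by (rule row_env_extends) (auto simp: scratch_def)
    have same: "\<tau> (Reg 7) = \<sigma> (Reg 7)"
      by (intro extendsD(1)[OF t]) (auto simp: scratch_def)
    have "D' \<subseteq> valid" using D'(2) D(2) env unfolding valid_def by auto
    then have "wp f_loop (170 * K ^ 4) (extends (scratch \<union> {11, 12, 27}) \<tau>
        (D' \<union> (\<Union>f<2. \<Union>b<K. {(m, f, a, e, b)}))) \<tau>"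
      using row same env e extendsD(2)[OF t] D(3) D'(1) by (intro wp_f_loop) auto
    then show "wp f_loop (170 * K ^ 4) (extends (?X - {9}) \<tau>
        (D' \<union> (\<Union>f<2. \<Union>b<K. {(m, f, a, e, b)}))) \<tau>"
      by (rule wp_conseq) (auto simp: extends_def scratch_def)
  qed (use env D in \<open>auto simp: row_env_def scratch_def\<close>)
  moreover have "2 + K * (170 * K ^ 4 + 2) \<le> 175 * K ^ 5"
    using loop_cost[of 170 2 175 4] by simp
  ultimately show ?thesis by (rule wp_weaken)
qed

definition a_loop :: com where
  "a_loop = For 7 6 (Seq (block [Sub 8 6 7]) e_loop)"

lemma wp_a_loop:
  assumes env: "row_env m \<sigma>" "\<sigma> (Reg 6) = int (K - m)" "m < K"
    and D: "tabulated \<sigma> (earlier m)"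
  shows "wp a_loop (180 * K ^ 6) (extends (scratch \<union> {7, 8, 9, 11, 12, 27}) \<sigma> (earlier (Suc m))) \<sigma>"
proof -
  let ?X = "scratch \<union> {7, 8, 9, 11, 12, 27}"
  let ?E = "\<lambda>a. \<Union>e<K - m - a. \<Union>f<2. \<Union>b<K. {(m, f, a, e, b)}"
  have "wp a_loop (2 + K * ((2 + 175 * K ^ 5) + 2)) (extends ?X \<sigma>
      (earlier m \<union> (\<Union>a<K - m. ?E a))) \<sigma>"
    unfolding a_loop_def
  proof (rule wp_For_fill)
    fix a \<tau> D' assume a: "a < K - m" "\<tau> (Reg 7) = int a"
      and t: "extends ?X \<sigma> D' \<tau>" and D': "earlier m \<subseteq> D'" "D' \<subseteq> earlier m \<union> (\<Union>a<K - m. ?E a)"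
    let ?\<tau> = "\<tau>(Reg 8 := int (K - m - a))"
    have t': "extends ?X \<sigma> D' ?\<tau>" using t by (auto simp: extends_def tabulated_def)
    have row: "row_env m ?\<tau>" using env(1) t' by (rule row_env_extends) (auto simp: scratch_def)
    have same: "\<tau> (Reg 6) = \<sigma> (Reg 6)"
      by (intro extendsD(1)[OF t]) (auto simp: scratch_def)
    have "earlier m \<subseteq> valid" using env unfolding earlier_def valid_def by auto
    then have "D' \<subseteq> valid" using D'(2) env unfolding valid_def by auto
    then have "wp e_loop (175 * K ^ 5) (extends (scratch \<union> {9, 11, 12, 27}) ?\<tau> (D' \<union> ?E a)) ?\<tau>"
      using row env a extendsD(2)[OF t'] D'(1) by (intro wp_e_loop) auto
    then have "wp e_loop (175 * K ^ 5) (extends (?X - {7}) \<tau> (D' \<union> ?E a)) ?\<tau>"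
      by (rule wp_conseq) (auto simp: extends_def scratch_def)
    moreover have "\<bar>int (K - m) - int a\<bar> \<le> int (value_bound K)"
      using a K by (intro index_le_bound) auto
    moreover have "int (K - m) - int a = int (K - m - a)" using a by simp
    ultimately show "wp (Seq (block [Sub 8 6 7]) e_loop) (2 + 175 * K ^ 5)
        (extends (?X - {7}) \<tau> (D' \<union> ?E a)) \<tau>"
      using env same a
      by (intro wp_seq[OF wp_block order.refl]) (simp_all del: of_nat_diff diff_diff_left)
  qed (use env D in \<open>auto simp: row_env_def scratch_def\<close>)
  moreover have "2 + K * ((2 + 175 * K ^ 5) + 2) \<le> 180 * K ^ 6"
  proof -
    have "(2 + 175 * K ^ 5) + 2 = 175 * K ^ 5 + 4" by simp
    moreover have "2 + K * (175 * K ^ 5 + 4) \<le> 180 * K ^ 6"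
      using loop_cost[of 175 4 180 5] by simp
    ultimately show ?thesis by metis
  qed
  \<comment> \<open>The loop bounds \<open>K - m\<close> for \<open>a\<close> and
    \<open>K - m - a\<close> for \<open>e\<close> cut out exactly row \<open>m\<close> of the
    simplex.\<close>
  moreover have "earlier m \<union> (\<Union>a<K - m. ?E a) = earlier (Suc m)"
    using env(3) by (auto simp: earlier_def less_Suc_eq)
  ultimately show ?thesis by (simp only: wp_weaken)
qed

section \<open>Output cells\<close>

definition output_step :: com where
  "output_step = block (addr 14 10 4 26 26 12 @ [Load 15 14, Add 13 13 15])"

lemma wp_output_step:
  assumes "row_env m \<sigma>" "\<sigma> (Reg 26) = 0" "\<sigma> (Reg 12) = int b" "m < K" "b < K"
    and "tabulated \<sigma> (earlier (Suc m))"
    and acc: "\<sigma> (Reg 13) \<ge> 0" "\<sigma> (Reg 13) + int (transfer K m 1 0 0 b) \<le> int (value_bound K)"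
  shows "wp output_step 12 (\<lambda>\<tau>. same_except {13, 14, 15} \<sigma> \<tau> \<and>
    \<tau> (Reg 13) = \<sigma> (Reg 13) + int (transfer K m 1 0 0 b)) \<sigma>"
  unfolding output_step_def
proof (rule wp_block)
  have x: "\<sigma> (Mem (int (enc K 2 m 0 0 b))) = int (transfer K m 1 0 0 b)"
    using assms tabulatedD[of \<sigma> "Suc m" m 1 0 0 b] by (simp add: numeral_2_eq_2)
  have "\<bar>\<sigma> (Reg 13) + int (transfer K m (Suc 0) 0 0 b)\<bar> \<le> int (value_bound K)"
    using acc by simp
  then show "safe_exec (addr 14 10 4 26 26 12 @ [Load 15 14, Add 13 13 15]) \<sigma>
      (\<lambda>\<tau>. same_except {13, 14, 15} \<sigma> \<tau> \<and>
        \<tau> (Reg 13) = \<sigma> (Reg 13) + int (transfer K m 1 0 0 b))"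
    using assms K by (intro safe_exec_addr[where g' = 2 and m' = m and a' = 0 and e' = 0 and b' = b])
      (simp_all add: row_env_def x[unfolded One_nat_def] same_except_def)
qed (simp_all add: addr_def)

definition output_sum :: "nat \<Rightarrow> nat" where
  "output_sum m = (\<Sum>b<K. transfer K m 1 0 0 b)"

lemma output_sum_le:
  assumes "m < K"
  shows "output_sum m \<le> value_bound K"
proof -
  have "output_sum m \<le> (\<Sum>b<K. (2 * K ^ 3) ^ m)"
    unfolding output_sum_def using assms by (intro sum_mono transfer_le) auto
  also have "\<dots> = K * (2 * K ^ 3) ^ m" by simp
  also have "\<dots> \<le> (2 * K ^ 3) * (2 * K ^ 3) ^ m"
    using self_le_power[of K 3] K by (intro mult_le_mono1) simp
  also have "\<dots> = (2 * K ^ 3) ^ Suc m" by simp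
  also have "\<dots> \<le> value_bound K"
    unfolding value_bound_def using assms K by (intro power_increasing) auto
  finally show ?thesis .
qed

definition output_loop :: com where
  "output_loop = Seq (Instr (Const 13 0)) (Seq (For 12 2 output_step) (Instr (Store 4 13)))"

lemma wp_output_loop:
  assumes env: "row_env m \<sigma>" "\<sigma> (Reg 26) = 0" "m < K"
    and D: "tabulated \<sigma> (earlier (Suc m))"
  shows "wp output_loop (4 + K * 14) (\<lambda>\<tau>.
    (\<forall>r. r \<notin> insert 12 scratch \<longrightarrow> \<tau> (Reg r) = \<sigma> (Reg r)) \<and>
    (\<forall>x. \<tau> (Mem x) = (if x = int m then int (output_sum m) else \<sigma> (Mem x)))) \<sigma>"
    (is "wp _ _ ?Q _")
proof -
  let ?X = "{12, 13, 14, 15}"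
  let ?\<sigma> = "\<sigma>(Reg 13 := 0)"
  have "wp (For 12 2 output_step) (2 + K * (12 + 2)) (\<lambda>\<tau>. same_except ?X ?\<sigma> \<tau> \<and>
      \<tau> (Reg 13) = ?\<sigma> (Reg 13) + int (\<Sum>b<K. transfer K m 1 0 0 b)) ?\<sigma>"
  proof (rule wp_For_sum)
    fix b \<tau> assume b: "b < K" and s: "same_except ?X ?\<sigma> \<tau>" "\<tau> (Reg 12) = int b"
      and ac: "?\<sigma> (Reg 13) \<le> \<tau> (Reg 13)" "\<tau> (Reg 13) + int (transfer K m 1 0 0 b)
        \<le> ?\<sigma> (Reg 13) + int (\<Sum>b<K. transfer K m 1 0 0 b)"
    show "wp output_step 12 (\<lambda>\<tau>'. same_except (?X - {12}) \<tau> \<tau>' \<and>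
        \<tau>' (Reg 13) = \<tau> (Reg 13) + int (transfer K m 1 0 0 b)) \<tau>"
    proof (rule wp_conseq[OF wp_output_step[where \<sigma> = \<tau> and m = m and b = b, OF _ _ s(2) env(3) b]])
      show "row_env m \<tau>" "\<tau> (Reg 26) = 0"
        using env s(1) unfolding row_env_def by (auto simp: same_except_def)
      show "tabulated \<tau> (earlier (Suc m))"
        using D s(1) unfolding tabulated_def by (simp add: same_except_def)
      show "0 \<le> \<tau> (Reg 13)" using ac(1) by simp
      have "int (output_sum m) \<le> int (value_bound K)" "?\<sigma> (Reg 13) = 0"
        using output_sum_le[OF env(3)] by simp_all
      then show "\<tau> (Reg 13) + int (transfer K m 1 0 0 b) \<le> int (value_bound K)"
        using ac(2) unfolding output_sum_def[symmetric] by linarith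
    qed (auto elim: same_except_mono)
  qed (use env in \<open>auto simp: row_env_def\<close>)
  then have "wp (For 12 2 output_step) (2 + K * (12 + 2)) (wp (Instr (Store 4 13)) 1 ?Q) ?\<sigma>"
  proof (rule wp_conseq)
    fix \<tau> assume t: "same_except ?X ?\<sigma> \<tau> \<and>
      \<tau> (Reg 13) = ?\<sigma> (Reg 13) + int (\<Sum>b<K. transfer K m 1 0 0 b)"
    have "m * 1 \<le> K * K ^ 3" using env(3) K by (intro mult_le_mono) auto
    then have "m \<le> 3 * K ^ 4" by (simp add: power_numeral_reduce)
    then have "Mem (int m) \<in> locations K" by (rule Mem_locations)
    then show "wp (Instr (Store 4 13)) 1 ?Q \<tau>"
      using t env by (intro wp_instr) (auto simp: row_env_def same_except_def scratch_def output_sum_def)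
  qed simp
  then have "wp (Seq (For 12 2 output_step) (Instr (Store 4 13))) (3 + K * 14) ?Q ?\<sigma>"
    by (rule wp_seq) simp
  then show ?thesis
    unfolding output_loop_def by (intro wp_seq[OF wp_instr]) auto
qed

section \<open>The loop over the rows\<close>

definition row :: com where
  "row = Seq (block [Sub 4 0 3, Sub 5 4 1, Sub 6 2 4]) (Seq a_loop output_loop)"

definition main_env :: "(loc \<Rightarrow> int) \<Rightarrow> bool" where
  "main_env \<sigma> \<longleftrightarrow> \<sigma> (Reg 0) = int K - 1 \<and> \<sigma> (Reg 1) = 1 \<and> \<sigma> (Reg 2) = int K \<and>
     \<sigma> (Reg 10) = 2 \<and> \<sigma> (Reg 26) = 0"

definition progress :: "nat \<Rightarrow> (loc \<Rightarrow> int) \<Rightarrow> bool" where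
  "progress m \<sigma> \<longleftrightarrow> main_env \<sigma> \<and> tabulated \<sigma> (earlier m) \<and>
     (\<forall>n<m. \<sigma> (Mem (int n)) = int (output_sum n))"

text \<open>Rows must be filled upwards, since each reads the ones before it, whereas
  \<open>For\<close> counts down; therefore \<open>m\<close> is recomputed as N minus the loop
  variable.\<close>

lemma wp_row:
  assumes p: "progress m \<sigma>" and m: "m < K" and x: "\<sigma> (Reg 3) = int (K - Suc m)"
  shows "wp row (190 * K ^ 6) (\<lambda>\<tau>. progress (Suc m) \<tau> \<and> \<tau> (Reg 3) = \<sigma> (Reg 3)) \<sigma>"
proof -
  let ?\<sigma> = "\<sigma>(Reg 4 := int m, Reg 5 := int m - 1, Reg 6 := int (K - m))"
  let ?Q = "\<lambda>\<tau>. progress (Suc m) \<tau> \<and> \<tau> (Reg 3) = \<sigma> (Reg 3)"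
  let ?X = "scratch \<union> {7, 8, 9, 11, 12, 27}"
  have env: "row_env m ?\<sigma>" using p unfolding progress_def main_env_def row_env_def by simp
  have "tabulated ?\<sigma> (earlier m)" using p unfolding progress_def tabulated_def by simp
  then have "wp a_loop (180 * K ^ 6) (extends ?X ?\<sigma> (earlier (Suc m))) ?\<sigma>"
    using env m by (intro wp_a_loop) auto
  then have "wp a_loop (180 * K ^ 6) (wp output_loop (4 + K * 14) ?Q) ?\<sigma>"
  proof (rule wp_conseq)
    fix \<tau> assume t: "extends ?X ?\<sigma> (earlier (Suc m)) \<tau>"
    have "row_env m \<tau>" using env t by (rule row_env_extends) (auto simp: scratch_def)
    moreover have "\<tau> (Reg 26) = 0"
      using extendsD(1)[OF t, of 26] p by (simp add: scratch_def progress_def main_env_def)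
    ultimately have "wp output_loop (4 + K * 14) (\<lambda>\<rho>.
        (\<forall>r. r \<notin> insert 12 scratch \<longrightarrow> \<rho> (Reg r) = \<tau> (Reg r)) \<and>
        (\<forall>x. \<rho> (Mem x) = (if x = int m then int (output_sum m) else \<tau> (Mem x)))) \<tau>"
      using m extendsD(2)[OF t] by (intro wp_output_loop)
    then show "wp output_loop (4 + K * 14) ?Q \<tau>"
    proof (rule wp_conseq)
      fix \<rho> assume r: "(\<forall>r. r \<notin> insert 12 scratch \<longrightarrow> \<rho> (Reg r) = \<tau> (Reg r)) \<and>
        (\<forall>x. \<rho> (Mem x) = (if x = int m then int (output_sum m) else \<tau> (Mem x)))"
      have same: "\<rho> (Reg r) = ?\<sigma> (Reg r)" if "r \<notin> ?X" for r
        using r extendsD(1)[OF t that] that by simp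
      then have "main_env \<rho>" "\<rho> (Reg 3) = \<sigma> (Reg 3)"
        using p by (simp_all add: progress_def main_env_def scratch_def)
      moreover have "tabulated \<rho> (earlier (Suc m))"
      proof -
        \<comment> \<open>Table addresses start at K, so the output written to cell \<open>m\<close>
          destroys no entry.\<close>
        have "int (enc K (Suc f) m' a e b) \<noteq> int m" for m' f a e b
          using enc_ge[of "Suc f" K m' a e b] m by simp
        then show ?thesis using extendsD(2)[OF t] r unfolding tabulated_def by simp
      qed
      moreover have "\<forall>n<Suc m. \<rho> (Mem (int n)) = int (output_sum n)"
        using r t p m unfolding progress_def extends_def by (auto simp: less_Suc_eq)
      ultimately show "?Q \<rho>" unfolding progress_def by blast
    qed simp
  qed simp
  then have "wp (Seq a_loop output_loop) (180 * K ^ 6 + (4 + K * 14)) ?Q ?\<sigma>"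
    by (rule wp_seq) simp
  moreover have "int K - 1 - int (K - Suc m) = int m" "int K - int m = int (K - m)"
    using m by auto
  moreover have "\<bar>int m\<bar> \<le> int (value_bound K)" "\<bar>int m - 1\<bar> \<le> int (value_bound K)"
    "\<bar>int (K - m)\<bar> \<le> int (value_bound K)"
    by (rule index_le_bound, use m in simp)+
  ultimately have "wp (block [Sub 4 0 3, Sub 5 4 1, Sub 6 2 4]) 4
      (wp (Seq a_loop output_loop) (180 * K ^ 6 + (4 + K * 14)) ?Q) \<sigma>"
    using p x by (intro wp_block) (simp_all add: progress_def main_env_def del: of_nat_diff)
  then show ?thesis
    unfolding row_def
  proof (rule wp_seq)
    have "2 ^ 5 \<le> K ^ 5" using K by (intro power_mono) auto
    then have "K * 32 \<le> K * K ^ 5" by simp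
    then have "K * 32 \<le> K ^ 6" by (simp add: power_numeral_reduce)
    then show "4 + (180 * K ^ 6 + (4 + K * 14)) \<le> 190 * K ^ 6" using K by simp
  qed
qed

definition program :: com where
  "program = Seq (block [Const 1 1, Add 2 0 1, Const 10 2, Const 26 0]) (For 3 2 row)"

lemma wp_program:
  assumes "\<sigma> (Reg 0) = int (K - 1)"
  shows "wp program (200 * K ^ 7) (progress K) \<sigma>"
proof -
  have K1: "int (K - 1) = int K - 1" using K by simp
  define k where "k = 2 + K * (190 * K ^ 6 + 2)"
  have main: "wp (For 3 2 row) k (progress K) \<tau>" if "main_env \<tau>" for \<tau>
    unfolding k_def
  proof (rule wp_For[where J = "\<lambda>x. progress (K - x)" and n = K])
    show "progress (K - K) (\<tau>(Reg 3 := int K))"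
      using that by (simp add: progress_def main_env_def tabulated_def earlier_def)
  next
    fix x \<rho> assume x: "x < K" and p: "progress (K - Suc x) \<rho>"
    have "wp row (190 * K ^ 6) (\<lambda>\<tau>. progress (Suc (K - Suc x)) \<tau> \<and> \<tau> (Reg 3) = (\<rho>(Reg 3 := int x)) (Reg 3))
        (\<rho>(Reg 3 := int x))"
      using p x by (intro wp_row) (auto simp: progress_def main_env_def tabulated_def)
    then show "wp row (190 * K ^ 6) (\<lambda>\<tau>'. progress (K - x) \<tau>' \<and> \<tau>' (Reg 3) = int x \<and> \<tau>' (Reg 1) = 1)
        (\<rho>(Reg 3 := int x))"
      using x by (elim wp_conseq) (auto simp: progress_def main_env_def Suc_diff_Suc)
  qed (use that in \<open>auto simp: main_env_def\<close>)
  have "wp (block [Const 1 1, Add 2 0 1, Const 10 2, Const 26 0]) 5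
     (wp (For 3 2 row) k (progress K)) \<sigma>"
    using assms K1 const_le_bound[of 1] const_le_bound[of 2] index_le_bound[of "int K"]
    by (intro wp_block) (auto intro!: main simp: main_env_def)
  then show ?thesis
    unfolding program_def
  proof (rule wp_seq)
    have "5 \<le> 5 * K ^ 7" using K by simp
    moreover have "k \<le> 195 * K ^ 7"
      using loop_cost[of 190 2 195 6] unfolding k_def by simp
    ultimately show "5 + k \<le> 200 * K ^ 7" by linarith
  qed
qed

end

section \<open>Resources\<close>

text \<open>Every number handled has at most \<open>bits B\<close> bits, and linear charges are
  dominated by \<open>M\<close>; the factor 2 is for instructions that handle two numbers.\<close>

lemma (in machine) ok_bit_cost:
  assumes "ok s" "ok (effect i s)" and M: "mono M" "\<forall>b. real b \<le> M b"
  shows "bit_cost M i s \<le> 2 * M (bits B)"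
proof -
  have mono: "bits x \<le> bits B" if "\<bar>x\<bar> \<le> B" for x
    using that by (simp add: bits_def floorlog_mono nat_mono)
  have b: "bits (val s l) \<le> bits B" for l
    using assms(1) by (intro mono) (auto simp: ok_def)
  have b': "bits (val (effect i s) l) \<le> bits B" for l
    using assms(2) by (intro mono) (auto simp: ok_def)
  have M1: "real (bits B) \<le> M (bits B)" using M by blast
  have le: "real (bits x) \<le> M (bits B)" if "bits x \<le> bits B" for x
    using that M1 by linarith
  show ?thesis
  proof (cases i)
    case (Const r c)
    \<comment> \<open>The constant appears only in the store after the instruction, so the bound is
      taken from there.\<close>
    then have "bits c \<le> bits B" using b'[of "Reg r"] by (simp add: val_upd)
    then show ?thesis using Const le[of c] M1 by simp
  next
    case (Mul r x y)
    have "M (max (bits (val s (Reg x))) (bits (val s (Reg y)))) \<le> M (bits B)"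
      using b by (intro monoD[OF M(1)]) simp
    then show ?thesis using Mul M1 by simp
  next
    case (Copy r x)
    then show ?thesis using le[OF b, of "Reg x"] M1 by simp
  next
    case (Test x)
    then show ?thesis using le[OF b, of "Reg x"] M1 by simp
  next
    case (Add r x y)
    then show ?thesis using le[OF b, of "Reg x"] le[OF b, of "Reg y"] by simp
  next
    case (Sub r x y)
    then show ?thesis using le[OF b, of "Reg x"] le[OF b, of "Reg y"] by simp
  next
    case (Load r x)
    then show ?thesis using le[OF b, of "Reg x"] le[OF b, of "Mem (val s (Reg x))"] by simp
  next
    case (Store x y)
    then show ?thesis using le[OF b, of "Reg x"] le[OF b, of "Reg y"] by simp
  qed
qed

lemma finite_locations: "finite (locations K)"
  unfolding locations_def by simp

lemma card_locations: "card (locations K) \<le> 41 + 3 * K ^ 4"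
proof -
  have "card (locations K) \<le> card (Reg ` {..<40}) + card (Mem ` {0..3 * int K ^ 4})"
    unfolding locations_def by (rule card_Un_le)
  also have "card (Reg ` {..<40}) \<le> 40" using card_image_le[of "{..<40}" Reg] by simp
  also have "card (Mem ` {0..3 * int K ^ 4}) \<le> card {0..3 * int K ^ 4}"
    by (rule card_image_le) simp
  also have "\<dots> = 1 + 3 * K ^ 4"
    by (simp add: nat_add_distrib nat_mult_distrib nat_power_eq)
  finally show ?thesis by simp
qed

context table
begin

lemma ok_stored: "ok s \<Longrightarrow> card (dom s) \<le> 41 + 3 * K ^ 4"
  using card_mono[OF finite_locations, of "dom s" K] card_locations[of K] unfolding ok_def by linarith

text \<open>Addresses are also below the value bound, so a location is charged at most twice that
  size: once for its address and once for its content.\<close>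

lemma ok_store_bits:
  assumes "ok s"
  shows "store_bits s \<le> (41 + 3 * K ^ 4) * (2 * bits (int (value_bound K)))"
proof -
  let ?B = "bits (int (value_bound K))"
  have mono: "bits x \<le> ?B" if "\<bar>x\<bar> \<le> int (value_bound K)" for x
    using that by (simp add: bits_def floorlog_mono)
  have "location_bits l + bits (val s l) \<le> 2 * ?B" if "l \<in> dom s" for l
  proof -
    have "bits (val s l) \<le> ?B" using assms by (intro mono) (auto simp: ok_def)
    moreover have "location_bits l \<le> ?B"
    proof (cases l)
      case (Mem x)
      have "l \<in> locations K" using that assms by (auto simp: ok_def)
      then have "0 \<le> x" "x \<le> 3 * int K ^ 4" using Mem by (auto simp: locations_def)
      moreover have "int (3 * K ^ 4) \<le> int (value_bound K)"
        using bound_ge by (simp only: of_nat_le_iff)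
      ultimately have "\<bar>x\<bar> \<le> int (value_bound K)" by simp
      then show ?thesis using mono Mem by simp
    qed simp
    ultimately show ?thesis by linarith
  qed
  then have "store_bits s \<le> card (dom s) * (2 * ?B)"
    unfolding store_bits_def using sum_bounded_above[of "dom s" _ "2 * ?B"] by simp
  also have "\<dots> \<le> (41 + 3 * K ^ 4) * (2 * ?B)"
    by (rule mult_le_mono1[OF ok_stored[OF assms]])
  finally show ?thesis .
qed

lemma run_program:
  "\<exists>tr t. run program (initial_store (K - 1)) tr t \<and>
     (\<forall>n<K. val t (Mem (int n)) = int (output_sum n)) \<and>
     operations tr \<le> 200 * K ^ 7 \<and>
     stored_integers tr t \<le> 41 + 3 * K ^ 4 \<and>
     (\<forall>M. mono M \<and> (\<forall>b. real b \<le> M b) \<longrightarrow>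
        bit_operations M tr \<le> real (200 * K ^ 7) * (2 * M (bits (int (value_bound K))))) \<and>
     bit_storage tr t \<le> (41 + 3 * K ^ 4) * (2 * bits (int (value_bound K)))"
proof -
  have v: "val (initial_store (K - 1)) = (\<lambda>l. if l = Reg 0 then int (K - 1) else 0)"
    by (auto simp: initial_store_def val_def)
  have "ok (initial_store (K - 1))"
    unfolding ok_def v using index_le_bound[of "int (K - 1)"] by (auto simp: initial_store_def)
  moreover have "wp program (200 * K ^ 7) (progress K) (val (initial_store (K - 1)))"
    unfolding v by (rule wp_program) simp
  ultimately obtain tr t where r: "run program (initial_store (K - 1)) tr t" "ok t" "progress K (val t)"
    "length tr \<le> 200 * K ^ 7" "\<forall>(i, s)\<in>set tr. ok s \<and> ok (effect i s)"
    unfolding wp_def by blast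
  have vis: "finite (visited tr t)" "visited tr t \<noteq> {}" "\<And>s. s \<in> visited tr t \<Longrightarrow> ok s"
    using r(2,5) unfolding visited_def by auto
  have "\<forall>n<K. val t (Mem (int n)) = int (output_sum n)" using r(3) unfolding progress_def by blast
  moreover have "stored_integers tr t \<le> 41 + 3 * K ^ 4"
    unfolding stored_integers_def using vis ok_stored by (subst Max_le_iff) auto
  moreover have "bit_storage tr t \<le> (41 + 3 * K ^ 4) * (2 * bits (int (value_bound K)))"
    unfolding bit_storage_def using vis ok_store_bits by (subst Max_le_iff) auto
  moreover have "bit_operations M tr \<le> real (200 * K ^ 7) * (2 * M (bits (int (value_bound K))))"
    if M: "mono M" "\<forall>b. real b \<le> M b" for M
  proof -
    let ?c = "2 * M (bits (int (value_bound K)))"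
    have "bit_operations M tr \<le> (\<Sum>x\<leftarrow>tr. ?c)"
      unfolding bit_operations_def using r(5) ok_bit_cost[OF _ _ M]
      by (intro sum_list_mono) auto
    also have "\<dots> = real (length tr) * ?c" by (simp add: sum_list_triv)
    also have "\<dots> \<le> real (200 * K ^ 7) * ?c"
    proof (rule mult_right_mono)
      show "real (length tr) \<le> real (200 * K ^ 7)" using r(4) by (simp only: of_nat_le_iff)
      have "0 \<le> real (bits (int (value_bound K)))" by simp
      also have "\<dots> \<le> M (bits (int (value_bound K)))" using M(2) by blast
      finally show "0 \<le> ?c" by simp
    qed
    finally show ?thesis .
  qed
  ultimately show ?thesis using r(1,4) unfolding operations_def by blast
qed

end

text \<open>The logarithm of the bound is \<open>K * (1 + 3 * log 2 K)\<close> with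
  \<open>K = N + 1\<close>, where \<open>K \<le> 2 * N\<close> and
  \<open>log 2 K \<le> 2 * log 2 N\<close>. From \<open>N = 2\<close> on, \<open>N * log 2 N\<close>
  is at least 1 and absorbs the additive constants; 40 is generous.\<close>

lemma bits_value_bound:
  assumes "N \<ge> 2"
  shows "real (bits (int (value_bound (Suc N)))) \<le> 40 * (real N * log 2 (real N))"
proof -
  define L where "L = log 2 (real N)"
  have L: "1 \<le> L" using assms unfolding L_def by (simp add: le_log_iff)
  have pos: "value_bound (Suc N) > 0" by (simp add: value_bound_def)
  have "log 2 (real (Suc N)) \<le> log 2 (2 * real N)" using assms by simp
  also have "\<dots> = 1 + L" using assms by (simp add: log_mult L_def)
  finally have S: "log 2 (real (Suc N)) \<le> 2 * L" using L by simp
  have "real (floorlog 2 (value_bound (Suc N))) \<le> 1 + log 2 (real (value_bound (Suc N)))"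
    using pos by (simp add: floorlog_def of_nat_floor)
  also have "log 2 (real (value_bound (Suc N))) = real (Suc N) * (1 + 3 * log 2 (real (Suc N)))"
    by (simp add: value_bound_def log_nat_power log_mult algebra_simps del: of_nat_Suc power_Suc)
  also have "\<dots> \<le> (2 * real N) * (L + 3 * (2 * L))"
    using assms L S by (intro mult_mono) auto
  finally have "real (floorlog 2 (value_bound (Suc N))) \<le> 1 + 14 * (real N * L)" by simp
  moreover have "1 * 1 \<le> real N * L" using assms L by (intro mult_mono) auto
  ultimately show ?thesis unfolding L_def[symmetric] bits_def by simp
qed

lemma runs_count_pos: "runs_count n a ds \<ge> 1"
proof (induction n arbitrary: a ds)
  case 0
  then show ?case by simp
next
  case (Suc n)
  from Suc.IH[of a "1 # ds"] show ?case by simp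
qed

lemma power_Suc_le: "N \<ge> 1 \<Longrightarrow> Suc N ^ k \<le> 2 ^ k * N ^ k"
  using power_mono[of "Suc N" "2 * N" k] by (simp add: power_mult_distrib)

text \<open>Six doublings give 64, a power of two above the constant 40 in
  \<open>bits_value_bound\<close>. The absolute value of \<open>C\<close> makes the iteration
  monotone.\<close>

lemma multiplication_cost_scale:
  assumes "multiplication_cost M"
  obtains c where "c \<ge> 0" "\<And>b. M (64 * b) \<le> c * M b"
proof -
  obtain C where C: "\<And>b. M (2 * b) \<le> C * M b" and ge: "\<And>b. real b \<le> M b"
    using assms unfolding multiplication_cost_def by blast
  have pos: "0 \<le> M b" for b using ge[of b] by linarith
  have abs: "M (2 * b) \<le> \<bar>C\<bar> * M b" for b
    using C[of b] mult_right_mono[OF abs_ge_self[of C] pos[of b]] by linarith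
  have pow: "M (2 ^ k * b) \<le> \<bar>C\<bar> ^ k * M b" for k b
  proof (induction k)
    case 0
    then show ?case by simp
  next
    case (Suc k)
    have "M (2 ^ Suc k * b) \<le> \<bar>C\<bar> * M (2 ^ k * b)"
      using abs[of "2 ^ k * b"] by (simp add: mult.assoc)
    also have "\<dots> \<le> \<bar>C\<bar> * (\<bar>C\<bar> ^ k * M b)" using Suc by (intro mult_left_mono) auto
    finally show ?case by (simp add: mult.assoc)
  qed
  show ?thesis
    by (rule that[of "\<bar>C\<bar> ^ 6"]) (use pow[of 6] in auto)
qed

text \<open>\<open>table.program\<close> carries no parameter K, so a single program serves all N.
  The bound for all \<open>M\<close> refers to one trace, since a run does not depend on the
  multiplication cost.\<close>

definition computes :: "nat \<Rightarrow> trace \<Rightarrow> store \<Rightarrow> bool" where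
  "computes N tr t \<longleftrightarrow> run table.program (initial_store N) tr t \<and>
     (\<forall>n\<le>N. t (Mem (int n)) = Some (int (card (Av n [1, 2, 4, 5, 3])))) \<and>
     operations tr \<le> 200 * Suc N ^ 7 \<and>
     stored_integers tr t \<le> 41 + 3 * Suc N ^ 4 \<and>
     (\<forall>M. multiplication_cost M \<longrightarrow> bit_operations M tr \<le>
        real (200 * Suc N ^ 7) * (2 * M (bits (int (value_bound (Suc N)))))) \<and>
     bit_storage tr t \<le> (41 + 3 * Suc N ^ 4) * (2 * bits (int (value_bound (Suc N))))"

lemma computes_ex:
  assumes "N \<ge> 1"
  shows "\<exists>tr t. computes N tr t"
proof -
  interpret table "Suc N" by unfold_locales (use assms in simp)
  obtain tr t where r: "run program (initial_store N) tr t"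
    "\<forall>n<Suc N. val t (Mem (int n)) = int (output_sum n)"
    "operations tr \<le> 200 * Suc N ^ 7" "stored_integers tr t \<le> 41 + 3 * Suc N ^ 4"
    "\<forall>M. mono M \<and> (\<forall>b. real b \<le> M b) \<longrightarrow> bit_operations M tr \<le>
        real (200 * Suc N ^ 7) * (2 * M (bits (int (value_bound (Suc N)))))"
    "bit_storage tr t \<le> (41 + 3 * Suc N ^ 4) * (2 * bits (int (value_bound (Suc N))))"
    using run_program unfolding diff_Suc_1 by blast
  have "t (Mem (int n)) = Some (int (card (Av n [1, 2, 4, 5, 3])))" if "n \<le> N" for n
  proof -
    have "output_sum n = card (Av n [1, 2, 4, 5, 3])"
      unfolding output_sum_def card_Av_eq_runs_count
      using that by (intro runs_count_singleton[symmetric]) simp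
    moreover have "card (Av n [1, 2, 4, 5, 3]) \<noteq> 0"
      unfolding card_Av_eq_runs_count using runs_count_pos[of n 0 "[0]"] by simp
    ultimately show ?thesis
      using r(2) that by (auto simp: val_def less_Suc_eq_le split: option.splits)
  qed
  then show ?thesis
    using r unfolding computes_def multiplication_cost_def by blast
qed

theorem corollary7p4:
  "\<exists>(P :: com) (tr :: nat \<Rightarrow> trace) (fin :: nat \<Rightarrow> store).
     (\<forall>N\<ge>1. run P (initial_store N) (tr N) (fin N) \<and>
            (\<forall>n\<le>N. fin N (Mem (int n)) = Some (int (card (Av n [1, 2, 4, 5, 3]))))) \<and>
     (\<lambda>N. real (operations (tr N))) \<in> O(\<lambda>N. real N ^ 7) \<and>
     (\<lambda>N. real (stored_integers (tr N) (fin N))) \<in> O(\<lambda>N. real N ^ 4) \<and>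
     (\<forall>M. multiplication_cost M \<longrightarrow>
        (\<lambda>N. bit_operations M (tr N))
          \<in> O(\<lambda>N. real N ^ 7 * M (nat \<lceil>real N * log 2 (real N)\<rceil>))) \<and>
     (\<lambda>N. real (bit_storage (tr N) (fin N))) \<in> O(\<lambda>N. real N ^ 5 * log 2 (real N))"
proof -
  \<comment> \<open>For \<open>N = 0\<close> the choice is arbitrary; the asymptotic bounds are
    checked from \<open>N = 2\<close> on.\<close>
  define tr where "tr N = (SOME tr. \<exists>t. computes N tr t)" for N
  define fin where "fin N = (SOME t. computes N (tr N) t)" for N
  have c: "computes N (tr N) (fin N)" if "N \<ge> 1" for N
    unfolding fin_def tr_def by (rule someI_ex[OF someI_ex[OF computes_ex[OF that]]])
  \<comment> \<open>From \<open>Suc N \<le> 2 * N\<close>: 25600 is \<open>200 * 2 ^ 7\<close>, and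
    89 is \<open>41 + 3 * 2 ^ 4\<close>.\<close>
  have pow: "real (200 * Suc N ^ 7) \<le> 25600 * real N ^ 7"
    "real (41 + 3 * Suc N ^ 4) \<le> 89 * real N ^ 4" if "N \<ge> 2" for N
  proof -
    have "200 * Suc N ^ 7 \<le> 25600 * N ^ 7" using power_Suc_le[of N 7] that by simp
    then have "real (200 * Suc N ^ 7) \<le> real (25600 * N ^ 7)" by (simp only: of_nat_le_iff)
    then show "real (200 * Suc N ^ 7) \<le> 25600 * real N ^ 7" by simp
    have "1 \<le> N ^ 4" "Suc N ^ 4 \<le> 16 * N ^ 4" using power_Suc_le[of N 4] that by simp_all
    then have "41 + 3 * Suc N ^ 4 \<le> 89 * N ^ 4" by linarith
    then have "real (41 + 3 * Suc N ^ 4) \<le> real (89 * N ^ 4)" by (simp only: of_nat_le_iff)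
    then show "real (41 + 3 * Suc N ^ 4) \<le> 89 * real N ^ 4" by simp
  qed
  have "(\<lambda>N. real (operations (tr N))) \<in> O(\<lambda>N. real N ^ 7)"
  proof (rule bigoI[of _ 25600], rule eventually_at_top_linorderI[of 2])
    fix N :: nat assume N: "2 \<le> N"
    have "real (operations (tr N)) \<le> real (200 * Suc N ^ 7)"
      using c[of N] N unfolding computes_def by (simp only: of_nat_le_iff)
    then show "norm (real (operations (tr N))) \<le> 25600 * norm (real N ^ 7)"
      using pow(1)[OF N] by simp
  qed
  moreover have "(\<lambda>N. real (stored_integers (tr N) (fin N))) \<in> O(\<lambda>N. real N ^ 4)"
  proof (rule bigoI[of _ 89], rule eventually_at_top_linorderI[of 2])
    fix N :: nat assume N: "2 \<le> N"
    have "real (stored_integers (tr N) (fin N)) \<le> real (41 + 3 * Suc N ^ 4)"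
      using c[of N] N unfolding computes_def by (simp only: of_nat_le_iff)
    then show "norm (real (stored_integers (tr N) (fin N))) \<le> 89 * norm (real N ^ 4)"
      using pow(2)[OF N] by simp
  qed
  moreover have "(\<lambda>N. bit_operations M (tr N))
      \<in> O(\<lambda>N. real N ^ 7 * M (nat \<lceil>real N * log 2 (real N)\<rceil>))" if M: "multiplication_cost M" for M
  proof -
    obtain C where C: "C \<ge> 0" "\<And>b. M (64 * b) \<le> C * M b"
      using multiplication_cost_scale[OF M] by blast
    have mono: "mono M" and ge: "\<And>b. real b \<le> M b"
      using M unfolding multiplication_cost_def by blast+
    have pos: "0 \<le> M b" for b using ge[of b] by linarith
    show ?thesis
    proof (rule bigoI[of _ "51200 * C"], rule eventually_at_top_linorderI[of 2])
      fix N :: nat assume N: "2 \<le> N"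
      let ?X = "nat \<lceil>real N * log 2 (real N)\<rceil>"
      let ?b = "bits (int (value_bound (Suc N)))"
      have "real ?b \<le> 40 * (real N * log 2 (real N))" by (rule bits_value_bound[OF N])
      also have "\<dots> \<le> 40 * real ?X" by (intro mult_left_mono real_nat_ceiling_ge) simp
      also have "\<dots> \<le> real (64 * ?X)" by simp
      finally have "?b \<le> 64 * ?X" by (simp only: of_nat_le_iff)
      then have "M ?b \<le> C * M ?X" using monoD[OF mono] C(2) order.trans by blast
      have "bit_operations M (tr N) \<le> real (200 * Suc N ^ 7) * (2 * M ?b)"
        using c[of N] N M unfolding computes_def by simp
      also have "\<dots> \<le> (25600 * real N ^ 7) * (2 * (C * M ?X))"
        using pow(1)[OF N] \<open>M ?b \<le> C * M ?X\<close> pos[of ?b] by (intro mult_mono) auto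
      finally have "bit_operations M (tr N) \<le> 51200 * C * (real N ^ 7 * M ?X)" by (simp add: mult_ac)
      moreover have "0 \<le> bit_cost M i s" for i s by (cases i) (auto simp: pos)
      then have "0 \<le> bit_operations M (tr N)"
        unfolding bit_operations_def by (intro sum_list_nonneg) auto
      ultimately show "norm (bit_operations M (tr N)) \<le> 51200 * C * norm (real N ^ 7 * M ?X)"
        using pos[of ?X] by simp
    qed
  qed
  moreover have "(\<lambda>N. real (bit_storage (tr N) (fin N))) \<in> O(\<lambda>N. real N ^ 5 * log 2 (real N))"
  \<comment> \<open>7120 is \<open>89 * 2 * 40\<close>: locations in use, address and content, bits
    of the value bound.\<close>
  proof (rule bigoI[of _ 7120], rule eventually_at_top_linorderI[of 2])
    fix N :: nat assume N: "2 \<le> N"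
    let ?b = "bits (int (value_bound (Suc N)))"
    have "real (bit_storage (tr N) (fin N)) \<le> real ((41 + 3 * Suc N ^ 4) * (2 * ?b))"
      using c[of N] N unfolding computes_def by (simp only: of_nat_le_iff)
    also have "\<dots> = real (41 + 3 * Suc N ^ 4) * (2 * real ?b)"
      by (simp only: of_nat_mult of_nat_numeral)
    also have "\<dots> \<le> (89 * real N ^ 4) * (2 * (40 * (real N * log 2 (real N))))"
      using pow(2)[OF N] bits_value_bound[OF N] by (intro mult_mono) auto
    also have "\<dots> = 7120 * (real N ^ 5 * log 2 (real N))" by (simp add: power_numeral_reduce)
    finally show "norm (real (bit_storage (tr N) (fin N))) \<le> 7120 * norm (real N ^ 5 * log 2 (real N))"
      using N by simp
  qed
  ultimately show ?thesis
    using c unfolding computes_def by (intro exI[of _ table.program] exI[of _ tr] exI[of _ fin]) blast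
qed

end
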